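(* Let $(X,T)$ be a minimal topological dynamical system and let $\pi: X\to X_D$ be the factor map onto its maximal distal factor. Then $(X,T)$ is strongly $\mathcal{F}_t$-sensitive if and only if $\pi$ is not proximal.
   Context: A topological dynamical system $(X,T)$: compact metric space $(X,d)$, $T$ continuous surjective; minimal means every orbit is dense. A pair $(x,y)$ is proximal if $\inf_n d(T^nx,T^ny)=0$, otherwise distal; a system is distal if all pairs of distinct points are distal. The maximal distal factor $X_D$ is the distal factor of which every distal factor of $(X,T)$ is a factor. A factor map $\pi$ is proximal if every pair $(x,y)$ with $\pi(x)=\pi(y)$ is proximal. A set $F\subset\mathbb{Z}_+$ is thick if it contains arbitrarily long blocks of consecutive integers; $\mathcal{F}_t$ is the family of thick sets. $(X,T)$ is strongly $\mathcal{F}_t$-sensitive if there is $\delta>0$ such that for each nonempty open $U$ there are $x,y\in U$ with $\{n\in\mathbb{Z}_+: d(T^nx,T^ny)>\delta\}$ thick. *)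

theory Defs
  imports "HOL-Analysis.Analysis"
begin

definition TDS :: "'a::metric_space set \<Rightarrow> ('a \<Rightarrow> 'a) \<Rightarrow> bool" where
  "TDS X T \<longleftrightarrow> compact X \<and> continuous_on X T \<and> T ` X = X"

definition orbit :: "('a \<Rightarrow> 'a) \<Rightarrow> 'a \<Rightarrow> 'a set" where
  "orbit T x = {(T ^^ n) x | n. True}"

definition minimal :: "'a::metric_space set \<Rightarrow> ('a \<Rightarrow> 'a) \<Rightarrow> bool" where
  "minimal X T \<longleftrightarrow> X \<noteq> {} \<and> (\<forall>x\<in>X. closure (orbit T x) = X)"

definition proximal_pair :: "('a::metric_space \<Rightarrow> 'a) \<Rightarrow> 'a \<Rightarrow> 'a \<Rightarrow> bool" where
  "proximal_pair T x y \<longleftrightarrow> (INF n. dist ((T ^^ n) x) ((T ^^ n) y)) = 0"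

definition distal :: "'a::metric_space set \<Rightarrow> ('a \<Rightarrow> 'a) \<Rightarrow> bool" where
  "distal X T \<longleftrightarrow> (\<forall>x\<in>X. \<forall>y\<in>X. x \<noteq> y \<longrightarrow> \<not> proximal_pair T x y)"

definition factor_map ::
  "'a::metric_space set \<Rightarrow> ('a \<Rightarrow> 'a) \<Rightarrow> 'b::metric_space set \<Rightarrow> ('b \<Rightarrow> 'b) \<Rightarrow> ('a \<Rightarrow> 'b) \<Rightarrow> bool" where
  "factor_map X T Y S p \<longleftrightarrow> TDS X T \<and> TDS Y S \<and> continuous_on X p \<and> p ` X = Y \<and>
     (\<forall>x\<in>X. p (T x) = S (p x))"

text \<open>(Y,S) with factor map p is the maximal distal factor of (X,T): it is a distal factor,
  and every distal factor (Z,U) of (X,T), with factor map q, is a factor of (Y,S) via a factor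
  map r compatible with p and q.  Since every compact metric space embeds in the Hilbert cube,
  the competing factors Z are taken (up to conjugacy) inside the metric space nat \<Rightarrow> real
  (product topology).\<close>
definition maximal_distal_factor ::
  "'a::metric_space set \<Rightarrow> ('a \<Rightarrow> 'a) \<Rightarrow> 'b::metric_space set \<Rightarrow> ('b \<Rightarrow> 'b) \<Rightarrow> ('a \<Rightarrow> 'b) \<Rightarrow> bool" where
  "maximal_distal_factor X T Y S p \<longleftrightarrow> factor_map X T Y S p \<and> distal Y S \<and>
     (\<forall>(Z :: (nat \<Rightarrow> real) set) U q. factor_map X T Z U q \<and> distal Z U \<longrightarrow>
        (\<exists>r. factor_map Y S Z U r \<and> (\<forall>x\<in>X. r (p x) = q x)))"

definition proximal_factor_map :: "'a::metric_space set \<Rightarrow> ('a \<Rightarrow> 'a) \<Rightarrow> ('a \<Rightarrow> 'b) \<Rightarrow> bool" where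
  "proximal_factor_map X T p \<longleftrightarrow> (\<forall>x\<in>X. \<forall>y\<in>X. p x = p y \<longrightarrow> proximal_pair T x y)"

definition thick :: "nat set \<Rightarrow> bool" where
  "thick F \<longleftrightarrow> (\<forall>L. \<exists>m. {m..<m+L} \<subseteq> F)"

text \<open>Nonempty open subsets of X are the sets U \<inter> X with U open in the ambient space.\<close>
definition strongly_Ft_sensitive :: "'a::metric_space set \<Rightarrow> ('a \<Rightarrow> 'a) \<Rightarrow> bool" where
  "strongly_Ft_sensitive X T \<longleftrightarrow> (\<exists>\<delta>>0. \<forall>U. open U \<and> U \<inter> X \<noteq> {} \<longrightarrow>
     (\<exists>x\<in>U \<inter> X. \<exists>y\<in>U \<inter> X. thick {n. dist ((T ^^ n) x) ((T ^^ n) y) > \<delta>}))"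

end

theory Submission
  imports Defs
begin

text \<open>If \<open>X\<close> is sensitive, thick sets yield distal pairs \<open>(x', y')\<close> in the orbit closures of pairs
  \<open>(x, y)\<close> of arbitrarily close points. All pairs of the distal factor are almost periodic, so
  \<open>(x', y')\<close> can be moved, staying distal, to a pair over \<open>(\<pi> x, \<pi> y)\<close>; in the limit one gets a
  distal pair in a single fibre.

  Conversely, let \<open>X\<close> be insensitive; passing to the natural extension we may assume that \<open>T\<close> is a
  homeomorphism. Insensitivity says that nearby points are syndetically close, which makes
  proximality an equivalence relation. The fibres of \<open>\<pi>\<close> form the smallest closed invariant
  equivalence relation containing the proximal pairs. Let \<open>Q\<close> be the regionally proximal relation
  of \<open>\<pi>\<close>, and let \<open>R\<close> consist of the fibre pairs whose almost periodic shadow \<open>(u x, u y)\<close> lies in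
  \<open>Q\<close>. Category arguments (generic points of lower semicontinuity, locally constant gaps) show that
  \<open>R\<close> is again a closed invariant equivalence relation containing the proximal pairs, hence \<open>R\<close>
  is everything, and then so is \<open>Q\<close>. Thus a generic pair of a fibre is proximal, two
  points of a generic fibre pair share a proximal partner, and every fibre pair is proximal.\<close>

subsection \<open>Orbit closures\<close>

text \<open>The obstacle is that \<pi> need not be open: when one point of a fibre pair moves, its
  partner may be unable to follow. Regional proximality is therefore tested only on pairs over
  points where the fibre map is lower semicontinuous. Such points are comeager in X, and minimality
  spreads comeager sets to the orbit closures of almost periodic pairs and triples. This is what the
  idempotent u is good for: a single map, commuting with T, makes all pairs and triples almost
  periodic at once. Transitivity of regional proximality is obtained along almost periodic triples,
  which is why R is defined through shadows. A second obstacle is that insensitivity bounds the gaps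
  between close times by a number that depends on the pair, while perturbing the pair needs one
  bound for a whole box. The natural extension is needed because being far from regional proximality
  has to be forward invariant, and for this T must carry open boxes to open boxes.\<close>

definition almost_periodic :: "('a::topological_space \<Rightarrow> 'a) \<Rightarrow> 'a \<Rightarrow> bool" where
  "almost_periodic F w \<longleftrightarrow> (\<forall>v\<in>closure (orbit F w). w \<in> closure (orbit F v))"

lemma in_closure_orbit_iff:
  "v \<in> closure (orbit F w) \<longleftrightarrow> (\<forall>V. open V \<and> v \<in> V \<longrightarrow> (\<exists>n. (F ^^ n) w \<in> V))"
proof -
  have "v \<in> closure (orbit F w) \<longleftrightarrow> (\<forall>V. v \<in> V \<and> open V \<longrightarrow> orbit F w \<inter> V \<noteq> {})"
    by (auto simp: closure_iff_nhds_not_empty)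
  then show ?thesis by (auto simp: orbit_def)
qed

lemma funpow_in_closure_orbit: "(F ^^ n) w \<in> closure (orbit F w)"
  by (rule subsetD[OF closure_subset]) (auto simp: orbit_def)

lemma self_in_closure_orbit: "w \<in> closure (orbit F w)"
  using funpow_in_closure_orbit[where n = 0] by simp

lemma funpow_in: "F ` W \<subseteq> W \<Longrightarrow> w \<in> W \<Longrightarrow> (F ^^ n) w \<in> W"
  by (induction n) auto

lemma continuous_on_funpow:
  "continuous_on W F \<Longrightarrow> F ` W \<subseteq> W \<Longrightarrow> continuous_on W (F ^^ n)"
proof (induction n)
  case (Suc n)
  have "(F ^^ n) ` W \<subseteq> W" using funpow_in[OF Suc.prems(2)] by (simp add: image_subset_iff)
  then show ?case
    using Suc continuous_on_compose[of W "F ^^ n" F] continuous_on_subset[of W F] by simp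
qed simp

lemma closure_orbit_subset:
  assumes "closed C" "F ` C \<subseteq> C" "w \<in> C"
  shows "closure (orbit F w) \<subseteq> C"
  using assms funpow_in[OF assms(2,3)] by (intro closure_minimal) (auto simp: orbit_def)

lemma closure_orbit_invariant:
  assumes "closed W" "continuous_on W F" "F ` W \<subseteq> W" "w \<in> W"
  shows "F ` closure (orbit F w) \<subseteq> closure (orbit F w)"
proof (rule image_closure_subset)
  show "continuous_on (closure (orbit F w)) F"
    using closure_orbit_subset[OF assms(1,3,4)] assms(2) continuous_on_subset by blast
  have "F ` orbit F w \<subseteq> orbit F w"
    unfolding orbit_def by (auto intro: exI[of _ "Suc _"])
  then show "F ` orbit F w \<subseteq> closure (orbit F w)" using closure_subset by blast
qed simp

lemma closure_orbit_trans:
  assumes "closed W" "continuous_on W F" "F ` W \<subseteq> W" "w \<in> W"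
    and "v \<in> closure (orbit F w)"
  shows "closure (orbit F v) \<subseteq> closure (orbit F w)"
  by (rule closure_orbit_subset[OF _ closure_orbit_invariant[OF assms(1-4)] assms(5)]) simp

text \<open>This justifies reading \<open>almost_periodic\<close> as minimality of the orbit
  closure: a point may be exchanged for any other point of its orbit closure, and one can always
  return.\<close>

lemma almost_periodic_closure_orbit:
  assumes "closed W" "continuous_on W F" "F ` W \<subseteq> W" "w \<in> W"
    and "almost_periodic F w" "v \<in> closure (orbit F w)"
  shows "closure (orbit F v) = closure (orbit F w)" "almost_periodic F v"
proof -
  have v: "v \<in> W" using closure_orbit_subset[OF assms(1,3,4)] assms(6) by blast
  have "w \<in> closure (orbit F v)" using assms(5,6) by (auto simp: almost_periodic_def)
  then show eq: "closure (orbit F v) = closure (orbit F w)"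
    using closure_orbit_trans[OF assms(1-3)] assms(4,6) v by blast
  show "almost_periodic F v"
    unfolding almost_periodic_def
  proof
    fix x assume x: "x \<in> closure (orbit F v)"
    then have "w \<in> closure (orbit F x)" using assms(5) eq by (auto simp: almost_periodic_def)
    moreover have "x \<in> W" using closure_orbit_subset[OF assms(1,3) v] x by blast
    ultimately have "closure (orbit F w) \<subseteq> closure (orbit F x)"
      using closure_orbit_trans[OF assms(1-3)] by blast
    then show "v \<in> closure (orbit F x)" using assms(6) by blast
  qed
qed

lemma funpow_semiconj:
  assumes "\<And>x. x \<in> W \<Longrightarrow> \<phi> (F x) = S (\<phi> x)" "F ` W \<subseteq> W" "w \<in> W"
  shows "\<phi> ((F ^^ n) w) = (S ^^ n) (\<phi> w)"
  by (induction n) (auto simp: assms funpow_in[OF assms(2,3)])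

lemma image_closure_orbit_subset:
  assumes "closed W" "F ` W \<subseteq> W" "w \<in> W" "continuous_on W \<phi>"
    and "\<And>x. x \<in> W \<Longrightarrow> \<phi> (F x) = S (\<phi> x)"
  shows "\<phi> ` closure (orbit F w) \<subseteq> closure (orbit S (\<phi> w))"
proof (rule image_closure_subset)
  show "continuous_on (closure (orbit F w)) \<phi>"
    using closure_orbit_subset[OF assms(1,2,3)] assms(4) continuous_on_subset by blast
  show "\<phi> ` orbit F w \<subseteq> closure (orbit S (\<phi> w))"
  proof -
    have "\<phi> ((F ^^ n) w) = (S ^^ n) (\<phi> w)" for n
      by (rule funpow_semiconj[where W = W]) (fact assms)+
    then show ?thesis
      using funpow_in_closure_orbit[of _ S "\<phi> w"] by (auto simp: orbit_def)
  qed
qed simp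

lemma image_closure_orbit:
  fixes S :: "'b::t2_space \<Rightarrow> 'b"
  assumes "compact W" "closed W" "F ` W \<subseteq> W" "w \<in> W" "continuous_on W \<phi>"
    and "\<And>x. x \<in> W \<Longrightarrow> \<phi> (F x) = S (\<phi> x)"
  shows "\<phi> ` closure (orbit F w) = closure (orbit S (\<phi> w))"
proof
  show "\<phi> ` closure (orbit F w) \<subseteq> closure (orbit S (\<phi> w))"
    by (rule image_closure_orbit_subset[of W]) (use assms in auto)
  have sub: "closure (orbit F w) \<subseteq> W" by (rule closure_orbit_subset[OF assms(2-4)])
  have "compact (closure (orbit F w))"
    using compact_Int_closed[OF assms(1) closed_closure, of "orbit F w"] sub
    by (simp add: inf.absorb2)
  then have "closed (\<phi> ` closure (orbit F w))"
    by (intro compact_imp_closed compact_continuous_image continuous_on_subset[OF assms(5) sub])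
  moreover have "orbit S (\<phi> w) \<subseteq> \<phi> ` closure (orbit F w)"
  proof -
    have "\<phi> ((F ^^ n) w) = (S ^^ n) (\<phi> w)" for n
      by (rule funpow_semiconj[where W = W]) (fact assms)+
    then show ?thesis
      using funpow_in_closure_orbit[of _ F w] by (auto simp: orbit_def) (metis image_eqI)
  qed
  ultimately show "closure (orbit S (\<phi> w)) \<subseteq> \<phi> ` closure (orbit F w)"
    by (rule closure_minimal[rotated])
qed

text \<open>By compactness the image of an orbit closure is a full orbit closure. So v lifts to some
  z, which returns to w, and the image of this return is the one required.\<close>

lemma almost_periodic_image:
  fixes S :: "'b::t2_space \<Rightarrow> 'b"
  assumes "compact W" "closed W" "F ` W \<subseteq> W" "w \<in> W" "continuous_on W \<phi>"
    and "\<And>x. x \<in> W \<Longrightarrow> \<phi> (F x) = S (\<phi> x)"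
    and "almost_periodic F w"
  shows "almost_periodic S (\<phi> w)"
  unfolding almost_periodic_def
proof
  fix v assume "v \<in> closure (orbit S (\<phi> w))"
  then obtain z where z: "z \<in> closure (orbit F w)" "v = \<phi> z"
    using image_closure_orbit[OF assms(1-6)] by blast
  then have "w \<in> closure (orbit F z)" using assms(7) by (auto simp: almost_periodic_def)
  moreover have "z \<in> W" using closure_orbit_subset[OF assms(2-4)] z by blast
  ultimately show "\<phi> w \<in> closure (orbit S v)"
    using image_closure_orbit_subset[OF assms(2,3) _ assms(5,6), of z] z by blast
qed

subsection \<open>Minimal idempotents of the Ellis semigroup\<close>

lemma Inter_in_finite_chain:
  assumes "finite F" "F \<noteq> {}" "\<And>C D. C \<in> F \<Longrightarrow> D \<in> F \<Longrightarrow> C \<subseteq> D \<or> D \<subseteq> C"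
  shows "\<Inter>F \<in> F"
  using assms
proof (induction rule: finite_ne_induct)
  case (insert C F)
  then have IH: "\<Inter>F \<in> F" by blast
  then have "C \<subseteq> \<Inter>F \<or> \<Inter>F \<subseteq> C" using insert.prems by blast
  then show ?case
  proof
    assume "C \<subseteq> \<Inter>F"
    then have "\<Inter>(insert C F) = C" by blast
    then show ?thesis by simp
  next
    assume "\<Inter>F \<subseteq> C"
    then have "\<Inter>(insert C F) = \<Inter>F" by blast
    then show ?thesis using IH by simp
  qed
qed simp

text \<open>The finite intersection property in K keeps intersections of chains nonempty. The
  property \<open>P\<close> is left open because the lemma serves twice, for invariant sets and for
  subsemigroups.\<close>

lemma minimal_closed_subset:
  fixes K :: "'a::topological_space set"
  assumes K: "compact K" "closed K" "K \<noteq> {}" "P K"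
    and Int: "\<And>\<C>. \<C> \<noteq> {} \<Longrightarrow> (\<And>C. C \<in> \<C> \<Longrightarrow> closed C \<and> P C) \<Longrightarrow> P (\<Inter>\<C>)"
  shows "\<exists>M. closed M \<and> M \<noteq> {} \<and> M \<subseteq> K \<and> P M \<and>
    (\<forall>C. closed C \<longrightarrow> C \<noteq> {} \<longrightarrow> C \<subseteq> M \<longrightarrow> P C \<longrightarrow> C = M)"
proof -
  \<comment> \<open>Complements reverse inclusion, so a maximal element from
    \<open>subset_Zorn\<close> is the complement of a minimal closed set.\<close>
  define A where "A = {-C |C. closed C \<and> C \<noteq> {} \<and> C \<subseteq> K \<and> P C}"
  have "\<exists>M\<in>A. \<forall>X\<in>A. M \<subseteq> X \<longrightarrow> X = M"
  proof (rule subset_Zorn)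
    fix \<D> assume ch: "subset.chain A \<D>"
    show "\<exists>U\<in>A. \<forall>X\<in>\<D>. X \<subseteq> U"
    proof (cases "\<D> = {}")
      case True
      have "-K \<in> A" using K by (auto simp: A_def)
      then show ?thesis using True by blast
    next
      case False
      define \<C> where "\<C> = uminus ` \<D>"
      have C: "closed C \<and> C \<noteq> {} \<and> C \<subseteq> K \<and> P C" if "C \<in> \<C>" for C
        using that ch by (auto simp: \<C>_def A_def subset.chain_def)
      have Cch: "C \<subseteq> D \<or> D \<subseteq> C" if "C \<in> \<C>" "D \<in> \<C>" for C D
        using that ch unfolding \<C>_def subset_chain_def by blast
      have "K \<inter> \<Inter>\<C> \<noteq> {}"
      proof (rule compact_imp_fip[OF K(1)])
        show "closed T" if "T \<in> \<C>" for T using C that by blast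
        fix F' assume F: "finite F'" "F' \<subseteq> \<C>"
        show "K \<inter> \<Inter>F' \<noteq> {}"
        proof (cases "F' = {}")
          case False
          have "\<Inter>F' \<in> F'"
            using Inter_in_finite_chain[OF F(1) False] Cch F(2) by (meson subsetD)
          then show ?thesis using C F by blast
        qed (use K in auto)
      qed
      then have "\<Inter>\<C> \<noteq> {}" by blast
      moreover have "\<Inter>\<C> \<subseteq> K" using C False by (auto simp: \<C>_def)
      moreover have "closed (\<Inter>\<C>)" using C by blast
      moreover have "P (\<Inter>\<C>)" using C False by (intro Int) (auto simp: \<C>_def)
      ultimately have "- \<Inter>\<C> \<in> A" by (auto simp: A_def)
      moreover have "X \<subseteq> - \<Inter>\<C>" if "X \<in> \<D>" for X using that by (auto simp: \<C>_def)
      ultimately show ?thesis by blast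
    qed
  qed
  then obtain M where M: "M \<in> A" "\<And>X. X \<in> A \<Longrightarrow> M \<subseteq> X \<Longrightarrow> X = M" by blast
  show ?thesis
  proof (intro exI[of _ "-M"] conjI allI impI)
    show "closed (-M)" "-M \<noteq> {}" "-M \<subseteq> K" "P (-M)" using M(1) by (auto simp: A_def)
    fix C assume C: "closed C" "C \<noteq> {}" "C \<subseteq> -M" "P C"
    with M(1) have "-C \<in> A" by (auto simp: A_def)
    then show "C = -M" using M(2)[of "-C"] C(3) by blast
  qed
qed

text \<open>Both this map and \<open>ellis_space\<close> freeze all coordinates outside X. The
  function space thus becomes a product of compact sets that contains \<open>id\<close>, and the
  orbit of \<open>id\<close> agrees on X with the iterates of T.\<close>

definition ellis_step :: "'a set \<Rightarrow> ('a \<Rightarrow> 'a) \<Rightarrow> ('a \<Rightarrow> 'a) \<Rightarrow> 'a \<Rightarrow> 'a" where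
  "ellis_step X T q = (\<lambda>x. if x \<in> X then T (q x) else x)"

definition ellis_space :: "'a set \<Rightarrow> ('a \<Rightarrow> 'a) set" where
  "ellis_space X = {q. (\<forall>x\<in>X. q x \<in> X) \<and> (\<forall>x. x \<notin> X \<longrightarrow> q x = x)}"

text \<open>The index set may be uncountable, so the function space need not be metrizable; what
  matters is that a product of Hausdorff spaces is Hausdorff.\<close>

lemma compact_imp_closed_fun:
  fixes K :: "('a \<Rightarrow> 'b::metric_space) set"
  assumes "compact K"
  shows "closed K"
proof -
  have "Hausdorff_space (product_topology (\<lambda>_::'a. euclidean :: 'b topology) UNIV)"
    by (simp add: Hausdorff_space_product_topology)
  then have "Hausdorff_space (euclidean :: ('a \<Rightarrow> 'b) topology)"
    by (simp add: euclidean_product_topology)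
  then show ?thesis
    using compactin_imp_closedin[of euclidean K] assms by simp
qed

lemma compact_ellis_space:
  fixes X :: "'a::metric_space set"
  assumes "compact X"
  shows "compact (ellis_space X)" "closed (ellis_space X)"
proof -
  have eq: "ellis_space X = Pi\<^sub>E UNIV (\<lambda>x. if x \<in> X then X else {x})"
    by (auto simp: ellis_space_def PiE_iff split: if_splits)
  have "compactin (product_topology (\<lambda>_. euclidean) UNIV) (ellis_space X)"
    unfolding eq by (subst compactin_PiE) (use assms in auto)
  then show "compact (ellis_space X)" by (simp add: euclidean_product_topology)
  then show "closed (ellis_space X)" by (rule compact_imp_closed_fun)
qed

lemma continuous_on_eval: "continuous_on K (\<lambda>q. q x)"
  by (rule continuous_on_subset[OF continuous_on_product_coordinates]) simp

lemma ellis_step_continuous: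
  assumes "continuous_on X T" "T ` X \<subseteq> X"
  shows "continuous_on (ellis_space X) (ellis_step X T)"
    "ellis_step X T ` ellis_space X \<subseteq> ellis_space X"
proof -
  show "continuous_on (ellis_space X) (ellis_step X T)"
  proof (rule continuous_on_coordinatewise_then_product)
    fix x show "continuous_on (ellis_space X) (\<lambda>q. ellis_step X T q x)"
    proof (cases "x \<in> X")
      case True
      then have "(\<lambda>q. q x) ` ellis_space X \<subseteq> X" by (auto simp: ellis_space_def)
      then have "continuous_on (ellis_space X) (\<lambda>q. T (q x))"
        by (intro continuous_on_compose2[OF assms(1) continuous_on_eval])
      then show ?thesis using True by (simp add: ellis_step_def)
    qed (simp add: ellis_step_def)
  qed
  show "ellis_step X T ` ellis_space X \<subseteq> ellis_space X"
    using assms(2) by (auto simp: ellis_space_def ellis_step_def)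
qed

text \<open>A minimal subsystem of the function space is a minimal left ideal of the Ellis semigroup, and
  a minimal closed subsemigroup of it consists of a single idempotent.\<close>

lemma ellis_idempotent:
  fixes X :: "'a::metric_space set"
  assumes X: "compact X" "continuous_on X T" "T ` X \<subseteq> X"
  obtains u where "u \<in> ellis_space X" "u \<circ> u = u"
    "u \<in> closure (orbit (ellis_step X T) id)" "almost_periodic (ellis_step X T) u"
proof -
  let ?E = "ellis_space X" and ?F = "ellis_step X T"
  note E = compact_ellis_space[OF X(1)] and F = ellis_step_continuous[OF X(2,3)]
  have id: "id \<in> ?E" by (auto simp: ellis_space_def)
  define K where "K = closure (orbit ?F id)"
  have KE: "K \<subseteq> ?E" unfolding K_def by (rule closure_orbit_subset[OF E(2) F(2) id])
  have Kc: "compact K"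
    using compact_Int_closed[OF E(1), of K] KE by (simp add: K_def inf.absorb2)
  have FK: "?F ` K \<subseteq> K" unfolding K_def by (rule closure_orbit_invariant[OF E(2) F(1,2) id])
  have Kne: "K \<noteq> {}" using self_in_closure_orbit[of id ?F] unfolding K_def by (metis empty_iff)
  have Kcl: "closed K" unfolding K_def by (rule closed_closure)
  have Int: "?F ` \<Inter>\<C> \<subseteq> \<Inter>\<C>"
    if "\<C> \<noteq> {}" "\<And>C. C \<in> \<C> \<Longrightarrow> closed C \<and> ?F ` C \<subseteq> C" for \<C>
    using that(2) by blast
  from minimal_closed_subset[of K "\<lambda>C. ?F ` C \<subseteq> C", OF Kc Kcl Kne FK Int]
  obtain L where "closed L \<and> L \<noteq> {} \<and> L \<subseteq> K \<and> ?F ` L \<subseteq> L \<and>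
    (\<forall>C. closed C \<longrightarrow> C \<noteq> {} \<longrightarrow> C \<subseteq> L \<longrightarrow> ?F ` C \<subseteq> C \<longrightarrow> C = L)" ..
  then have L: "closed L" "L \<noteq> {}" "L \<subseteq> K" "?F ` L \<subseteq> L"
    "\<And>C. closed C \<Longrightarrow> C \<noteq> {} \<Longrightarrow> C \<subseteq> L \<Longrightarrow> ?F ` C \<subseteq> C \<Longrightarrow> C = L"
    by simp_all
  have LE: "L \<subseteq> ?E" using L(3) KE by blast
  have Lc: "compact L" using compact_Int_closed[OF Kc L(1)] L(3) by (simp add: inf.absorb2)
  have Lorb: "closure (orbit ?F q) = L" if "q \<in> L" for q
  proof (rule L(5))
    show "closure (orbit ?F q) \<noteq> {}" using self_in_closure_orbit[of q ?F] by (metis empty_iff)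
    show "closure (orbit ?F q) \<subseteq> L" by (rule closure_orbit_subset[OF L(1,4) that])
    show "?F ` closure (orbit ?F q) \<subseteq> closure (orbit ?F q)"
      by (rule closure_orbit_invariant[OF E(2) F(1,2) subsetD[OF LE that]])
  qed simp
  have rc: "continuous_on UNIV (\<lambda>p. p \<circ> q)" for q :: "'a \<Rightarrow> 'a"
    by (rule continuous_on_coordinatewise_then_product) (simp add: continuous_on_eval)
  \<comment> \<open>Right composition commutes with the step map, so it carries the orbit of
    \<open>id\<close> to the orbit of q. Hence p composed with q stays in the orbit closure of q,
    which is L.\<close>
  have Fcomp: "?F p \<circ> q = ?F (p \<circ> q)" if "p \<in> ?E" "q \<in> ?E" for p q
    using that by (force simp: ellis_step_def ellis_space_def)
  have comp_L: "p \<circ> q \<in> L" if "p \<in> L" "q \<in> L" for p q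
  proof -
    have cont: "continuous_on ?E (\<lambda>p. p \<circ> q)" by (rule continuous_on_subset[OF rc]) simp
    have eq: "?F p \<circ> q = ?F (p \<circ> q)" if "p \<in> ?E" for p
      by (rule Fcomp[OF that subsetD[OF LE \<open>q \<in> L\<close>]])
    have "(\<lambda>p. p \<circ> q) ` closure (orbit ?F id) \<subseteq> closure (orbit ?F (id \<circ> q))"
      using image_closure_orbit_subset[where W = ?E and F = ?F and w = id and S = ?F
          and \<phi> = "\<lambda>p. p \<circ> q", OF E(2) F(2) id cont eq] by simp
    moreover have "p \<in> closure (orbit ?F id)" using subsetD[OF L(3) that(1)] by (simp add: K_def)
    ultimately have "p \<circ> q \<in> closure (orbit ?F (id \<circ> q))"
      by (rule subsetD[OF _ imageI])
    then show ?thesis using Lorb[OF that(2)] by simp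
  qed
  have comp_closed: "closed ((\<lambda>p. p \<circ> q) ` B)" if "closed B" "B \<subseteq> L" for B and q :: "'a \<Rightarrow> 'a"
  proof -
    have "compact B" using compact_Int_closed[OF Lc that(1)] that(2) by (simp add: inf.absorb2)
    moreover have "continuous_on B (\<lambda>p. p \<circ> q)" by (rule continuous_on_subset[OF rc]) simp
    ultimately show ?thesis by (intro compact_imp_closed_fun compact_continuous_image)
  qed
  let ?P = "\<lambda>C :: ('a \<Rightarrow> 'a) set. \<forall>p\<in>C. \<forall>q\<in>C. p \<circ> q \<in> C"
  have Int: "?P (\<Inter>\<C>)"
    if "\<C> \<noteq> {}" "\<And>C. C \<in> \<C> \<Longrightarrow> closed C \<and> ?P C" for \<C>
  proof (intro ballI InterI)
    fix p q C assume "p \<in> \<Inter>\<C>" "q \<in> \<Inter>\<C>" "C \<in> \<C>"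
    then have "p \<in> C" "q \<in> C" by (simp_all only: Inter_iff)
    then show "p \<circ> q \<in> C" using that(2)[OF \<open>C \<in> \<C>\<close>] by simp
  qed
  have "?P L" using comp_L by simp
  from minimal_closed_subset[of L ?P, OF Lc L(1,2) this Int]
  obtain B where "closed B \<and> B \<noteq> {} \<and> B \<subseteq> L \<and> ?P B \<and>
    (\<forall>C. closed C \<longrightarrow> C \<noteq> {} \<longrightarrow> C \<subseteq> B \<longrightarrow> ?P C \<longrightarrow> C = B)" ..
  then have B: "closed B" "B \<noteq> {}" "B \<subseteq> L" "?P B"
    "\<And>C. closed C \<Longrightarrow> C \<noteq> {} \<Longrightarrow> C \<subseteq> B \<Longrightarrow> ?P C \<Longrightarrow> C = B"
    by simp_all
  obtain u where u: "u \<in> B" using B(2) by blast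
  \<comment> \<open>The right translate of B by u is again a closed subsemigroup in B, so by
    minimality some v in B satisfies \<open>v \<circ> u = u\<close>. All such v form a closed
    subsemigroup too, hence all of B, which contains u itself.\<close>
  have "(\<lambda>p. p \<circ> u) ` B = B"
  proof (rule B(5))
    have "(p \<circ> u) \<circ> (q \<circ> u) \<in> (\<lambda>p. p \<circ> u) ` B" if "p \<in> B" "q \<in> B" for p q
    proof (rule image_eqI)
      show "(p \<circ> u) \<circ> (q \<circ> u) = (p \<circ> u \<circ> q) \<circ> u" by (simp add: o_assoc)
      show "p \<circ> u \<circ> q \<in> B" using B(4) u that by simp
    qed
    then show "?P ((\<lambda>p. p \<circ> u) ` B)" by (simp only: ball_simps) simp
    show "closed ((\<lambda>p. p \<circ> u) ` B)" by (rule comp_closed[OF B(1,3)])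
    show "(\<lambda>p. p \<circ> u) ` B \<noteq> {}" using B(2) by simp
    show "(\<lambda>p. p \<circ> u) ` B \<subseteq> B" using B(4) u by (simp add: image_subset_iff)
  qed
  with u have "u \<in> (\<lambda>p. p \<circ> u) ` B" by simp
  then obtain v where v: "v \<in> B" "v \<circ> u = u" by (metis imageE)
  define C where "C = {p \<in> B. p \<circ> u = u}"
  have "C = B"
  proof (rule B(5))
    have "{p. p \<circ> u = u} = (\<Inter>x. (\<lambda>p. p (u x)) -` {u x})"
      unfolding fun_eq_iff by auto
    moreover have "closed ((\<lambda>p. p (u x)) -` {u x})" for x
      by (rule closed_vimage) (simp_all add: continuous_on_eval)
    ultimately have "closed {p. p \<circ> u = u}" by (simp add: closed_INT)
    then show "closed C" using B(1) by (simp add: C_def Collect_conj_eq closed_Int)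
    have "p \<circ> q \<circ> u = u" if "p \<circ> u = u" "q \<circ> u = u" for p q
      using that by (simp add: comp_assoc)
    then show "?P C" using B(4) by (simp add: C_def)
    show "C \<noteq> {}" using v by (metis (mono_tags, lifting) C_def empty_iff mem_Collect_eq)
    show "C \<subseteq> B" by (simp add: C_def)
  qed
  with u have "u \<in> C" by simp
  then have uu: "u \<circ> u = u" by (simp add: C_def)
  have uL: "u \<in> L" by (rule subsetD[OF B(3) u])
  have "almost_periodic ?F u"
    unfolding almost_periodic_def
  proof
    fix v assume "v \<in> closure (orbit ?F u)"
    then have "v \<in> L" using Lorb[OF uL] by simp
    then show "u \<in> closure (orbit ?F v)" using Lorb uL by simp
  qed
  moreover have "u \<in> ?E" by (rule subsetD[OF LE uL])
  moreover have "u \<in> closure (orbit ?F id)" using subsetD[OF L(3) uL] by (simp only: K_def)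
  ultimately show thesis using that uu by simp
qed

subsection \<open>Comeager sets\<close>

definition comeager_in :: "'a::topological_space set \<Rightarrow> 'a set \<Rightarrow> bool" where
  "comeager_in X D \<longleftrightarrow> (\<exists>U :: nat \<Rightarrow> 'a set.
     (\<forall>i. open (U i) \<and> (\<forall>V. open V \<longrightarrow> V \<inter> X \<noteq> {} \<longrightarrow> V \<inter> X \<inter> U i \<noteq> {})) \<and> X \<inter> (\<Inter>i. U i) \<subseteq> D)"

lemma comeager_inI:
  assumes "\<And>i::nat. open (U i)" "\<And>i V. open V \<Longrightarrow> V \<inter> X \<noteq> {} \<Longrightarrow> V \<inter> X \<inter> U i \<noteq> {}"
    and "X \<inter> (\<Inter>i. U i) \<subseteq> D"
  shows "comeager_in X D"
  unfolding comeager_in_def by (rule exI[of _ U]) (use assms in simp)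

lemma comeager_in_open:
  assumes "open U" "\<And>V. open V \<Longrightarrow> V \<inter> X \<noteq> {} \<Longrightarrow> V \<inter> X \<inter> U \<noteq> {}"
  shows "comeager_in X U"
  unfolding comeager_in_def by (rule exI[of _ "\<lambda>_. U"]) (use assms in auto)

lemma comeager_in_mono: "comeager_in X D \<Longrightarrow> X \<inter> D \<subseteq> E \<Longrightarrow> comeager_in X E"
  unfolding comeager_in_def by (elim ex_forward conj_forward) blast+

lemma comeager_in_INT:
  assumes "\<And>i::nat. comeager_in X (D i)"
  shows "comeager_in X (\<Inter>i. D i)"
proof -
  have "\<forall>i. \<exists>U :: nat \<Rightarrow> 'a set.
     (\<forall>j. open (U j) \<and> (\<forall>V. open V \<longrightarrow> V \<inter> X \<noteq> {} \<longrightarrow> V \<inter> X \<inter> U j \<noteq> {})) \<and> X \<inter> (\<Inter>j. U j) \<subseteq> D i"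
    using assms unfolding comeager_in_def by (rule allI)
  then obtain U :: "nat \<Rightarrow> nat \<Rightarrow> 'a set" where U: "\<And>i. (\<forall>j. open (U i j) \<and>
      (\<forall>V. open V \<longrightarrow> V \<inter> X \<noteq> {} \<longrightarrow> V \<inter> X \<inter> U i j \<noteq> {})) \<and> X \<inter> (\<Inter>j. U i j) \<subseteq> D i"
    by metis
  show ?thesis
    unfolding comeager_in_def
  proof (intro exI[of _ "\<lambda>k. U (fst (prod_decode k)) (snd (prod_decode k))"] conjI)
    show "X \<inter> (\<Inter>k. U (fst (prod_decode k)) (snd (prod_decode k))) \<subseteq> (\<Inter>i. D i)"
    proof (rule subsetI, rule INT_I)
      fix x i assume x: "x \<in> X \<inter> (\<Inter>k. U (fst (prod_decode k)) (snd (prod_decode k)))"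
      then have "x \<in> U (fst (prod_decode k)) (snd (prod_decode k))" for k by blast
      from this[of "prod_encode (i, _)"] have "x \<in> U i j" for j by simp
      then show "x \<in> D i" using U[of i] x by blast
    qed
  qed (use U in blast)
qed

lemma comeager_in_Int:
  assumes "comeager_in X A" "comeager_in X B"
  shows "comeager_in X (A \<inter> B)"
proof -
  have "comeager_in X (\<Inter>i::nat. if i = 0 then A else B)"
    by (rule comeager_in_INT) (use assms in auto)
  then show ?thesis by (rule comeager_in_mono) (auto split: if_splits)
qed

lemma comeager_in_dense:
  fixes X :: "'a::metric_space set"
  assumes "compact X" "comeager_in X D" "open V" "V \<inter> X \<noteq> {}"
  obtains x where "x \<in> V" "x \<in> X" "x \<in> D"
proof -
  obtain U :: "nat \<Rightarrow> 'a set" where U: "\<And>i. open (U i)"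
    "\<And>i V. open V \<Longrightarrow> V \<inter> X \<noteq> {} \<Longrightarrow> V \<inter> X \<inter> U i \<noteq> {}" "X \<inter> (\<Inter>i. U i) \<subseteq> D"
    using assms(2) unfolding comeager_in_def by metis
  have "top_of_set X closure_of \<Inter>(range (\<lambda>i. X \<inter> U i)) = topspace (top_of_set X)"
  proof (rule Baire_category)
    have "compact_space (top_of_set X)" by (simp add: assms(1) compact_space_subtopology)
    moreover have "Hausdorff_space (top_of_set X)" by (simp add: Hausdorff_space_subtopology)
    ultimately show "completely_metrizable_space (top_of_set X) \<or>
        locally_compact_space (top_of_set X) \<and> regular_space (top_of_set X)"
      by (simp add: compact_imp_locally_compact_space compact_Hausdorff_imp_regular_space)
    fix T assume "T \<in> range (\<lambda>i. X \<inter> U i)"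
    then obtain i where i: "T = X \<inter> U i" by auto
    have "X \<subseteq> closure (X \<inter> U i)"
    proof
      fix x assume "x \<in> X"
      then show "x \<in> closure (X \<inter> U i)"
        using U(2)[of _ i] by (auto simp: closure_iff_nhds_not_empty)
    qed
    then show "openin (top_of_set X) T \<and> top_of_set X closure_of T = topspace (top_of_set X)"
      using U(1)[of i] by (auto simp: i closure_of_subtopology openin_open)
  qed auto
  moreover have "\<Inter>(range (\<lambda>i. X \<inter> U i)) = X \<inter> (\<Inter>i. U i)" by auto
  ultimately have "X \<subseteq> closure (X \<inter> (\<Inter>i. U i))"
    by (simp add: closure_of_subtopology) (metis Int_lower1 inf.absorb_iff2 inf.left_idem inf_commute)
  then obtain x where "x \<in> X \<inter> (\<Inter>i. U i)" "x \<in> V"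
    using assms(3,4) by (meson disjoint_iff open_Int_closure_eq_empty subset_iff)
  then show thesis using U(3) that by blast
qed

lemma compact_countable_basis:
  fixes X :: "'a::metric_space set"
  assumes "compact X"
  obtains B :: "nat \<Rightarrow> 'a set" where "\<And>i. open (B i)"
    "\<And>x V. x \<in> X \<Longrightarrow> open V \<Longrightarrow> x \<in> V \<Longrightarrow> \<exists>i. x \<in> B i \<and> closure (B i) \<subseteq> V"
proof -
  have "\<exists>F. finite F \<and> X \<subseteq> (\<Union>c\<in>F. ball c (1 / Suc n))" for n
    using assms unfolding compact_eq_totally_bounded by (simp del: of_nat_Suc)
  then obtain F where F: "\<And>n. finite (F n)" "\<And>n. X \<subseteq> (\<Union>c\<in>F n. ball c (1 / Suc n))"
    by metis
  \<comment> \<open>Balls around finite nets; the empty set is added so that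
    \<open>from_nat_into\<close> always enumerates a nonempty family.\<close>
  define \<B> where "\<B> = insert {} (\<Union>n. (\<lambda>c. ball c (1 / Suc n)) ` F n)"
  have c: "countable \<B>" "\<B> \<noteq> {}" unfolding \<B>_def using F(1) by (auto intro: countable_finite)
  show thesis
  proof (rule that[of "from_nat_into \<B>"])
    show "open (from_nat_into \<B> i)" for i
      using from_nat_into[OF c(2), of i] by (auto simp: \<B>_def)
    fix x V assume x: "x \<in> X" "open V" "x \<in> V"
    then obtain e where e: "e > 0" "ball x e \<subseteq> V" by (meson open_contains_ball)
    \<comment> \<open>With a radius below e/2, any point of the closed ball around c is less than e
      away from x.\<close>
    obtain n where n: "1 / Suc n < e / 2" using nat_approx_posE[of "e/2"] e(1) by auto
    obtain c where c': "c \<in> F n" "x \<in> ball c (1 / Suc n)" using F(2)[of n] x by auto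
    have "closure (ball c (1 / Suc n)) \<subseteq> cball c (1 / Suc n)" by (simp add: closure_minimal ball_subset_cball)
    also have "\<dots> \<subseteq> ball x e"
    proof
      fix y assume "y \<in> cball c (1 / Suc n)"
      then show "y \<in> ball x e"
        using n c'(2) dist_triangle[of x y c] by (simp add: dist_commute)
    qed
    finally have "closure (ball c (1 / Suc n)) \<subseteq> V" using e by blast
    moreover have "ball c (1 / Suc n) \<in> \<B>" using c' by (auto simp: \<B>_def)
    then obtain i where "from_nat_into \<B> i = ball c (1 / Suc n)"
      using from_nat_into_surj[OF c(1)] by blast
    ultimately show "\<exists>i. x \<in> from_nat_into \<B> i \<and> closure (from_nat_into \<B> i) \<subseteq> V" using c' by metis
  qed
qed

text \<open>The section map of a compact relation is upper semicontinuous, hence lower semicontinuous at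
  all points of a comeager set.\<close>

definition lsc_at :: "'a::topological_space set \<Rightarrow> ('a \<times> 'b::topological_space) set \<Rightarrow> 'a \<Rightarrow> bool" where
  "lsc_at X C x \<longleftrightarrow> (\<forall>z V. (x, z) \<in> C \<longrightarrow> open V \<longrightarrow> z \<in> V \<longrightarrow>
     (\<exists>W. open W \<and> x \<in> W \<and> (\<forall>x'\<in>W \<inter> X. \<exists>z'\<in>V. (x', z') \<in> C)))"

text \<open>The points whose section meets the closure of \<open>B i\<close> form a closed set
  \<open>F i\<close>, a projection of a compact set. Its relative boundary is nowhere dense. Off all
  these boundaries, a point of the section in \<open>B i\<close> forces a whole neighbourhood into
  \<open>F i\<close>, which is lower semicontinuity.\<close>

lemma comeager_lsc_at:
  fixes X :: "'a::metric_space set" and Z :: "'b::metric_space set"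
  assumes "compact Z" "compact C" "C \<subseteq> X \<times> Z"
  shows "comeager_in X {x. lsc_at X C x}"
proof -
  obtain B where B: "\<And>i::nat. open (B i)"
    "\<And>x V. x \<in> Z \<Longrightarrow> open V \<Longrightarrow> x \<in> V \<Longrightarrow> \<exists>i. x \<in> B i \<and> closure (B i) \<subseteq> V"
    using compact_countable_basis[OF assms(1)] by metis
  define F where "F i = fst ` (C \<inter> (UNIV \<times> closure (B i)))" for i
  define I where "I i = \<Union>{W. open W \<and> W \<inter> X \<subseteq> F i}" for i
  have F: "closed (F i)" for i unfolding F_def
    by (intro compact_imp_closed compact_continuous_image compact_Int_closed assms continuous_on_fst
        continuous_on_id closed_Times closed_UNIV closed_closure)
  have "comeager_in X (I i \<union> - F i)" for i
  proof (rule comeager_in_open)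
    show "open (I i \<union> - F i)" using F by (auto simp: I_def)
    fix V assume "open V" "V \<inter> X \<noteq> {}"
    then show "V \<inter> X \<inter> (I i \<union> - F i) \<noteq> {}" by (cases "V \<inter> X \<subseteq> F i") (auto simp: I_def)
  qed
  then have "comeager_in X (\<Inter>i. I i \<union> - F i)" by (rule comeager_in_INT)
  then show ?thesis
  proof (rule comeager_in_mono, intro subsetI CollectI)
    fix x assume x: "x \<in> X \<inter> (\<Inter>i. I i \<union> - F i)"
    show "lsc_at X C x" unfolding lsc_at_def
    proof (intro allI impI)
      fix z V assume zV: "(x, z) \<in> C" "open V" "z \<in> V"
      then obtain i where i: "z \<in> B i" "closure (B i) \<subseteq> V" using B(2) assms(3) by blast
      have "z \<in> closure (B i)" using i closure_subset by blast
      then have "x \<in> F i" unfolding F_def using zV by force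
      then obtain W where W: "open W" "x \<in> W" "W \<inter> X \<subseteq> F i" using x by (auto simp: I_def)
      have "\<exists>z'\<in>V. (x', z') \<in> C" if x': "x' \<in> W \<inter> X" for x'
      proof -
        have "x' \<in> F i" using W x' by blast
        then show ?thesis unfolding F_def using i by force
      qed
      then show "\<exists>W. open W \<and> x \<in> W \<and> (\<forall>x'\<in>W \<inter> X. \<exists>z'\<in>V. (x', z') \<in> C)" using W by blast
    qed
  qed
qed

section \<open>Transport of comeager sets along homeomorphisms and factor maps\<close>

lemma openin_preimage_open:
  assumes "continuous_on X f" "open U"
  obtains V where "open V" "V \<inter> X = {x \<in> X. f x \<in> U}"
proof -
  obtain V where "open V" "V \<inter> X = f -` U \<inter> X"
    using assms continuous_on_open_invariant by metis
  then show thesis using that[of V] by auto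
qed

lemma homeo_image_open:
  fixes Y :: "'a::t2_space set"
  assumes "compact Y" "continuous_on Y S" "S ` Y = Y" "inj_on S Y" "open V"
  obtains W where "open W" "W \<inter> Y = S ` (V \<inter> Y)"
proof -
  let ?g = "inv_into Y S"
  have g: "\<And>y. y \<in> Y \<Longrightarrow> ?g (S y) = y" using assms(4) by (simp add: inv_into_f_f)
  then have "continuous_on Y ?g"
    using continuous_on_inv[OF assms(2,1), of ?g] assms(3) by simp
  from openin_preimage_open[OF this assms(5)]
  obtain W where W: "open W" "W \<inter> Y = {y \<in> Y. ?g y \<in> V}" .
  have "{y \<in> S ` Y. ?g y \<in> V} = S ` (V \<inter> Y)" using g by auto
  then show thesis using that W assms(3) by simp
qed

lemma comeager_homeo_preimage:
  fixes Y :: "'a::t2_space set"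
  assumes "compact Y" "continuous_on Y S" "S ` Y = Y" "inj_on S Y" "comeager_in Y D"
  shows "comeager_in Y {y. S y \<in> D}"
proof -
  obtain U :: "nat \<Rightarrow> 'a set" where U: "\<And>i. open (U i)"
    "\<And>i V. open V \<Longrightarrow> V \<inter> Y \<noteq> {} \<Longrightarrow> V \<inter> Y \<inter> U i \<noteq> {}" "Y \<inter> (\<Inter>i. U i) \<subseteq> D"
    using assms(5) unfolding comeager_in_def by metis
  have "\<exists>U'. open U' \<and> U' \<inter> Y = {y \<in> Y. S y \<in> U i}" for i
    using openin_preimage_open[OF assms(2) U(1)[of i]] by metis
  then obtain U' where U': "\<And>i. open (U' i)" "\<And>i. U' i \<inter> Y = {y \<in> Y. S y \<in> U i}" by metis
  have "V \<inter> Y \<inter> U' i \<noteq> {}" if V: "open V" "V \<inter> Y \<noteq> {}" for V i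
  proof -
    obtain W where W: "open W" "W \<inter> Y = S ` (V \<inter> Y)"
      using homeo_image_open[OF assms(1-4) V(1)] by metis
    then have "W \<inter> Y \<inter> U i \<noteq> {}" using U(2)[of W i] V(2) by auto
    then obtain y where y: "y \<in> V" "y \<in> Y" "S y \<in> U i" using W(2) by auto
    then have "y \<in> U' i \<inter> Y" using U'(2) by auto
    then show ?thesis using y by blast
  qed
  moreover have "Y \<inter> (\<Inter>i. U' i) \<subseteq> {y. S y \<in> D}"
  proof
    fix y assume y: "y \<in> Y \<inter> (\<Inter>i. U' i)"
    then have "S y \<in> U i" for i using U'(2)[of i] by auto
    moreover have "S y \<in> Y" using y assms(3) by blast
    ultimately show "y \<in> {y. S y \<in> D}" using U(3) by blast
  qed
  ultimately show ?thesis using U'(1) by (intro comeager_inI[of U'])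
qed

text \<open>As \<phi> need not be open, preimages of dense open sets are not dense for free. By
  Baire some y has its entire forward orbit in \<open>U i\<close>, because S is a homeomorphism. A
  lift v of y has a dense forward orbit, which visits V while staying over
  \<open>U i\<close>.\<close>

lemma comeager_factor_preimage:
  fixes Y :: "'b::metric_space set"
  assumes Y: "compact Y" "continuous_on Y S" "S ` Y = Y" "inj_on S Y" "comeager_in Y D"
    and \<Omega>: "F ` \<Omega> \<subseteq> \<Omega>" "\<And>v V. v \<in> \<Omega> \<Longrightarrow> open V \<Longrightarrow> V \<inter> \<Omega> \<noteq> {} \<Longrightarrow> \<exists>n. (F ^^ n) v \<in> V"
    and \<phi>: "continuous_on \<Omega> \<phi>" "\<phi> ` \<Omega> = Y" "\<And>w. w \<in> \<Omega> \<Longrightarrow> \<phi> (F w) = S (\<phi> w)"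
  shows "comeager_in \<Omega> {w. \<phi> w \<in> D}"
proof -
  obtain U :: "nat \<Rightarrow> 'b set" where U: "\<And>i. open (U i)"
    "\<And>i V. open V \<Longrightarrow> V \<inter> Y \<noteq> {} \<Longrightarrow> V \<inter> Y \<inter> U i \<noteq> {}" "Y \<inter> (\<Inter>i. U i) \<subseteq> D"
    using Y(5) unfolding comeager_in_def by metis
  have "\<exists>U'. open U' \<and> U' \<inter> \<Omega> = {w \<in> \<Omega>. \<phi> w \<in> U i}" for i
    using openin_preimage_open[OF \<phi>(1) U(1)[of i]] by metis
  then obtain U' where U': "\<And>i. open (U' i)" "\<And>i. U' i \<inter> \<Omega> = {w \<in> \<Omega>. \<phi> w \<in> U i}" by metis
  have it: "comeager_in Y {y. (S ^^ n) y \<in> E}" if "comeager_in Y E" for n E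
    using that
  proof (induction n arbitrary: E)
    case (Suc n)
    have "comeager_in Y {y. S y \<in> {y. (S ^^ n) y \<in> E}}"
      by (rule comeager_homeo_preimage[OF Y(1-4) Suc.IH[OF Suc.prems]])
    then show ?case by (simp add: funpow_swap1)
  qed simp
  have "V \<inter> \<Omega> \<inter> U' i \<noteq> {}" if V: "open V" "V \<inter> \<Omega> \<noteq> {}" for V i
  proof -
    have "comeager_in Y (U i)" by (rule comeager_in_open) (use U in auto)
    then have "comeager_in Y (\<Inter>n. {y. (S ^^ n) y \<in> U i})" by (intro comeager_in_INT it)
    moreover have "UNIV \<inter> Y \<noteq> {}" using V(2) \<phi>(2) by auto
    ultimately obtain y where "y \<in> Y" "y \<in> (\<Inter>n. {y. (S ^^ n) y \<in> U i})"
      by (rule comeager_in_dense[OF Y(1) _ open_UNIV])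
    then have y: "y \<in> Y" "\<And>n. (S ^^ n) y \<in> U i" by auto
    then obtain v where v: "v \<in> \<Omega>" "y = \<phi> v" using \<phi>(2) by blast
    obtain n where n: "(F ^^ n) v \<in> V" using \<Omega>(2)[OF v(1) V] by blast
    have vn: "(F ^^ n) v \<in> \<Omega>" by (rule funpow_in[OF \<Omega>(1) v(1)])
    have "\<phi> ((F ^^ n) v) = (S ^^ n) (\<phi> v)"
      by (rule funpow_semiconj[of \<Omega>]) (use \<phi>(3) \<Omega>(1) v(1) in auto)
    then have "(F ^^ n) v \<in> U' i \<inter> \<Omega>" using y(2) v(2) vn U'(2) by auto
    then show ?thesis using n by blast
  qed
  moreover have "\<Omega> \<inter> (\<Inter>i. U' i) \<subseteq> {w. \<phi> w \<in> D}"
  proof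
    fix w assume w: "w \<in> \<Omega> \<inter> (\<Inter>i. U' i)"
    then have "\<phi> w \<in> U i" for i using U'(2)[of i] by auto
    moreover have "\<phi> w \<in> Y" using w \<phi>(2) by blast
    ultimately show "w \<in> {w. \<phi> w \<in> D}" using U(3) by blast
  qed
  ultimately show ?thesis using U'(1) by (intro comeager_inI[of U'])
qed

subsection \<open>Almost periodic pairs and triples\<close>

abbreviation map_triple :: "('a \<Rightarrow> 'a) \<Rightarrow> 'a \<times> 'a \<times> 'a \<Rightarrow> 'a \<times> 'a \<times> 'a" where
  "map_triple T \<equiv> map_prod T (map_prod T T)"

lemma funpow_map_prod [simp]:
  fixes f :: "'a \<Rightarrow> 'a" and g :: "'b \<Rightarrow> 'b"
  shows "(map_prod f g ^^ n) (x, y) = ((f ^^ n) x, (g ^^ n) y)"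
  by (induction n) auto

lemma continuous_on_map_prod:
  assumes "continuous_on X f" "continuous_on Y g"
  shows "continuous_on (X \<times> Y) (map_prod f g)"
proof -
  have "continuous_on (X \<times> Y) (\<lambda>p. (f (fst p), g (snd p)))"
    by (intro continuous_on_Pair continuous_on_compose2[OF assms(1)]
        continuous_on_compose2[OF assms(2)] continuous_on_fst continuous_on_snd continuous_on_id) auto
  then show ?thesis by (simp add: map_prod_def case_prod_beta')
qed

text \<open>Evaluation at two or three points carries the orbit of \<open>id\<close> to the orbit of
  the tuple and the idempotent to the tuple of its values, so both properties descend from the
  function space.\<close>

lemma ellis_retraction:
  fixes X :: "'a::metric_space set"
  assumes X: "compact X" "continuous_on X T" "T ` X \<subseteq> X"
  obtains u where "\<And>x. x \<in> X \<Longrightarrow> u x \<in> X" "\<And>x. u (u x) = u x"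
    "\<And>x. x \<in> X \<Longrightarrow> u (T x) = T (u x)"
    "\<And>x y. x \<in> X \<Longrightarrow> y \<in> X \<Longrightarrow> (u x, u y) \<in> closure (orbit (map_prod T T) (x, y))"
    "\<And>x y. x \<in> X \<Longrightarrow> y \<in> X \<Longrightarrow> almost_periodic (map_prod T T) (u x, u y)"
    "\<And>x y z. x \<in> X \<Longrightarrow> y \<in> X \<Longrightarrow> z \<in> X \<Longrightarrow>
       (u x, u y, u z) \<in> closure (orbit (map_triple T) (x, y, z))"
    "\<And>x y z. x \<in> X \<Longrightarrow> y \<in> X \<Longrightarrow> z \<in> X \<Longrightarrow> almost_periodic (map_triple T) (u x, u y, u z)"
proof -
  let ?E = "ellis_space X" and ?F = "ellis_step X T"
  note E = compact_ellis_space[OF X(1)] and F = ellis_step_continuous[OF X(2,3)]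
  obtain u where u: "u \<in> ?E" "u \<circ> u = u" "u \<in> closure (orbit ?F id)" "almost_periodic ?F u"
    using ellis_idempotent[OF X] by metis
  have id: "id \<in> ?E" by (auto simp: ellis_space_def)
  have pair: "(u x, u y) \<in> closure (orbit (map_prod T T) (x, y))"
    "almost_periodic (map_prod T T) (u x, u y)" if "x \<in> X" "y \<in> X" for x y
  proof -
    let ?e = "\<lambda>q. (q x, q y)"
    have c: "continuous_on ?E ?e" by (intro continuous_on_Pair continuous_on_eval)
    have eq: "?e (?F q) = map_prod T T (?e q)" if "q \<in> ?E" for q
      using \<open>x \<in> X\<close> \<open>y \<in> X\<close> by (simp add: ellis_step_def)
    from image_closure_orbit_subset[where W = ?E and F = ?F and w = id and S = "map_prod T T"
        and \<phi> = ?e, OF E(2) F(2) id c eq] imageI[OF u(3), of ?e]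
    show "(u x, u y) \<in> closure (orbit (map_prod T T) (x, y))" by (simp add: subset_iff)
    show "almost_periodic (map_prod T T) (u x, u y)"
      using almost_periodic_image[where W = ?E and F = ?F and w = u and S = "map_prod T T"
        and \<phi> = ?e, OF E F(2) u(1) c eq u(4)] by simp
  qed
  have triple: "(u x, u y, u z) \<in> closure (orbit (map_triple T) (x, y, z))"
    "almost_periodic (map_triple T) (u x, u y, u z)" if "x \<in> X" "y \<in> X" "z \<in> X" for x y z
  proof -
    let ?e = "\<lambda>q. (q x, q y, q z)"
    have c: "continuous_on ?E ?e" by (intro continuous_on_Pair continuous_on_eval)
    have eq: "?e (?F q) = map_triple T (?e q)" if "q \<in> ?E" for q
      using \<open>x \<in> X\<close> \<open>y \<in> X\<close> \<open>z \<in> X\<close> by (simp add: ellis_step_def)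
    from image_closure_orbit_subset[where W = ?E and F = ?F and w = id and S = "map_triple T"
        and \<phi> = ?e, OF E(2) F(2) id c eq] imageI[OF u(3), of ?e]
    show "(u x, u y, u z) \<in> closure (orbit (map_triple T) (x, y, z))" by (simp add: subset_iff)
    show "almost_periodic (map_triple T) (u x, u y, u z)"
      using almost_periodic_image[where W = ?E and F = ?F and w = u and S = "map_triple T"
        and \<phi> = ?e, OF E F(2) u(1) c eq u(4)] by simp
  qed
  have comm: "u (T x) = T (u x)" if "x \<in> X" for x
  proof -
    \<comment> \<open>Although u is only a pointwise limit of iterates, it commutes with T: the
      graph of T is closed and invariant, so it contains the limit of the pair (x, T x).\<close>
    let ?C = "(\<lambda>a. (a, T a)) ` X"
    have "closed ?C"
      by (intro compact_imp_closed compact_continuous_image continuous_on_Pair continuous_on_id X)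
    moreover have "map_prod T T ` ?C \<subseteq> ?C" using X(3) by auto
    ultimately have "closure (orbit (map_prod T T) (x, T x)) \<subseteq> ?C"
      using that by (intro closure_orbit_subset) auto
    moreover have "T x \<in> X" using X(3) that by blast
    ultimately have "(u x, u (T x)) \<in> ?C" using pair(1)[of x "T x"] that by blast
    then show ?thesis by auto
  qed
  have uu: "u (u x) = u x" for x using u(2) by (metis comp_apply)
  have uX: "u x \<in> X" if "x \<in> X" for x using u(1) that by (simp add: ellis_space_def)
  show thesis by (rule that[of u]) (fact uX uu comm pair triple)+
qed

subsection \<open>Proximality\<close>

lemma proximal_pair_iff:
  "proximal_pair T x y \<longleftrightarrow> (\<forall>e>0. \<exists>n. dist ((T ^^ n) x) ((T ^^ n) y) < e)"
proof -
  let ?d = "\<lambda>n. dist ((T ^^ n) x) ((T ^^ n) y)"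
  have bdd: "bdd_below (range ?d)" by (rule bdd_belowI[of _ 0]) auto
  have nonneg: "0 \<le> (INF n. ?d n)" by (rule cINF_greatest) auto
  have "proximal_pair T x y \<longleftrightarrow> (\<forall>e>0. (INF n. ?d n) < e)"
  proof
    assume *: "\<forall>e>0. (INF n. ?d n) < e"
    then have "\<not> (INF n. ?d n) > 0" by blast
    then show "proximal_pair T x y" using nonneg by (simp add: proximal_pair_def)
  qed (simp add: proximal_pair_def)
  then show ?thesis using cINF_less_iff[OF _ bdd] by simp
qed

lemma proximal_pair_if_diagonal:
  assumes "(a, a) \<in> closure (orbit (map_prod T T) (x, y))"
  shows "proximal_pair T x y"
  unfolding proximal_pair_iff
proof (intro allI impI)
  fix e :: real assume "e > 0"
  have "open {p. dist (fst p) (snd p :: 'a) < e}"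
    by (intro open_Collect_less continuous_intros)
  moreover have "(a, a) \<in> {p. dist (fst p) (snd p) < e}" using \<open>e > 0\<close> by simp
  ultimately have "\<exists>n. (map_prod T T ^^ n) (x, y) \<in> {p. dist (fst p) (snd p) < e}"
    using assms unfolding in_closure_orbit_iff by meson
  then show "\<exists>n. dist ((T ^^ n) x) ((T ^^ n) y) < e" by simp
qed

lemma map_prod_invariant: "T ` X \<subseteq> X \<Longrightarrow> S ` Y \<subseteq> Y \<Longrightarrow> map_prod T S ` (X \<times> Y) \<subseteq> X \<times> Y"
  by auto

lemma diagonal_if_proximal:
  fixes X :: "'a::metric_space set"
  assumes X: "compact X" "continuous_on X T" "T ` X \<subseteq> X" "x \<in> X" "y \<in> X"
    and "proximal_pair T x y"
  obtains a where "(a, a) \<in> closure (orbit (map_prod T T) (x, y))"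
proof -
  let ?C = "closure (orbit (map_prod T T) (x, y))"
  have W: "closed (X \<times> X)" "map_prod T T ` (X \<times> X) \<subseteq> X \<times> X"
    using X compact_imp_closed closed_Times map_prod_invariant by auto
  have "compact ?C"
    using compact_Int_closed[OF compact_Times[OF X(1,1)], of ?C]
      closure_orbit_subset[OF W, of "(x, y)"] X by (simp add: inf.absorb2)
  moreover have "?C \<noteq> {}" using self_in_closure_orbit[of "(x, y)" "map_prod T T"] by (metis empty_iff)
  moreover have "continuous_on ?C (\<lambda>p. dist (fst p) (snd p))" by (intro continuous_intros)
  ultimately have "\<exists>p\<in>?C. \<forall>q\<in>?C. dist (fst p) (snd p) \<le> dist (fst q) (snd q)"
    by (rule continuous_attains_inf)
  then obtain p where p: "p \<in> ?C" "\<And>q. q \<in> ?C \<Longrightarrow> dist (fst p) (snd p) \<le> dist (fst q) (snd q)"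
    by blast
  have "dist (fst p) (snd p) \<le> e" if e: "e > 0" for e
  proof -
    obtain n where "dist ((T ^^ n) x) ((T ^^ n) y) < e"
      using assms(6) e unfolding proximal_pair_iff by blast
    moreover have "((T ^^ n) x, (T ^^ n) y) \<in> ?C"
      using funpow_in_closure_orbit[of n "map_prod T T" "(x, y)"] by simp
    ultimately show ?thesis using p(2) by fastforce
  qed
  then have "dist (fst p) (snd p) = 0"
    by (metis dense_ge dual_order.antisym zero_le_dist)
  then show thesis using that[of "fst p"] p(1) by (metis dist_eq_0_iff prod.collapse)
qed

text \<open>The orbit closure reaches the diagonal, which is closed and invariant; the return to (x,
  y) cannot leave it.\<close>

lemma almost_periodic_proximal_eq:
  fixes X :: "'a::metric_space set"
  assumes X: "compact X" "continuous_on X T" "T ` X \<subseteq> X" "x \<in> X" "y \<in> X"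
    and "proximal_pair T x y" "almost_periodic (map_prod T T) (x, y)"
  shows "x = y"
proof -
  obtain a where a: "(a, a) \<in> closure (orbit (map_prod T T) (x, y))"
    using diagonal_if_proximal[OF assms(1-6)] .
  then have "(x, y) \<in> closure (orbit (map_prod T T) (a, a))"
    using assms(7) by (simp add: almost_periodic_def)
  moreover have "a \<in> X"
    using a closure_orbit_subset[of "X \<times> X" "map_prod T T" "(x, y)"] X(3-5)
      closed_Times[OF compact_imp_closed[OF X(1)] compact_imp_closed[OF X(1)]]
      map_prod_invariant[OF X(3,3)] by auto
  then have "closure (orbit (map_prod T T) (a, a)) \<subseteq> (\<lambda>x. (x, x)) ` X"
    using X(1,3)
    by (intro closure_orbit_subset compact_imp_closed compact_continuous_image continuous_on_Pair
        continuous_on_id) auto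
  ultimately show ?thesis by auto
qed

text \<open>Idempotence sends (x, u x) to the diagonal point (u x, u x), so x and u x are proximal.
  Distality then makes u the identity on Y.\<close>

lemma distal_almost_periodic_pair:
  fixes Y :: "'a::metric_space set"
  assumes Y: "compact Y" "continuous_on Y S" "S ` Y \<subseteq> Y" "distal Y S" "a \<in> Y" "b \<in> Y"
  shows "almost_periodic (map_prod S S) (a, b)"
proof -
  obtain u where u: "\<And>x. x \<in> Y \<Longrightarrow> u x \<in> Y" "\<And>x. u (u x) = u x"
    "\<And>x y. x \<in> Y \<Longrightarrow> y \<in> Y \<Longrightarrow> (u x, u y) \<in> closure (orbit (map_prod S S) (x, y))"
    "\<And>x y. x \<in> Y \<Longrightarrow> y \<in> Y \<Longrightarrow> almost_periodic (map_prod S S) (u x, u y)"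
    using ellis_retraction[OF Y(1-3)] by metis
  have "u x = x" if "x \<in> Y" for x
  proof -
    have "proximal_pair S x (u x)"
      using u(3)[of x "u x"] u(1,2) that by (intro proximal_pair_if_diagonal[of "u x"]) auto
    then show ?thesis using Y(4) that u(1)[OF that] unfolding distal_def by metis
  qed
  then show ?thesis using u(4)[OF Y(5,6)] Y by simp
qed

lemma compact_nested_nonempty:
  fixes F :: "nat \<Rightarrow> 'a::t2_space set"
  assumes "\<And>n. compact (F n)" "\<And>n. F n \<noteq> {}" "\<And>m n. m \<le> n \<Longrightarrow> F n \<subseteq> F m"
  obtains x where "\<And>n. x \<in> F n"
proof -
  have "F 0 \<inter> (\<Inter>n\<in>UNIV. F n) \<noteq> {}"
  proof (rule compact_imp_fip_image[OF assms(1)])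
    fix I :: "nat set" assume "finite I"
    then have "F (Max (insert 0 I)) \<subseteq> F i" if "i \<in> insert 0 I" for i
      using that by (intro assms(3) Max_ge) auto
    then have "F (Max (insert 0 I)) \<subseteq> F 0 \<inter> (\<Inter>i\<in>I. F i)" by auto
    then show "F 0 \<inter> (\<Inter>i\<in>I. F i) \<noteq> {}" using assms(2) by blast
  qed (use assms(1) compact_imp_closed in auto)
  then show thesis using that by blast
qed

section \<open>From sensitivity to a distal pair in a fibre\<close>

lemma closed_far:
  fixes X :: "'a::metric_space set"
  assumes "compact X" "continuous_on X T" "T ` X \<subseteq> X"
  shows "compact {p \<in> X \<times> X. \<forall>n\<in>I. d \<le> dist ((T ^^ n) (fst p)) ((T ^^ n) (snd p))}"
proof -
  have c: "compact (X \<times> X)" by (intro compact_Times assms)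
  have "closed {p \<in> X \<times> X. d \<le> dist ((T ^^ n) (fst p)) ((T ^^ n) (snd p))}" for n
    by (intro continuous_on_closed_Collect_le continuous_intros compact_imp_closed[OF c]
        continuous_on_compose2[OF continuous_on_funpow[OF assms(2,3)]]) auto
  then have "closed (\<Inter>n\<in>I. {p \<in> X \<times> X. d \<le> dist ((T ^^ n) (fst p)) ((T ^^ n) (snd p))})" by blast
  from compact_Int_closed[OF c this] show ?thesis
    by (rule back_subst[of compact]) auto
qed

lemma strongly_sensitive_imp_not_proximal:
  fixes X :: "'a::metric_space set" and Y :: "'b::metric_space set"
  assumes "X \<noteq> {}" "factor_map X T Y S p" "distal Y S" "strongly_Ft_sensitive X T"
  shows "\<not> proximal_factor_map X T p"
proof
  assume prox: "proximal_factor_map X T p"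
  have X: "compact X" "continuous_on X T" "T ` X \<subseteq> X"
    and Y: "compact Y" "continuous_on Y S" "S ` Y \<subseteq> Y"
    and p: "continuous_on X p" "p ` X = Y" "\<And>x. x \<in> X \<Longrightarrow> p (T x) = S (p x)"
    using assms(2) by (auto simp: factor_map_def TDS_def)
  let ?TT = "map_prod T T" and ?SS = "map_prod S S" and ?pp = "map_prod p p"
  have W: "compact (X \<times> X)" "closed (X \<times> X)" "?TT ` (X \<times> X) \<subseteq> X \<times> X"
    using compact_Times[OF X(1,1)] compact_imp_closed map_prod_invariant[OF X(3,3)] by auto
  obtain d where "d > 0 \<and> (\<forall>U. open U \<and> U \<inter> X \<noteq> {} \<longrightarrow>
      (\<exists>x\<in>U \<inter> X. \<exists>y\<in>U \<inter> X. thick {n. dist ((T ^^ n) x) ((T ^^ n) y) > d}))"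
    using assms(4) unfolding strongly_Ft_sensitive_def ..
  then have d: "d > 0" "\<And>U. open U \<Longrightarrow> U \<inter> X \<noteq> {} \<Longrightarrow>
      \<exists>x\<in>U \<inter> X. \<exists>y\<in>U \<inter> X. thick {n. dist ((T ^^ n) x) ((T ^^ n) y) > d}"
    by simp_all
  \<comment> \<open>The weak inequality, in place of the strict one of sensitivity, makes the set of
    pairs that never come closer than d compact.\<close>
  define C where "C = {q \<in> X \<times> X. \<forall>n\<in>UNIV. d \<le> dist ((T ^^ n) (fst q)) ((T ^^ n) (snd q))}"
  have C: "compact C" unfolding C_def by (rule closed_far[OF X])
  have TC: "?TT ` C \<subseteq> C"
  proof
    fix q assume "q \<in> ?TT ` C"
    then obtain a b where ab: "(a, b) \<in> C" "q = (T a, T b)" by auto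
    then have "d \<le> dist ((T ^^ Suc n) a) ((T ^^ Suc n) b)" for n
      unfolding C_def by (metis (no_types, lifting) UNIV_I fst_conv mem_Collect_eq snd_conv)
    then show "q \<in> C" using ab X(3) by (auto simp: C_def funpow_swap1)
  qed
  have lift: "\<exists>q\<in>C. ?pp q = (p x, p y)"
    if xy: "x \<in> X" "y \<in> X" and th: "thick {n. dist ((T ^^ n) x) ((T ^^ n) y) > d}" for x y
  proof -
    let ?O = "closure (orbit ?TT (x, y))"
    have sub: "?O \<subseteq> X \<times> X" using closure_orbit_subset[OF W(2,3)] xy by auto
    \<comment> \<open>A block of length L in the thick set, starting at m, puts the m-th iterate of
      (x, y) into \<open>F L\<close>. A point common to all \<open>F L\<close> is a pair of the
      orbit closure that stays apart forever.\<close>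
    define F where "F L = ?O \<inter> {q \<in> X \<times> X. \<forall>n\<in>{..<L}. d \<le> dist ((T ^^ n) (fst q)) ((T ^^ n) (snd q))}"
      for L
    have "compact (F L)" for L
      unfolding F_def by (rule closed_Int_compact[OF closed_closure closed_far[OF X]])
    moreover have "F L \<noteq> {}" for L
    proof -
      obtain m where m: "{m..<m + L} \<subseteq> {n. dist ((T ^^ n) x) ((T ^^ n) y) > d}"
        using th by (auto simp: thick_def)
      have "d \<le> dist ((T ^^ (n + m)) x) ((T ^^ (n + m)) y)" if "n < L" for n
      proof -
        have "n + m \<in> {m..<m + L}" using that by simp
        then have "n + m \<in> {n. dist ((T ^^ n) x) ((T ^^ n) y) > d}" using m by (rule subsetD[rotated])
        then show ?thesis by simp
      qed
      moreover have "((T ^^ m) x, (T ^^ m) y) \<in> ?O"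
        using funpow_in_closure_orbit[of m ?TT "(x, y)"] by simp
      ultimately have "((T ^^ m) x, (T ^^ m) y) \<in> F L"
        using sub by (auto simp: F_def funpow_add)
      then show ?thesis by blast
    qed
    moreover have "F n \<subseteq> F m" if "m \<le> n" for m n using that by (auto simp: F_def)
    ultimately obtain q where q: "\<And>n. q \<in> F n" using compact_nested_nonempty by metis
    have qC: "q \<in> C" using q[of "Suc _"] by (auto simp: F_def C_def)
    have qO: "q \<in> ?O" using q[of 0] by (auto simp: F_def)
    have pp: "continuous_on (X \<times> X) ?pp" by (rule continuous_on_map_prod[OF p(1,1)])
    have eq: "?pp (?TT z) = ?SS (?pp z)" if "z \<in> X \<times> X" for z using that p(3) by auto
    have "?pp q \<in> closure (orbit ?SS (?pp (x, y)))"
      using image_closure_orbit_subset[where W = "X \<times> X" and F = ?TT and S = ?SS and \<phi> = ?pp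
          and w = "(x, y)", OF W(2,3) _ pp eq] xy imageI[OF qO, of ?pp] by (simp add: subsetD)
    \<comment> \<open>Almost periodicity downstairs reverses the direction: the image of (x, y) lies
      in the orbit closure of the image of q, and this lifts into the orbit closure of q, hence into
      C.\<close>
    then have "?pp (x, y) \<in> closure (orbit ?SS (?pp q))"
      using distal_almost_periodic_pair[OF Y assms(3), of "p x" "p y"] xy p(2)
      by (auto simp: almost_periodic_def)
    also have "\<dots> = ?pp ` closure (orbit ?TT q)"
      using image_closure_orbit[where W = "X \<times> X" and F = ?TT and S = ?SS and \<phi> = ?pp
          and w = q, OF W(1,2,3) _ pp eq] qC by (simp add: C_def)
    also have "\<dots> \<subseteq> ?pp ` C"
      by (intro image_mono closure_orbit_subset[OF compact_imp_closed[OF C] TC qC])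
    finally show ?thesis by (metis imageE map_prod_simp)
  qed
  obtain x0 where x0: "x0 \<in> X" using assms(1) by blast
  define D where "D k = C \<inter> {q \<in> X \<times> X. dist (p (fst q)) (p x0) \<le> 1 / Suc k}
      \<inter> {q \<in> X \<times> X. dist (p (snd q)) (p x0) \<le> 1 / Suc k}" for k
  have "closed {q \<in> X \<times> X. dist (p (fst q)) (p x0) \<le> r}"
    "closed {q \<in> X \<times> X. dist (p (snd q)) (p x0) \<le> r}" for r
    by (intro continuous_on_closed_Collect_le continuous_intros W
        continuous_on_compose2[OF p(1)]; auto)+
  then have "compact (D k)" for k
    unfolding D_def using C by (intro compact_Int_closed)
  moreover have "D k \<noteq> {}" for k
  proof -
    obtain r where r: "r > 0" "\<And>x. x \<in> X \<Longrightarrow> dist x x0 < r \<Longrightarrow> dist (p x) (p x0) < 1 / Suc k"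
      using p(1) x0 unfolding continuous_on_iff by (metis of_nat_0_less_iff zero_less_Suc zero_less_divide_1_iff)
    have "x0 \<in> ball x0 r \<inter> X" using x0 r(1) by simp
    then have "ball x0 r \<inter> X \<noteq> {}" by blast
    then obtain x y where xy: "x \<in> ball x0 r \<inter> X" "y \<in> ball x0 r \<inter> X"
      "thick {n. dist ((T ^^ n) x) ((T ^^ n) y) > d}" using d(2)[OF open_ball] by metis
    then obtain q where q: "q \<in> C" "?pp q = (p x, p y)" using lift by blast
    have "dist (p x) (p x0) < 1 / Suc k" "dist (p y) (p x0) < 1 / Suc k"
      using r(2)[of x] r(2)[of y] xy(1,2) by (simp_all add: dist_commute[of x0])
    moreover have "p (fst q) = p x" "p (snd q) = p y" using q(2) by (auto simp: prod_eq_iff)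
    ultimately have "q \<in> D k" using q(1) by (auto simp: D_def C_def)
    then show ?thesis by blast
  qed
  moreover have "D n \<subseteq> D m" if "m \<le> n" for m n
  proof -
    have "1 / real (Suc n) \<le> 1 / real (Suc m)" using that by (simp add: frac_le)
    then show ?thesis unfolding D_def by auto
  qed
  ultimately obtain q where q: "\<And>k. q \<in> D k" using compact_nested_nonempty by metis
  obtain a b where ab: "q = (a, b)" by force
  have z: "dist (p c) (p x0) = 0" if c: "\<And>k. dist (p c) (p x0) \<le> 1 / Suc k" for c
  proof (rule ccontr)
    assume "dist (p c) (p x0) \<noteq> 0"
    then obtain k where "1 / Suc k < dist (p c) (p x0)" using nat_approx_posE zero_less_dist_iff
      by (metis dist_eq_0_iff)
    then show False using c[of k] by linarith
  qed
  have "p a = p x0" "p b = p x0"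
    using z[of a] z[of b] q by (auto simp: D_def ab)
  then have "proximal_pair T a b"
    using prox q[of 0] by (auto simp: proximal_factor_map_def D_def ab)
  then obtain n where "dist ((T ^^ n) a) ((T ^^ n) b) < d" using d(1) by (auto simp: proximal_pair_iff)
  moreover have "d \<le> dist ((T ^^ n) a) ((T ^^ n) b)" using q[of 0] by (auto simp: D_def C_def ab)
  ultimately show False by simp
qed

subsection \<open>Distal quotients\<close>

text \<open>This is the embedding of the compact metrizable quotient X/R into a countable product of
  lines, the space over which \<open>maximal_distal_factor\<close> quantifies. The coordinates are
  Urysohn functions for pairs of basic sets whose closures contain no R-related points.\<close>

lemma closed_equiv_separating_map:
  fixes X :: "'a::metric_space set"
  assumes X: "compact X" and R: "closed R" "equiv X R"
  obtains q :: "'a \<Rightarrow> nat \<Rightarrow> real" where "continuous_on X q"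
    "\<And>x y. x \<in> X \<Longrightarrow> y \<in> X \<Longrightarrow> q x = q y \<longleftrightarrow> (x, y) \<in> R"
proof -
  have RX: "R \<subseteq> X \<times> X" using R(2) by (simp add: equiv_def)
  have Rc: "compact R"
    using compact_Int_closed[OF compact_Times[OF X X] R(1)] RX by (simp add: inf.absorb2)
  have sym: "(y, x) \<in> R" if "(x, y) \<in> R" for x y using R(2) that by (meson equivE symD)
  have trans: "(x, z) \<in> R" if "(x, y) \<in> R" "(y, z) \<in> R" for x y z
    using R(2) that by (meson equivE transD)
  have refl: "(x, x) \<in> R" if "x \<in> X" for x using R(2) that by (meson equivE refl_onD)
  have sat_closed: "closed (R `` C)" if "closed C" for C
  proof -
    have "R `` C = snd ` (R \<inter> C \<times> UNIV)" by force
    then show ?thesis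
      by (simp add: compact_imp_closed compact_continuous_image compact_Int_closed[OF Rc]
          closed_Times that continuous_on_snd continuous_on_id)
  qed
  \<comment> \<open>The quotient topology, represented on X itself by its saturated relatively open
    sets.\<close>
  define L where "L U \<longleftrightarrow> openin (top_of_set X) U \<and> (\<forall>x y. (x, y) \<in> R \<longrightarrow> x \<in> U \<longrightarrow> y \<in> U)" for U
  have L: "istopology L" unfolding istopology_def L_def by (auto intro: openin_Int)
  define \<tau> where "\<tau> = topology L"
  have op: "openin \<tau> = L" unfolding \<tau>_def using L by (rule topology_inverse')
  have top: "topspace \<tau> = X"
  proof -
    have "L X" using RX by (auto simp: L_def)
    moreover have "U \<subseteq> X" if "L U" for U using that openin_subset by (fastforce simp: L_def)
    ultimately show ?thesis unfolding topspace_def op by blast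
  qed
  have opC: "openin \<tau> (X - R `` C)" if "closed C" for C
  proof -
    have "openin (top_of_set X) (X - R `` C)" using sat_closed[OF that] by (metis Diff_eq openin_open open_Compl)
    moreover have "y \<in> X - R `` C" if "(x, y) \<in> R" "x \<in> X - R `` C" for x y
      using that trans sym RX by blast
    ultimately show ?thesis by (auto simp: op L_def)
  qed
  have clC: "closedin \<tau> (R `` C)" if "closed C" for C
  proof -
    have "R `` C \<subseteq> X" using RX by blast
    then show ?thesis using opC[OF that] by (simp add: closedin_def top)
  qed
  have clD: "closed C \<and> (\<forall>x y. (x, y) \<in> R \<longrightarrow> x \<in> C \<longrightarrow> y \<in> C)" if "closedin \<tau> C" for C
  proof -
    have CX: "C \<subseteq> X" "L (X - C)" using that by (auto simp: closedin_def top op)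
    then have "closedin (top_of_set X) C" by (simp add: closedin_def L_def)
    then have "closed C" using compact_imp_closed[OF X] closedin_closed_trans by blast
    moreover have "y \<in> C" if "(x, y) \<in> R" "x \<in> C" for x y
    proof (rule ccontr)
      assume "y \<notin> C"
      then have "y \<in> X - C" using RX that by blast
      then have "x \<in> X - C" using CX(2) sym[OF that(1)] unfolding L_def by blast
      then show False using that by blast
    qed
    ultimately show ?thesis by blast
  qed
  have normal: "normal_space \<tau>"
    unfolding normal_space_def
  proof (intro allI impI, elim conjE)
    fix A B assume A: "closedin \<tau> A" and B: "closedin \<tau> B" and AB: "disjnt A B"
    obtain U V where UV: "open U" "open V" "A \<subseteq> U" "B \<subseteq> V" "U \<inter> V = {}"
      using t4_space[of A B] clD[OF A] clD[OF B] AB unfolding disjnt_def by metis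
    \<comment> \<open>The complement in X of the R-saturation of -U' is the union of the classes
      inside U'. It is open and saturated, and it contains each saturated A' inside U'.\<close>
    have sub: "A' \<subseteq> X - R `` (-U')" if "closedin \<tau> A'" "A' \<subseteq> U'" for A' U'
      using clD[OF that(1)] that(2) sym closedin_subset[OF that(1)] unfolding top by blast
    have "X - R `` (-U) \<subseteq> U" "X - R `` (-V) \<subseteq> V" using refl by blast+
    then have "disjnt (X - R `` (-U)) (X - R `` (-V))" using UV(5) unfolding disjnt_def by blast
    moreover have "closed (-U)" "closed (-V)" using UV by auto
    ultimately show "\<exists>U V. openin \<tau> U \<and> openin \<tau> V \<and> A \<subseteq> U \<and> B \<subseteq> V \<and> disjnt U V"
      using opC sub[OF A UV(3)] sub[OF B UV(4)] by metis
  qed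
  have sep: "\<exists>f. continuous_on X f \<and> (\<forall>x y. (x, y) \<in> R \<longrightarrow> f x = f y) \<and>
      f ` (R `` A) \<subseteq> {0::real} \<and> f ` (R `` B) \<subseteq> {1}"
    if AB: "closed A" "closed B" "(A \<times> B) \<inter> R = {}" for A B
  proof -
    have "disjnt (R `` A) (R `` B)" unfolding disjnt_def using AB(3) trans sym by blast
    then obtain f where f: "continuous_map \<tau> (top_of_set {0..1::real}) f"
      "f ` (R `` A) \<subseteq> {0}" "f ` (R `` B) \<subseteq> {1}"
      using Urysohn_lemma[OF normal clC[OF AB(1)] clC[OF AB(2)]] by (metis zero_le_one)
    have pre: "L {x \<in> X. f x \<in> U}" if "open U" for U
    proof -
      have "continuous_map \<tau> euclidean f" using f(1) by (simp add: continuous_map_in_subtopology)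
      then show ?thesis using that unfolding continuous_map op top by simp
    qed
    have "continuous_on X f"
      unfolding continuous_on_open_invariant
    proof (intro allI impI)
      fix B :: "real set" assume "open B"
      then obtain V where "open V" "{x \<in> X. f x \<in> B} = X \<inter> V"
        using pre[of B] unfolding L_def openin_open by blast
      then show "\<exists>A. open A \<and> A \<inter> X = f -` B \<inter> X" by blast
    qed
    \<comment> \<open>Preimages of open sets are saturated, so f cannot separate two points of one
      class.\<close>
    moreover have "f x = f y" if "(x, y) \<in> R" for x y
    proof (rule ccontr)
      assume "f x \<noteq> f y"
      then have "x \<in> {z \<in> X. f z \<in> - {f y}}" using that RX by auto
      then have "y \<in> {z \<in> X. f z \<in> - {f y}}" using pre[of "- {f y}"] that unfolding L_def by blast
      then show False by simp
    qed
    ultimately show ?thesis using f by blast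
  qed
  obtain B where B: "\<And>i::nat. open (B i)"
    "\<And>x V. x \<in> X \<Longrightarrow> open V \<Longrightarrow> x \<in> V \<Longrightarrow> \<exists>i. x \<in> B i \<and> closure (B i) \<subseteq> V"
    using compact_countable_basis[OF X] by metis
  define good where "good i j \<longleftrightarrow> (closure (B i) \<times> closure (B j)) \<inter> R = {}" for i j
  define sp where "sp i j f \<longleftrightarrow> continuous_on X f \<and> (\<forall>x y. (x, y) \<in> R \<longrightarrow> f x = f y) \<and>
      f ` (R `` closure (B i)) \<subseteq> {0::real} \<and> f ` (R `` closure (B j)) \<subseteq> {1}" for i j f
  define f where "f i j = (SOME f. sp i j f)" for i j
  have ex: "\<exists>f. sp i j f" if "good i j" for i j
    using sep[OF closed_closure closed_closure] that unfolding good_def sp_def .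
  have "sp i j (f i j)" if "good i j" for i j
    unfolding f_def by (rule someI_ex[OF ex[OF that]])
  note f = this[unfolded sp_def]
  \<comment> \<open>Pairs of basic sets that cannot be separated contribute the constant coordinate
    0.\<close>
  define q where "q x k = (let (i, j) = prod_decode k in if good i j then f i j x else 0)" for x k
  show thesis
  proof (rule that[of q])
    show "continuous_on X q"
    proof (rule continuous_on_coordinatewise_then_product)
      fix k show "continuous_on X (\<lambda>x. q x k)"
      proof (cases "prod_decode k")
        case (Pair i j)
        then show ?thesis using f[of i j] by (cases "good i j") (simp_all add: q_def)
      qed
    qed
    fix x y assume xy: "x \<in> X" "y \<in> X"
    show "q x = q y \<longleftrightarrow> (x, y) \<in> R"
    proof
      assume "(x, y) \<in> R"
      then show "q x = q y" using f by (auto simp: q_def fun_eq_iff split: prod.split)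
    next
      assume eq: "q x = q y"
      show "(x, y) \<in> R"
      proof (rule ccontr)
        assume "(x, y) \<notin> R"
        moreover have "open (-R)" using R(1) by blast
        ultimately obtain U V where UV: "open U" "open V" "x \<in> U" "y \<in> V" "U \<times> V \<subseteq> -R"
          by (metis ComplI mem_Sigma_iff open_prod_elim)
        obtain i j where ij: "x \<in> B i" "closure (B i) \<subseteq> U" "y \<in> B j" "closure (B j) \<subseteq> V"
          using B(2) xy UV by metis
        have good: "good i j" using ij UV unfolding good_def by blast
        have "x \<in> R `` closure (B i)" "y \<in> R `` closure (B j)"
          using refl xy ij closure_subset by blast+
        then have "f i j x = 0" "f i j y = 1" using f[OF good] by (auto simp: image_subset_iff)
        moreover have "f i j x = f i j y"
          using fun_cong[OF eq, of "prod_encode (i, j)"] good by (simp add: q_def)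
        ultimately show False by simp
      qed
    qed
  qed
qed

text \<open>A proximal pair of the quotient need not lift to a proximal pair. Instead, each x is
  proximal to u x, so both have the same image; every pair of the quotient is then the image of an
  almost periodic pair (u x, u x'), and an almost periodic proximal pair is diagonal.\<close>

lemma distal_quotient:
  fixes X :: "'a::metric_space set" and q :: "'a \<Rightarrow> 'c::metric_space"
  assumes X: "compact X" "continuous_on X T" "T ` X = X"
    and R: "\<And>x y. (x, y) \<in> R \<Longrightarrow> (T x, T y) \<in> R"
      "\<And>x y. x \<in> X \<Longrightarrow> y \<in> X \<Longrightarrow> proximal_pair T x y \<Longrightarrow> (x, y) \<in> R"
    and q: "continuous_on X q" "\<And>x y. x \<in> X \<Longrightarrow> y \<in> X \<Longrightarrow> q x = q y \<longleftrightarrow> (x, y) \<in> R"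
  obtains U where "factor_map X T (q ` X) U q" "distal (q ` X) U"
proof -
  have TX: "\<And>x. x \<in> X \<Longrightarrow> T x \<in> X" and TX': "T ` X \<subseteq> X" using X(3) by auto
  define U where "U z = q (T (inv_into X q z))" for z
  have U: "U (q x) = q (T x)" if "x \<in> X" for x
  proof -
    let ?y = "inv_into X q (q x)"
    have y: "?y \<in> X" "q ?y = q x" using that by (auto simp: inv_into_into f_inv_into_f)
    then have "(T ?y, T x) \<in> R" using q(2) that R(1) by blast
    then show ?thesis using q(2) y that TX unfolding U_def by blast
  qed
  have qX: "compact (q ` X)" using X(1) q(1) compact_continuous_image by blast
  have UqX: "U ` q ` X = q ` X"
  proof -
    have "U ` q ` X = q ` T ` X" using U by (force simp: image_image)
    then show ?thesis using X(3) by simp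
  qed
  \<comment> \<open>Continuity comes from compactness: the preimage of a closed set under U is the
    image under q of a compact subset of X.\<close>
  have contU: "continuous_on (q ` X) U"
    unfolding continuous_on_closed_vimage[OF compact_imp_closed[OF qX]]
  proof (intro allI impI)
    fix C :: "'c set" assume C: "closed C"
    have "continuous_on X (\<lambda>x. q (T x))"
      by (rule continuous_on_compose2[OF q(1) X(2)]) (use X(3) in auto)
    then have "closed ((\<lambda>x. q (T x)) -` C \<inter> X)"
      using C continuous_on_closed_vimage[OF compact_imp_closed[OF X(1)]] by blast
    then have "compact (X \<inter> ((\<lambda>x. q (T x)) -` C \<inter> X))" by (rule compact_Int_closed[OF X(1)])
    then have "compact (q ` (X \<inter> ((\<lambda>x. q (T x)) -` C \<inter> X)))"
      by (rule compact_continuous_image[rotated]) (rule continuous_on_subset[OF q(1)], blast)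
    moreover have "q ` (X \<inter> ((\<lambda>x. q (T x)) -` C \<inter> X)) = U -` C \<inter> q ` X" using U by auto
    ultimately show "closed (U -` C \<inter> q ` X)" using compact_imp_closed by metis
  qed
  have "factor_map X T (q ` X) U q"
    using X q(1) qX contU UqX U by (simp add: factor_map_def TDS_def)
  moreover have "distal (q ` X) U"
    unfolding distal_def
  proof (intro ballI impI notI)
    fix z z' assume z: "z \<in> q ` X" "z' \<in> q ` X" "z \<noteq> z'" "proximal_pair U z z'"
    then obtain x x' where x: "x \<in> X" "x' \<in> X" "z = q x" "z' = q x'" by blast
    obtain u where u: "\<And>x. x \<in> X \<Longrightarrow> u x \<in> X" "\<And>x. u (u x) = u x"
      "\<And>x y. x \<in> X \<Longrightarrow> y \<in> X \<Longrightarrow> (u x, u y) \<in> closure (orbit (map_prod T T) (x, y))"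
      "\<And>x y. x \<in> X \<Longrightarrow> y \<in> X \<Longrightarrow> almost_periodic (map_prod T T) (u x, u y)"
      using ellis_retraction[OF X(1,2) TX'] by metis
    have qu: "q (u x) = q x" if "x \<in> X" for x
    proof -
      have "proximal_pair T x (u x)"
        using u(3)[of x "u x"] u(1,2) that by (intro proximal_pair_if_diagonal[of "u x"]) auto
      then have "(x, u x) \<in> R" using R(2) that u(1) by blast
      then show ?thesis using q(2) that u(1) by metis
    qed
    have W: "compact (X \<times> X)" "closed (X \<times> X)" "map_prod T T ` (X \<times> X) \<subseteq> X \<times> X"
      using compact_Times[OF X(1,1)] compact_imp_closed map_prod_invariant[OF TX' TX'] by auto
    have eq: "map_prod q q (map_prod T T w) = map_prod U U (map_prod q q w)" if "w \<in> X \<times> X" for w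
      using that U by auto
    have "almost_periodic (map_prod U U) (map_prod q q (u x, u x'))"
      using almost_periodic_image[where W = "X \<times> X" and F = "map_prod T T" and S = "map_prod U U"
          and \<phi> = "map_prod q q" and w = "(u x, u x')",
          OF W _ continuous_on_map_prod[OF q(1,1)] eq u(4)[OF x(1,2)]] x u(1) by simp
    then have "almost_periodic (map_prod U U) (z, z')" using x qu by simp
    then have "z = z'"
      using almost_periodic_proximal_eq[OF qX contU equalityD1[OF UqX] z(1,2,4)] by blast
    then show False using z(3) by blast
  qed
  ultimately show thesis using that by blast
qed

text \<open>The universal property enters here: X/R is a distal factor, so its quotient map factors
  through p and cannot separate points of a p-fibre.\<close>

lemma maximal_distal_factor_fibre:
  fixes X :: "'a::metric_space set"
  assumes "maximal_distal_factor X T Y S p"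
    and R: "closed R" "equiv X R" "\<And>x y. (x, y) \<in> R \<Longrightarrow> (T x, T y) \<in> R"
      "\<And>x y. x \<in> X \<Longrightarrow> y \<in> X \<Longrightarrow> proximal_pair T x y \<Longrightarrow> (x, y) \<in> R"
    and xy: "x \<in> X" "y \<in> X" "p x = p y"
  shows "(x, y) \<in> R"
proof -
  have X: "compact X" "continuous_on X T" "T ` X = X"
    using assms(1) by (auto simp: maximal_distal_factor_def factor_map_def TDS_def)
  obtain q :: "'a \<Rightarrow> nat \<Rightarrow> real" where q: "continuous_on X q"
    "\<And>x y. x \<in> X \<Longrightarrow> y \<in> X \<Longrightarrow> q x = q y \<longleftrightarrow> (x, y) \<in> R"
    using closed_equiv_separating_map[OF X(1) R(1,2)] by metis
  obtain U where "factor_map X T (q ` X) U q" "distal (q ` X) U"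
    by (rule distal_quotient[OF X, of R q]) (use R(3,4) q in blast)+
  then obtain r where "\<forall>x\<in>X. r (p x) = q x"
    using assms(1) unfolding maximal_distal_factor_def by blast
  then show ?thesis using q(2) xy by metis
qed

subsection \<open>Syndetically close pairs\<close>

lemma closure_boxE:
  assumes "(x, y) \<in> closure Z" "open A" "open B" "x \<in> A" "y \<in> B"
  obtains x' y' where "x' \<in> A" "y' \<in> B" "(x', y') \<in> Z"
proof -
  have "open (A \<times> B)" "(x, y) \<in> A \<times> B" using assms by (auto intro: open_Times)
  then have "Z \<inter> (A \<times> B) \<noteq> {}" using assms(1) unfolding closure_iff_nhds_not_empty by blast
  then show thesis using that by auto
qed

lemma closure_boxI:
  assumes "\<And>A B. open A \<Longrightarrow> open B \<Longrightarrow> x \<in> A \<Longrightarrow> y \<in> B \<Longrightarrow> \<exists>x'\<in>A. \<exists>y'\<in>B. (x', y') \<in> Z"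
  shows "(x, y) \<in> closure Z"
  unfolding closure_iff_nhds_not_empty
proof (intro allI impI)
  fix U V assume V: "V \<subseteq> U" "open V" "(x, y) \<in> V"
  then obtain A B where "open A" "open B" "x \<in> A" "y \<in> B" "A \<times> B \<subseteq> V"
    by (metis mem_Sigma_iff open_prod_elim)
  then show "Z \<inter> U \<noteq> {}" using assms[of A B] V by blast
qed

text \<open>Failure of thickness for the set of times with distance above d, with the gap m made
  explicit. For fixed d and m the weak inequality makes the relation closed on X, so that it passes
  to orbit closures.\<close>

definition syndetically_close :: "('a::metric_space \<Rightarrow> 'a) \<Rightarrow> real \<Rightarrow> nat \<Rightarrow> 'a \<Rightarrow> 'a \<Rightarrow> bool" where
  "syndetically_close T d m x y \<longleftrightarrow> (\<forall>k. \<exists>i\<le>m. dist ((T ^^ (k + i)) x) ((T ^^ (k + i)) y) \<le> d)"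

lemma syndetically_close_step:
  assumes "syndetically_close T d m x y"
  shows "syndetically_close T d m (T x) (T y)"
  unfolding syndetically_close_def
proof
  fix k
  obtain i where "i \<le> m" "dist ((T ^^ (Suc k + i)) x) ((T ^^ (Suc k + i)) y) \<le> d"
    using assms unfolding syndetically_close_def by blast
  then show "\<exists>i\<le>m. dist ((T ^^ (k + i)) (T x)) ((T ^^ (k + i)) (T y)) \<le> d"
    by (auto simp: funpow_swap1)
qed

text \<open>Nothing is known about the first n times, so the window grows by n.\<close>

lemma syndetically_close_funpow:
  assumes "syndetically_close T d m ((T ^^ n) x) ((T ^^ n) y)"
  shows "syndetically_close T d (m + n) x y"
  unfolding syndetically_close_def
proof
  fix k
  obtain i where i: "i \<le> m" "dist ((T ^^ (k + i)) ((T ^^ n) x)) ((T ^^ (k + i)) ((T ^^ n) y)) \<le> d"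
    using assms unfolding syndetically_close_def by blast
  have "(T ^^ (k + i)) ((T ^^ n) z) = (T ^^ (k + (i + n))) z" for z
    by (metis add.assoc comp_apply funpow_add)
  with i show "\<exists>j\<le>m + n. dist ((T ^^ (k + j)) x) ((T ^^ (k + j)) y) \<le> d"
    by (intro exI[of _ "i + n"]) auto
qed

lemma equicontinuous_upto:
  fixes X :: "'a::metric_space set"
  assumes X: "compact X" "continuous_on X T" "T ` X \<subseteq> X" and "d > 0"
  shows "\<exists>e>0. \<forall>x\<in>X. \<forall>y\<in>X. dist x y < e \<longrightarrow> (\<forall>i\<le>m. dist ((T ^^ i) x) ((T ^^ i) y) < d)"
proof (induction m)
  case 0
  show ?case using assms(4) by (intro exI[of _ d]) auto
next
  case (Suc m)
  then obtain e where e: "e > 0"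
    "\<And>x y i. x \<in> X \<Longrightarrow> y \<in> X \<Longrightarrow> dist x y < e \<Longrightarrow> i \<le> m \<Longrightarrow> dist ((T ^^ i) x) ((T ^^ i) y) < d"
    by blast
  have "uniformly_continuous_on X (T ^^ Suc m)"
    by (rule compact_uniformly_continuous[OF continuous_on_funpow[OF X(2,3)] X(1)])
  then obtain e' where e': "e' > 0"
    "\<And>x y. x \<in> X \<Longrightarrow> y \<in> X \<Longrightarrow> dist x y < e' \<Longrightarrow> dist ((T ^^ Suc m) x) ((T ^^ Suc m) y) < d"
    using assms(4) unfolding uniformly_continuous_on_def by metis
  show ?case
  proof (intro exI[of _ "min e e'"] conjI ballI impI allI)
    fix x y i assume "x \<in> X" "y \<in> X" "dist x y < min e e'" "i \<le> Suc m"
    then show "dist ((T ^^ i) x) ((T ^^ i) y) < d"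
      using e(2)[of x y i] e'(2)[of x y] by (cases "i = Suc m") auto
  qed (use e e' in auto)
qed

text \<open>The setting of the hard implication: a minimal homeomorphism that is not sensitive, and a
  factor whose fibres form the smallest invariant closed equivalence relation containing all
  proximal pairs; \<open>u\<close> is a minimal idempotent of the Ellis semigroup.\<close>

locale nonsensitive_factor =
  fixes X :: "'a::metric_space set" and T :: "'a \<Rightarrow> 'a"
    and Y :: "'b::metric_space set" and S :: "'b \<Rightarrow> 'b" and p :: "'a \<Rightarrow> 'b" and u :: "'a \<Rightarrow> 'a"
  assumes X: "compact X" "X \<noteq> {}" and T: "continuous_on X T" "T ` X = X" "inj_on T X"
    and dense: "\<And>x V. x \<in> X \<Longrightarrow> open V \<Longrightarrow> V \<inter> X \<noteq> {} \<Longrightarrow> \<exists>n. (T ^^ n) x \<in> V"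
    and Y: "compact Y" "continuous_on Y S" "S ` Y = Y" "inj_on S Y"
    and p: "continuous_on X p" "p ` X = Y" "\<And>x. x \<in> X \<Longrightarrow> p (T x) = S (p x)"
    and nonsensitive: "\<And>d. d > 0 \<Longrightarrow>
      \<exists>e>0. \<forall>x\<in>X. \<forall>y\<in>X. dist x y < e \<longrightarrow> (\<exists>m. syndetically_close T d m x y)"
    and proximal_fibre: "\<And>x y. x \<in> X \<Longrightarrow> y \<in> X \<Longrightarrow> proximal_pair T x y \<Longrightarrow> p x = p y"
    and fibre_minimal: "\<And>R x y. closed R \<Longrightarrow> equiv X R \<Longrightarrow> (\<And>x y. (x, y) \<in> R \<Longrightarrow> (T x, T y) \<in> R) \<Longrightarrow>
      (\<And>x y. x \<in> X \<Longrightarrow> y \<in> X \<Longrightarrow> proximal_pair T x y \<Longrightarrow> (x, y) \<in> R) \<Longrightarrow>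
      x \<in> X \<Longrightarrow> y \<in> X \<Longrightarrow> p x = p y \<Longrightarrow> (x, y) \<in> R"
    and u: "\<And>x. x \<in> X \<Longrightarrow> u x \<in> X" "\<And>x. x \<in> X \<Longrightarrow> u (T x) = T (u x)"
    and u_orbit: "\<And>x y. x \<in> X \<Longrightarrow> y \<in> X \<Longrightarrow> (u x, u y) \<in> closure (orbit (map_prod T T) (x, y))"
    and u_pair: "\<And>x y. x \<in> X \<Longrightarrow> y \<in> X \<Longrightarrow> almost_periodic (map_prod T T) (u x, u y)"
    and u_triple: "\<And>x y z. x \<in> X \<Longrightarrow> y \<in> X \<Longrightarrow> z \<in> X \<Longrightarrow>
      almost_periodic (map_triple T) (u x, u y, u z)"
begin

section \<open>Closeness at a single time, and transitivity of proximality\<close>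

abbreviation "TT \<equiv> map_prod T T"

lemma TX: "T ` X \<subseteq> X" using T(2) by simp

lemma T_in: "x \<in> X \<Longrightarrow> T x \<in> X" using TX by blast

lemma funpow_T_in: "x \<in> X \<Longrightarrow> (T ^^ n) x \<in> X" by (rule funpow_in[OF TX])

lemma XX: "compact (X \<times> X)" "closed (X \<times> X)" "TT ` (X \<times> X) \<subseteq> X \<times> X" "continuous_on (X \<times> X) TT"
  using compact_Times[OF X(1,1)] compact_imp_closed map_prod_invariant[OF TX TX]
    continuous_on_map_prod[OF T(1,1)] by auto

lemma XXX: "compact (X \<times> X \<times> X)" "closed (X \<times> X \<times> X)"
  "map_triple T ` (X \<times> X \<times> X) \<subseteq> X \<times> X \<times> X" "continuous_on (X \<times> X \<times> X) (map_triple T)"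
  using compact_Times[OF X(1) XX(1)] compact_imp_closed map_prod_invariant[OF TX XX(3)]
    continuous_on_map_prod[OF T(1) XX(4)] by auto

text \<open>Asking for one close time makes this relation open in X x X and stable under backward
  iteration. It is not stable forward; \<open>modulus\<close> repairs this at the price of a worse
  constant.\<close>

definition close_pairs :: "real \<Rightarrow> ('a \<times> 'a) set" where
  "close_pairs d = {(x, y). x \<in> X \<and> y \<in> X \<and> (\<exists>n. dist ((T ^^ n) x) ((T ^^ n) y) < d)}"

lemma close_pairs_nbhd:
  assumes "(x, y) \<in> close_pairs d"
  obtains A B where "open A" "open B" "x \<in> A" "y \<in> B"
    "\<And>x' y'. x' \<in> A \<Longrightarrow> y' \<in> B \<Longrightarrow> x' \<in> X \<Longrightarrow> y' \<in> X \<Longrightarrow> (x', y') \<in> close_pairs d"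
proof -
  obtain n where n: "x \<in> X" "y \<in> X" "dist ((T ^^ n) x) ((T ^^ n) y) < d"
    using assms by (auto simp: close_pairs_def)
  have "continuous_on (X \<times> X) (\<lambda>q. dist ((T ^^ n) (fst q)) ((T ^^ n) (snd q)))"
    by (intro continuous_intros continuous_on_compose2[OF continuous_on_funpow[OF T(1) TX]]) auto
  from openin_preimage_open[OF this open_lessThan[of d]]
  obtain V where V: "open V"
    "V \<inter> X \<times> X = {q \<in> X \<times> X. dist ((T ^^ n) (fst q)) ((T ^^ n) (snd q)) \<in> {..<d}}" .
  then have "(x, y) \<in> V" using n by (auto simp: set_eq_iff)
  then obtain A B where AB: "open A" "open B" "x \<in> A" "y \<in> B" "A \<times> B \<subseteq> V"
    using V(1) by (metis mem_Sigma_iff open_prod_elim)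
  show thesis
  proof (rule that[OF AB(1-4)])
    fix x' y' assume "x' \<in> A" "y' \<in> B" "x' \<in> X" "y' \<in> X"
    then have "(x', y') \<in> V \<inter> X \<times> X" using AB(5) by auto
    then show "(x', y') \<in> close_pairs d" unfolding V(2) close_pairs_def by auto
  qed
qed

lemma close_pairs_mono: "d \<le> e \<Longrightarrow> close_pairs d \<subseteq> close_pairs e"
  unfolding close_pairs_def by (auto intro: less_le_trans)

lemma close_pairs_sym: "(x, y) \<in> close_pairs d \<longleftrightarrow> (y, x) \<in> close_pairs d"
  by (auto simp: close_pairs_def dist_commute)

lemma close_pairs_funpow:
  assumes "((T ^^ n) x, (T ^^ n) y) \<in> close_pairs d" "x \<in> X" "y \<in> X"
  shows "(x, y) \<in> close_pairs d"
proof -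
  obtain k where "dist ((T ^^ k) ((T ^^ n) x)) ((T ^^ k) ((T ^^ n) y)) < d"
    using assms(1) by (auto simp: close_pairs_def)
  then have "dist ((T ^^ (k + n)) x) ((T ^^ (k + n)) y) < d" by (simp add: funpow_add)
  then show ?thesis using assms(2,3) unfolding close_pairs_def by blast
qed

lemma proximal_iff_close: "x \<in> X \<Longrightarrow> y \<in> X \<Longrightarrow> proximal_pair T x y \<longleftrightarrow> (\<forall>d>0. (x, y) \<in> close_pairs d)"
  by (simp add: proximal_pair_iff close_pairs_def)

lemma syndetically_close_imp_close:
  assumes "syndetically_close T d m x y" "d < e" "x \<in> X" "y \<in> X"
  shows "(x, y) \<in> close_pairs e"
proof -
  obtain i where "dist ((T ^^ (0 + i)) x) ((T ^^ (0 + i)) y) \<le> d"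
    using assms(1) unfolding syndetically_close_def by blast
  then have "dist ((T ^^ i) x) ((T ^^ i) y) < e" using assms(2) by simp
  then show ?thesis using assms(3,4) unfolding close_pairs_def by blast
qed

lemma closed_syndetically_close:
  "closed {q \<in> X \<times> X. syndetically_close T d m (fst q) (snd q)}"
proof -
  have "closed {q \<in> X \<times> X. dist ((T ^^ n) (fst q)) ((T ^^ n) (snd q)) \<le> d}" for n
    by (intro continuous_on_closed_Collect_le continuous_intros XX
        continuous_on_compose2[OF continuous_on_funpow[OF T(1) TX]]) auto
  then have "closed (\<Inter>k. \<Union>i\<in>{..m}. {q \<in> X \<times> X. dist ((T ^^ (k + i)) (fst q)) ((T ^^ (k + i)) (snd q)) \<le> d})"
    by (intro closed_INT ballI closed_UN) auto
  then show ?thesis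
    by (rule back_subst[of closed]) (fastforce simp: syndetically_close_def)
qed

text \<open>Insensitivity in the form in which it is used: the hypothesis asks for closeness at one
  unspecified time. The gap m still depends on the pair, which is what
  \<open>uniform_gap_box\<close> has to overcome.\<close>

definition modulus :: "real \<Rightarrow> real \<Rightarrow> bool" where
  "modulus d e \<longleftrightarrow> e > 0 \<and> (\<forall>x y. (x, y) \<in> close_pairs e \<longrightarrow> (\<exists>m. syndetically_close T d m x y))"

lemma modulus_exists:
  assumes "d > 0"
  obtains e where "modulus d e"
proof -
  obtain e where e: "e > 0" "\<forall>x\<in>X. \<forall>y\<in>X. dist x y < e \<longrightarrow> (\<exists>m. syndetically_close T d m x y)"
    using nonsensitive[OF assms] by blast
  have "\<exists>m. syndetically_close T d m x y" if xy: "(x, y) \<in> close_pairs e" for x y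
  proof -
    obtain n where n: "x \<in> X" "y \<in> X" "dist ((T ^^ n) x) ((T ^^ n) y) < e"
      using xy by (auto simp: close_pairs_def)
    then obtain m where "syndetically_close T d m ((T ^^ n) x) ((T ^^ n) y)"
      using e(2) funpow_T_in by blast
    then show ?thesis using syndetically_close_funpow by blast
  qed
  then show thesis using e(1) that[of e] by (simp add: modulus_def)
qed

text \<open>Closeness of one pair is only used at one time, so it has to persist over a whole gap of the
  syndetic set of times at which the other pair is close.\<close>

lemma close_pairs_triangle:
  assumes "d > 0"
  shows "\<exists>e>0. \<forall>x\<in>X. \<forall>y z. syndetically_close T d m x y \<longrightarrow> (y, z) \<in> close_pairs e \<longrightarrow>
      (x, z) \<in> close_pairs (2 * d)"
proof -
  obtain e where e: "e > 0"
    "\<And>x y i. x \<in> X \<Longrightarrow> y \<in> X \<Longrightarrow> dist x y < e \<Longrightarrow> i \<le> m \<Longrightarrow> dist ((T ^^ i) x) ((T ^^ i) y) < d"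
    using equicontinuous_upto[OF X(1) T(1) TX assms, of m] by blast
  show ?thesis
  proof (intro exI[of _ e] conjI e(1) ballI allI impI)
    fix x y z assume x: "x \<in> X" and s: "syndetically_close T d m x y" and c: "(y, z) \<in> close_pairs e"
    obtain n where n: "y \<in> X" "z \<in> X" "dist ((T ^^ n) y) ((T ^^ n) z) < e"
      using c by (auto simp: close_pairs_def)
    obtain i where i: "i \<le> m" "dist ((T ^^ (n + i)) x) ((T ^^ (n + i)) y) \<le> d"
      using s unfolding syndetically_close_def by blast
    have "dist ((T ^^ i) ((T ^^ n) y)) ((T ^^ i) ((T ^^ n) z)) < d"
      by (rule e(2)[OF funpow_T_in[OF n(1)] funpow_T_in[OF n(2)] n(3) i(1)])
    then have "dist ((T ^^ (n + i)) y) ((T ^^ (n + i)) z) < d"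
      by (simp add: add.commute[of n] funpow_add)
    then have "dist ((T ^^ (n + i)) x) ((T ^^ (n + i)) z) < 2 * d"
      using i(2) dist_triangle[of "(T ^^ (n + i)) x" "(T ^^ (n + i)) z" "(T ^^ (n + i)) y"] by linarith
    then show "(x, z) \<in> close_pairs (2 * d)" using x n(2) unfolding close_pairs_def by blast
  qed
qed

text \<open>The order of choices matters: the gap m for (x, y) comes first, then a scale e'
  depending on m, and only then a time at which y and z are e'-close.\<close>

lemma proximal_trans:
  assumes "x \<in> X" "y \<in> X" "z \<in> X" "proximal_pair T x y" "proximal_pair T y z"
  shows "proximal_pair T x z"
proof -
  have "(x, z) \<in> close_pairs d" if "d > 0" for d
  proof -
    have d: "d / 2 > 0" using that by simp
    obtain e where e: "modulus (d / 2) e" using modulus_exists[OF d] .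
    then obtain m where m: "syndetically_close T (d / 2) m x y"
      using assms proximal_iff_close unfolding modulus_def by blast
    obtain e' where e': "e' > 0" "\<forall>x\<in>X. \<forall>y z. syndetically_close T (d / 2) m x y \<longrightarrow>
        (y, z) \<in> close_pairs e' \<longrightarrow> (x, z) \<in> close_pairs (2 * (d / 2))"
      using close_pairs_triangle[OF d] by blast
    have "(y, z) \<in> close_pairs e'" using assms e'(1) proximal_iff_close by blast
    then have "(x, z) \<in> close_pairs (2 * (d / 2))" using e'(2) assms(1) m by blast
    then show ?thesis by simp
  qed
  then show ?thesis using proximal_iff_close assms by blast
qed

text \<open>Being close with a fixed gap m is a closed invariant relation, so it survives the
  passage to shadows. The shadows are thus proximal as well as almost periodic, hence equal.\<close>

lemma u_proximal:
  assumes "x \<in> X" "y \<in> X" "proximal_pair T x y"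
  shows "u x = u y"
proof -
  have "(u x, u y) \<in> close_pairs d" if "d > 0" for d
  proof -
    have d: "d / 2 > 0" using that by simp
    obtain e where e: "modulus (d / 2) e" using modulus_exists[OF d] .
    then obtain m where m: "syndetically_close T (d / 2) m x y"
      using assms proximal_iff_close unfolding modulus_def by blast
    let ?K = "{q \<in> X \<times> X. syndetically_close T (d / 2) m (fst q) (snd q)}"
    have "closure (orbit TT (x, y)) \<subseteq> ?K"
      by (rule closure_orbit_subset[OF closed_syndetically_close])
        (use m assms syndetically_close_step T_in in auto)
    then have "syndetically_close T (d / 2) m (u x) (u y)" using u_orbit[OF assms(1,2)] by auto
    then show ?thesis by (rule syndetically_close_imp_close) (use that assms u in auto)
  qed
  then have "proximal_pair T (u x) (u y)" using proximal_iff_close assms u by blast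
  then show ?thesis
    using almost_periodic_proximal_eq[OF X(1) T(1) TX] u(1) assms u_pair by blast
qed

lemma closure_orbit_pair_subset:
  "closed C \<Longrightarrow> TT ` C \<subseteq> C \<Longrightarrow> (x, y) \<in> C \<Longrightarrow> closure (orbit TT (x, y)) \<subseteq> C"
  by (rule closure_orbit_subset)

subsection \<open>Fibre pairs over points of openness\<close>

text \<open>The fibres of p as the sections of a compact relation. Lower semicontinuity of this
  relation at p x says that p is open at every point of the fibre through x, which replaces openness
  of p.\<close>

definition graph :: "('b \<times> 'a) set" where "graph = (\<lambda>x. (p x, x)) ` X"

definition open_points :: "'a set" where "open_points = {x \<in> X. lsc_at Y graph (p x)}"

lemma compact_graph: "compact graph" "graph \<subseteq> Y \<times> X"
  using p X(1) unfolding graph_def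
  by (auto intro!: compact_continuous_image continuous_on_Pair continuous_on_id)

lemma closure_orbit_dense:
  assumes "closed W" "continuous_on W F" "F ` W \<subseteq> W" "w \<in> W" "almost_periodic F w"
    "v \<in> closure (orbit F w)" "open V" "V \<inter> closure (orbit F w) \<noteq> {}"
  shows "\<exists>n. (F ^^ n) v \<in> V"
proof -
  obtain z where "z \<in> V" "z \<in> closure (orbit F w)" using assms(8) by blast
  then have "z \<in> closure (orbit F v)" using almost_periodic_closure_orbit(1)[OF assms(1-6)] by simp
  then show ?thesis using \<open>z \<in> V\<close> assms(7) unfolding in_closure_orbit_iff by blast
qed

lemma comeager_open_points: "comeager_in X open_points"
proof -
  have "comeager_in Y {y. lsc_at Y graph y}"
    by (rule comeager_lsc_at[OF X(1) compact_graph])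
  from comeager_factor_preimage[OF Y this TX dense p]
  have "comeager_in X {x. p x \<in> {y. lsc_at Y graph y}}" by simp
  then show ?thesis by (rule comeager_in_mono) (auto simp: open_points_def)
qed

text \<open>The orbit closure of an almost periodic point is minimal and \<phi> maps it onto X, so a
  comeager condition on one coordinate of a pair or triple can be met inside its orbit
  closure.\<close>

lemma comeager_orbit_preimage:
  fixes F :: "'c::metric_space \<Rightarrow> 'c"
  assumes W: "compact W" "closed W" "F ` W \<subseteq> W" "continuous_on W F" "w \<in> W" "almost_periodic F w"
    and \<phi>: "continuous_on W \<phi>" "\<phi> ` W \<subseteq> X" "\<And>v. v \<in> W \<Longrightarrow> \<phi> (F v) = T (\<phi> v)"
    and D: "comeager_in X D"
  shows "comeager_in (closure (orbit F w)) {v. \<phi> v \<in> D}"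
proof -
  have sub: "closure (orbit F w) \<subseteq> W" by (rule closure_orbit_subset[OF W(2,3,5)])
  show ?thesis
  proof (rule comeager_factor_preimage[OF X(1) T D])
    show "F ` closure (orbit F w) \<subseteq> closure (orbit F w)"
      by (rule closure_orbit_invariant[OF W(2,4,3,5)])
    show "\<exists>n. (F ^^ n) v \<in> V"
      if "v \<in> closure (orbit F w)" "open V" "V \<inter> closure (orbit F w) \<noteq> {}" for v V
      using closure_orbit_dense[OF W(2,4,3,5,6)] that by blast
    show "continuous_on (closure (orbit F w)) \<phi>" using \<phi>(1) sub by (rule continuous_on_subset)
    have "\<phi> ` closure (orbit F w) = closure (orbit T (\<phi> w))"
      by (rule image_closure_orbit[where W = W, OF W(1,2,3,5) \<phi>(1,3)])
    also have "\<dots> = X"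
    proof
      have w: "\<phi> w \<in> X" using \<phi>(2) W(5) by blast
      show "closure (orbit T (\<phi> w)) \<subseteq> X"
        by (rule closure_orbit_subset[OF compact_imp_closed[OF X(1)] TX w])
      show "X \<subseteq> closure (orbit T (\<phi> w))"
      proof
        fix x assume "x \<in> X"
        then show "x \<in> closure (orbit T (\<phi> w))"
          unfolding in_closure_orbit_iff using dense[OF w] by blast
      qed
    qed
    finally show "\<phi> ` closure (orbit F w) = X" .
    show "\<phi> (F v) = T (\<phi> v)" if "v \<in> closure (orbit F w)" for v using \<phi>(3) that sub by blast
  qed
qed

lemma comeager_orbit_pair:
  assumes "x \<in> X" "y \<in> X" "almost_periodic TT (x, y)" "comeager_in X D"
  shows "comeager_in (closure (orbit TT (x, y))) {q. fst q \<in> D}"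
    "comeager_in (closure (orbit TT (x, y))) {q. snd q \<in> D}"
  by (rule comeager_orbit_preimage[where W = "X \<times> X" and F = TT and w = "(x, y)", OF XX];
      use assms in \<open>auto intro: continuous_on_fst continuous_on_snd continuous_on_id\<close>)+

lemma comeager_orbit_triple:
  assumes "x \<in> X" "y \<in> X" "z \<in> X" "almost_periodic (map_triple T) (x, y, z)" "comeager_in X D"
  shows "comeager_in (closure (orbit (map_triple T) (x, y, z))) {q. fst (snd q) \<in> D}"
    "comeager_in (closure (orbit (map_triple T) (x, y, z))) {q. snd (snd q) \<in> D}"
  by (rule comeager_orbit_preimage[where W = "X \<times> X \<times> X" and F = "map_triple T" and w = "(x, y, z)", OF XXX];
      use assms in \<open>auto intro!: continuous_on_fst continuous_on_snd continuous_on_id\<close>)+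

text \<open>T and S are homeomorphisms intertwined by p, so neighbourhoods witnessing openness can
  be carried along in both directions.\<close>

lemma T_open_points_iff:
  assumes "x \<in> X"
  shows "T x \<in> open_points \<longleftrightarrow> x \<in> open_points"
proof
  have g: "(y, z) \<in> graph \<longleftrightarrow> z \<in> X \<and> y = p z" for y z by (auto simp: graph_def)
  assume "T x \<in> open_points"
  then have l: "lsc_at Y graph (S (p x))" using p(3)[OF assms] by (simp add: open_points_def)
  have "lsc_at Y graph (p x)" unfolding lsc_at_def
  proof (intro allI impI)
    fix z V assume z: "(p x, z) \<in> graph" "open V" "z \<in> V"
    obtain V1 where V1: "open V1" "V1 \<inter> X = T ` (V \<inter> X)"
      using homeo_image_open[OF X(1) T z(2)] .
    have "(S (p x), T z) \<in> graph" "T z \<in> V1" using z V1 p(3) T_in by (auto simp: g)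
    then obtain W where W: "open W" "S (p x) \<in> W" "\<And>y'. y' \<in> W \<inter> Y \<Longrightarrow> \<exists>z'\<in>V1. (y', z') \<in> graph"
      using l V1(1) unfolding lsc_at_def by meson
    obtain W' where W': "open W'" "W' \<inter> Y = {y \<in> Y. S y \<in> W}"
      using openin_preimage_open[OF Y(2) W(1)] .
    have pY: "p x \<in> Y" using assms p(2) by blast
    have "\<exists>z'\<in>V. (y', z') \<in> graph" if "y' \<in> W' \<inter> Y" for y'
    proof -
      have y': "y' \<in> Y" "S y' \<in> W \<inter> Y" using that W'(2) Y(3) by auto
      then obtain z1 where z1: "z1 \<in> V1" "z1 \<in> X" "S y' = p z1" using W(3)[OF y'(2)] by (auto simp: g)
      then obtain z2 where z2: "z2 \<in> V" "z2 \<in> X" "z1 = T z2" using V1(2) by blast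
      then have "S y' = S (p z2)" using z1 p(3) by simp
      then have "y' = p z2" using Y(4) y'(1) z2(2) p(2) by (meson imageI inj_onD)
      then show ?thesis using z2 by (auto simp: g)
    qed
    then show "\<exists>W. open W \<and> p x \<in> W \<and> (\<forall>x'\<in>W \<inter> Y. \<exists>z'\<in>V. (x', z') \<in> graph)"
      using W' W(2) pY by (intro exI[of _ W']) (auto simp: set_eq_iff)
  qed
  then show "x \<in> open_points" using assms by (simp add: open_points_def)
next
  have g: "(y, z) \<in> graph \<longleftrightarrow> z \<in> X \<and> y = p z" for y z by (auto simp: graph_def)
  assume "x \<in> open_points"
  then have l: "lsc_at Y graph (p x)" by (simp add: open_points_def)
  have pY: "p x \<in> Y" using assms p(2) by blast
  have "lsc_at Y graph (S (p x))" unfolding lsc_at_def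
  proof (intro allI impI)
    fix z V assume z: "(S (p x), z) \<in> graph" "open V" "z \<in> V"
    then obtain z0 where z0: "z0 \<in> X" "z = T z0" using T(2) by (auto simp: g)
    then have "S (p x) = S (p z0)" using z p(3) by (simp add: g)
    then have pz0: "p x = p z0" using Y(4) pY z0(1) p(2) by (meson imageI inj_onD)
    obtain V1 where V1: "open V1" "V1 \<inter> X = {y \<in> X. T y \<in> V}"
      using openin_preimage_open[OF T(1) z(2)] .
    then have "z0 \<in> V1" using z0 z(3) by (auto simp: set_eq_iff)
    moreover have "(p x, z0) \<in> graph" using pz0 z0 by (simp add: g)
    ultimately obtain W where W: "open W" "p x \<in> W"
      "\<And>y'. y' \<in> W \<inter> Y \<Longrightarrow> \<exists>z'\<in>V1. (y', z') \<in> graph"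
      using l V1(1) unfolding lsc_at_def by meson
    obtain W' where W': "open W'" "W' \<inter> Y = S ` (W \<inter> Y)"
      using homeo_image_open[OF Y W(1)] .
    have "\<exists>z'\<in>V. (y', z') \<in> graph" if y': "y' \<in> W' \<inter> Y" for y'
    proof -
      obtain y1 where y1: "y1 \<in> W \<inter> Y" "y' = S y1" using y' unfolding W'(2) by blast
      then obtain z1 where z1: "z1 \<in> V1" "z1 \<in> X" "y1 = p z1" using W(3) by (auto simp: g)
      then have "T z1 \<in> V" using V1(2) by blast
      moreover have "(y', T z1) \<in> graph" using y1 z1 p(3) T_in by (simp add: g)
      ultimately show ?thesis by blast
    qed
    then show "\<exists>W. open W \<and> S (p x) \<in> W \<and> (\<forall>x'\<in>W \<inter> Y. \<exists>z'\<in>V. (x', z') \<in> graph)"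
      using W' W(2) pY by (intro exI[of _ W']) auto
  qed
  then show "T x \<in> open_points" using assms p(3) T_in by (simp add: open_points_def)
qed

text \<open>The working form of openness: when a moves slightly to a', a point c of its fibre can
  follow to a point c' of the new fibre.\<close>

lemma open_points_nbhd:
  assumes "a \<in> open_points" "c \<in> X" "p c = p a" "open V" "c \<in> V"
  shows "\<exists>W. open W \<and> a \<in> W \<and> (\<forall>a'\<in>W \<inter> X. \<exists>c'\<in>V. c' \<in> X \<and> p c' = p a')"
proof -
  have g: "(y, z) \<in> graph \<longleftrightarrow> z \<in> X \<and> y = p z" for y z by (auto simp: graph_def)
  have a: "a \<in> X" "lsc_at Y graph (p a)" using assms(1) by (auto simp: open_points_def)
  have "(p a, c) \<in> graph" using assms by (simp add: g)
  then obtain W where W: "open W" "p a \<in> W" "\<And>y'. y' \<in> W \<inter> Y \<Longrightarrow> \<exists>z'\<in>V. (y', z') \<in> graph"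
    using a(2) assms(4,5) unfolding lsc_at_def by meson
  obtain W' where W': "open W'" "W' \<inter> X = {x \<in> X. p x \<in> W}"
    using openin_preimage_open[OF p(1) W(1)] .
  show ?thesis
  proof (intro exI[of _ W'] conjI W'(1) ballI)
    show "a \<in> W'" using a W W' by (auto simp: set_eq_iff)
    fix a' assume "a' \<in> W' \<inter> X"
    then have "p a' \<in> W \<inter> Y" using W'(2) p(2) by auto
    then obtain c' where "c' \<in> V" "(p a', c') \<in> graph" using W(3) by blast
    then show "\<exists>c'\<in>V. c' \<in> X \<and> p c' = p a'" by (auto simp: g)
  qed
qed

lemma open_points_fibre: "a \<in> open_points \<Longrightarrow> c \<in> X \<Longrightarrow> p c = p a \<Longrightarrow> c \<in> open_points"
  by (simp add: open_points_def)

definition fibre_pairs :: "('a \<times> 'a) set" where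
  "fibre_pairs = {(x, y). x \<in> X \<and> y \<in> X \<and> p x = p y}"

text \<open>The condition on the first coordinate alone is symmetric, since
  \<open>open_points\<close> is a union of fibres. The closure \<open>pairs\<close> may be smaller
  than \<open>fibre_pairs\<close>, for example when p is almost one-to-one.\<close>

definition open_pairs :: "('a \<times> 'a) set" where
  "open_pairs = {(x, y). x \<in> open_points \<and> y \<in> X \<and> p x = p y}"

lemma closed_fibre_pairs: "closed fibre_pairs" "TT ` fibre_pairs \<subseteq> fibre_pairs"
proof -
  have "closed {q \<in> X \<times> X. p (fst q) = p (snd q)}"
    by (rule continuous_closed_preimage_constant[of "X \<times> X" "\<lambda>q. dist (p (fst q)) (p (snd q))" 0, simplified])
      (auto intro!: continuous_intros continuous_on_compose2[OF p(1)] XX(2))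
  moreover have "{q \<in> X \<times> X. p (fst q) = p (snd q)} = fibre_pairs" by (auto simp: fibre_pairs_def)
  ultimately show "closed fibre_pairs" by simp
  show "TT ` fibre_pairs \<subseteq> fibre_pairs" using p(3) T_in by (auto simp: fibre_pairs_def)
qed

lemma open_pairs_subset: "open_pairs \<subseteq> fibre_pairs" "fibre_pairs \<subseteq> X \<times> X"
  by (auto simp: open_pairs_def fibre_pairs_def open_points_def)

lemma closure_open_pairs_subset: "closure open_pairs \<subseteq> fibre_pairs"
  by (rule closure_minimal[OF open_pairs_subset(1) closed_fibre_pairs(1)])

lemma open_pairs_sym: "(x, y) \<in> open_pairs \<longleftrightarrow> (y, x) \<in> open_pairs"
  using open_points_fibre by (auto simp: open_pairs_def open_points_def)

lemma open_pairs_T: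
  assumes "x \<in> X" "y \<in> X"
  shows "(T x, T y) \<in> open_pairs \<longleftrightarrow> (x, y) \<in> open_pairs"
proof -
  have "p (T x) = p (T y) \<longleftrightarrow> p x = p y"
    using inj_on_eq_iff[OF Y(4), of "p x" "p y"] p(2,3) assms by auto
  then show ?thesis using T_open_points_iff[OF assms(1)] assms T_in by (simp add: open_pairs_def)
qed

lemma closure_invariant:
  assumes "Z \<subseteq> X \<times> X" "TT ` Z \<subseteq> closure Z'" 
  shows "TT ` closure Z \<subseteq> closure Z'"
proof (rule image_closure_subset)
  have "closure Z \<subseteq> X \<times> X" by (rule closure_minimal[OF assms(1) XX(2)])
  then show "continuous_on (closure Z) TT" using XX(4) continuous_on_subset by blast
qed (use assms in auto)

lemma closure_sym:
  assumes "\<And>x y. (x, y) \<in> Z \<Longrightarrow> (y, x) \<in> Z" "(x, y) \<in> closure Z"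
  shows "(y, x) \<in> closure Z"
proof (rule closure_boxI)
  fix A B assume "open A" "open B" "y \<in> A" "x \<in> B"
  then obtain x' y' where "x' \<in> B" "y' \<in> A" "(x', y') \<in> Z" using closure_boxE[OF assms(2)] by metis
  then show "\<exists>x'\<in>A. \<exists>y'\<in>B. (x', y') \<in> Z" using assms(1) by blast
qed

abbreviation "pairs \<equiv> closure open_pairs"

lemma pairs_invariant: "TT ` pairs \<subseteq> pairs"
proof (rule closure_invariant)
  show "open_pairs \<subseteq> X \<times> X" using open_pairs_subset by blast
  have "TT q \<in> open_pairs" if "q \<in> open_pairs" for q
  proof (cases q)
    case (Pair x y)
    then have "x \<in> X" "y \<in> X" using that open_pairs_subset by auto
    then show ?thesis using that Pair open_pairs_T by simp
  qed
  then show "TT ` open_pairs \<subseteq> pairs"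
    using subsetD[OF closure_subset[of open_pairs]] by (intro image_subsetI) simp
qed

lemma pairs_sym: "(x, y) \<in> pairs \<Longrightarrow> (y, x) \<in> pairs"
  by (rule closure_sym) (simp_all add: open_pairs_sym)

subsection \<open>The relative regionally proximal relation\<close>

definition near :: "real \<Rightarrow> ('a \<times> 'a) set" where
  "near d = closure (close_pairs d \<inter> open_pairs)"

text \<open>The regionally proximal relation of p, except that the approximating close pairs must
  lie over points of openness.\<close>

definition rprox :: "('a \<times> 'a) set" where "rprox = (\<Inter>d\<in>{0<..}. near d)"

lemma closed_near: "closed (near d)" "near d \<subseteq> pairs"
  by (auto simp: near_def intro: closure_mono[THEN subsetD])

lemma closed_rprox: "closed rprox"
  unfolding rprox_def using closed_near by blast

lemma rprox_near: "q \<in> rprox \<Longrightarrow> d > 0 \<Longrightarrow> q \<in> near d"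
  by (auto simp: rprox_def)

lemma rproxI: "(\<And>d. d > 0 \<Longrightarrow> q \<in> near d) \<Longrightarrow> q \<in> rprox"
  by (auto simp: rprox_def)

lemma rprox_subset: "rprox \<subseteq> pairs" "rprox \<subseteq> fibre_pairs" "rprox \<subseteq> X \<times> X"
proof -
  show "rprox \<subseteq> pairs" using rprox_near[of _ 1] closed_near by force
  then show "rprox \<subseteq> fibre_pairs" "rprox \<subseteq> X \<times> X"
    using closure_open_pairs_subset open_pairs_subset by blast+
qed

lemma near_sym: "(x, y) \<in> near d \<Longrightarrow> (y, x) \<in> near d"
  unfolding near_def by (rule closure_sym) (use close_pairs_sym open_pairs_sym in auto)

lemma rprox_sym: "(x, y) \<in> rprox \<Longrightarrow> (y, x) \<in> rprox"
  using near_sym by (auto simp: rprox_def)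

text \<open>A single close time may be lost by applying T. Syndetic closeness, supplied by
  \<open>modulus\<close>, survives, and the loss from e to d disappears in the intersection over all
  d.\<close>

lemma rprox_invariant: "TT ` rprox \<subseteq> rprox"
proof (rule image_subsetI)
  fix q' assume q': "q' \<in> rprox"
  show "TT q' \<in> rprox"
  proof (rule rproxI)
    fix d :: real assume d: "d > 0"
    obtain e where e: "modulus (d / 2) e" using modulus_exists[of "d / 2"] d by auto
    have "TT ` (close_pairs e \<inter> open_pairs) \<subseteq> close_pairs d \<inter> open_pairs"
    proof (rule image_subsetI)
      fix q assume q: "q \<in> close_pairs e \<inter> open_pairs"
      obtain x y where [simp]: "q = (x, y)" by (cases q)
      have xy: "(x, y) \<in> close_pairs e" "(x, y) \<in> open_pairs" using q by auto
      from xy(1) have X': "x \<in> X" "y \<in> X" by (auto simp: close_pairs_def)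
      obtain m where "syndetically_close T (d / 2) m x y"
        using e xy(1) unfolding modulus_def by blast
      then have "syndetically_close T (d / 2) m (T x) (T y)" by (rule syndetically_close_step)
      then have "(T x, T y) \<in> close_pairs d"
        by (rule syndetically_close_imp_close) (use X' T_in d in auto)
      then show "TT q \<in> close_pairs d \<inter> open_pairs" using open_pairs_T[OF X'] xy(2) by simp
    qed
    then have "TT ` (close_pairs e \<inter> open_pairs) \<subseteq> near d"
      unfolding near_def by (rule subset_trans[OF _ closure_subset])
    moreover have "close_pairs e \<inter> open_pairs \<subseteq> X \<times> X" by (auto simp: close_pairs_def)
    ultimately have "TT ` near e \<subseteq> near d"
      unfolding near_def by (intro closure_invariant)
    moreover have "q' \<in> near e" using rprox_near[OF q'] e by (simp add: modulus_def)
    ultimately show "TT q' \<in> near d" by (rule subsetD[OF _ imageI])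
  qed
qed

text \<open>T maps boxes to relatively open boxes, so approximating pairs can be found near the
  image and pulled back; closeness at one time is stable under pulling back.\<close>

lemma near_pull_back:
  assumes "x \<in> X" "y \<in> X" "(T x, T y) \<in> near d"
  shows "(x, y) \<in> near d"
  unfolding near_def
proof (rule closure_boxI)
  fix A B assume AB: "open A" "open B" "x \<in> A" "y \<in> B"
  obtain A' where A': "open A'" "A' \<inter> X = T ` (A \<inter> X)" using homeo_image_open[OF X(1) T AB(1)] .
  obtain B' where B': "open B'" "B' \<inter> X = T ` (B \<inter> X)" using homeo_image_open[OF X(1) T AB(2)] .
  have "T x \<in> A'" "T y \<in> B'" using AB A' B' assms by blast+
  then obtain x1 y1 where 1: "x1 \<in> A'" "y1 \<in> B'" "(x1, y1) \<in> close_pairs d \<inter> open_pairs"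
    using closure_boxE[OF assms(3)[unfolded near_def] A'(1) B'(1)] by metis
  then have "x1 \<in> X" "y1 \<in> X" by (auto simp: close_pairs_def)
  then obtain x2 y2 where 2: "x2 \<in> A" "x2 \<in> X" "x1 = T x2" "y2 \<in> B" "y2 \<in> X" "y1 = T y2"
    using 1 A' B' by blast
  then have "(x2, y2) \<in> open_pairs" using 1 open_pairs_T by simp
  moreover have "(x2, y2) \<in> close_pairs d"
    using 1 2 close_pairs_funpow[of 1 x2 y2 d] by simp
  ultimately show "\<exists>x'\<in>A. \<exists>y'\<in>B. (x', y') \<in> close_pairs d \<inter> open_pairs" using 2 by blast
qed

section \<open>Almost periodic regionally proximal pairs and their transitivity\<close>

lemma diagonal_rprox:
  assumes "x \<in> X" shows "(x, x) \<in> rprox"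
proof (rule rproxI)
  fix d :: real assume d: "d > 0"
  show "(x, x) \<in> near d"
    unfolding near_def
  proof (rule closure_boxI)
    fix A B assume AB: "open A" "open B" "x \<in> A" "x \<in> B"
    then have "open (A \<inter> B)" "(A \<inter> B) \<inter> X \<noteq> {}" using assms by auto
    then obtain z where z: "z \<in> A \<inter> B" "z \<in> X" "z \<in> open_points"
      using comeager_in_dense[OF X(1) comeager_open_points] by metis
    have "(z, z) \<in> close_pairs d" "(z, z) \<in> open_pairs"
      using z d by (auto simp: close_pairs_def open_pairs_def)
    then show "\<exists>x'\<in>A. \<exists>y'\<in>B. (x', y') \<in> close_pairs d \<inter> open_pairs" using z by blast
  qed
qed

text \<open>Almost periodicity is imposed so that a pair can be moved within a minimal orbit closure
  until a chosen coordinate is generic, without leaving the relation.\<close>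

definition ap_pairs :: "('a \<times> 'a) set" where
  "ap_pairs = {q \<in> rprox. almost_periodic TT q}"

lemma ap_pairs_sym: "(x, y) \<in> ap_pairs \<Longrightarrow> (y, x) \<in> ap_pairs"
proof -
  assume xy: "(x, y) \<in> ap_pairs"
  then have "(x, y) \<in> X \<times> X" using rprox_subset(3) by (auto simp: ap_pairs_def)
  moreover have "continuous_on (X \<times> X) prod.swap"
    unfolding prod.swap_def by (intro continuous_intros)
  moreover have "almost_periodic TT (x, y)" using xy by (simp add: ap_pairs_def)
  ultimately have "almost_periodic TT (prod.swap (x, y))"
    using almost_periodic_image[where W = "X \<times> X" and F = TT and S = TT and \<phi> = prod.swap
        and w = "(x, y)", OF XX(1,2,3)] by auto
  then show "(y, x) \<in> ap_pairs" using xy rprox_sym by (auto simp: ap_pairs_def)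
qed

lemma ap_pairs_orbit:
  assumes "q \<in> ap_pairs" "q' \<in> closure (orbit TT q)"
  shows "q' \<in> ap_pairs"
proof -
  have q: "q \<in> rprox" "almost_periodic TT q" "q \<in> X \<times> X"
    using assms(1) rprox_subset(3) by (auto simp: ap_pairs_def)
  have "q' \<in> rprox" using closure_orbit_subset[OF closed_rprox rprox_invariant q(1)] assms(2) by blast
  then show ?thesis
    using almost_periodic_closure_orbit(2)[OF XX(2,4,3) q(3,2) assms(2)] by (simp add: ap_pairs_def)
qed

lemma closure_ap_pairs: "closure ap_pairs \<subseteq> rprox"
  by (rule closure_minimal[OF _ closed_rprox]) (auto simp: ap_pairs_def)

text \<open>At such a point, partners in \<open>closure ap_pairs\<close>, in \<open>pairs\<close>
  and in the fibre all persist under small moves. The condition on \<open>pairs\<close> serves the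
  closedness of \<open>shadow_rprox\<close>.\<close>

definition generic_points :: "'a set" where
  "generic_points = {x. lsc_at X (closure ap_pairs) x} \<inter> {x. lsc_at X pairs x} \<inter> open_points"

lemma comeager_generic: "comeager_in X generic_points"
proof -
  have sub: "closure ap_pairs \<subseteq> X \<times> X" "pairs \<subseteq> X \<times> X"
    using closure_ap_pairs rprox_subset closure_open_pairs_subset open_pairs_subset by blast+
  have "compact (closure ap_pairs)" "compact pairs"
    using compact_Int_closed[OF XX(1) closed_closure[of ap_pairs]]
      compact_Int_closed[OF XX(1) closed_closure[of open_pairs]] sub by (simp_all add: inf.absorb2)
  then show ?thesis unfolding generic_points_def
    using sub by (intro comeager_in_Int comeager_lsc_at[OF X(1)] comeager_open_points)
qed

text \<open>By Baire's theorem the gap length is locally constant on a dense open set of pairs.\<close>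

lemma uniform_gap_box:
  assumes e: "modulus d e" and ca: "(c, a) \<in> near e" "open C" "c \<in> C" "open A" "a \<in> A"
  shows "\<exists>C' A' m. open C' \<and> open A' \<and> C' \<subseteq> C \<and> A' \<subseteq> A \<and>
    (\<exists>c'\<in>C'. \<exists>a'\<in>A'. (c', a') \<in> open_pairs) \<and>
    (\<forall>x\<in>C'. \<forall>y\<in>A'. (x, y) \<in> open_pairs \<longrightarrow> syndetically_close T d m x y)"
proof (rule ccontr)
  assume no: "\<not> ?thesis"
  obtain c0 a0 where 0: "c0 \<in> C" "a0 \<in> A" "(c0, a0) \<in> close_pairs e \<inter> open_pairs"
    using closure_boxE[OF ca(1)[unfolded near_def] ca(2,4,3,5)] by metis
  then obtain C0 A0 where 1: "open C0" "open A0" "c0 \<in> C0" "a0 \<in> A0"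
    "\<And>x y. x \<in> C0 \<Longrightarrow> y \<in> A0 \<Longrightarrow> x \<in> X \<Longrightarrow> y \<in> X \<Longrightarrow> (x, y) \<in> close_pairs e"
    using close_pairs_nbhd[of c0 a0 e] by (metis IntD1)
  define O0 where "O0 = (C \<inter> C0) \<times> (A \<inter> A0)"
  have O0: "open O0" "(c0, a0) \<in> O0" using 0 1 ca by (auto simp: O0_def intro: open_Times)
  \<comment> \<open>The compact set in which Baire is applied. Every open set meeting this closure
    meets \<open>O0 \<inter> pairs\<close>, hence contains an actual open pair of
    \<open>O0\<close>.\<close>
  define Q where "Q = closure (O0 \<inter> pairs)"
  have pXX: "pairs \<subseteq> X \<times> X" using closure_open_pairs_subset open_pairs_subset by blast
  have QN: "Q \<subseteq> pairs" unfolding Q_def by (rule closure_minimal) auto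
  have "compact Q"
    using compact_Int_closed[OF XX(1), of Q] QN pXX by (simp add: Q_def inf.absorb2)
  define K where "K m = {q \<in> X \<times> X. syndetically_close T d m (fst q) (snd q)}" for m
  have K: "closed (K m)" for m unfolding K_def by (rule closed_syndetically_close)
  \<comment> \<open>By the contradiction hypothesis no box around an open pair has uniform gap m, so
    K m has no relative interior in Q. But every pair in \<open>O0\<close> is e-close, so by
    \<open>modulus\<close> the sets K m cover \<open>O0 \<inter> Q\<close>.\<close>
  have "comeager_in Q (- K m)" for m
  proof (rule comeager_in_open)
    show "open (- K m)" using K by blast
    fix V assume V: "open V" "V \<inter> Q \<noteq> {}"
    then have "V \<inter> (O0 \<inter> pairs) \<noteq> {}"
      unfolding Q_def using open_Int_closure_eq_empty[of V "O0 \<inter> pairs"] by simp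
    then have "(V \<inter> O0) \<inter> closure open_pairs \<noteq> {}" by (simp add: Int_assoc)
    then have "(V \<inter> O0) \<inter> open_pairs \<noteq> {}"
      using open_Int_closure_eq_empty[of "V \<inter> O0" open_pairs] V(1) O0(1) by (simp add: open_Int)
    then obtain q where q: "q \<in> V" "q \<in> O0" "q \<in> open_pairs" by blast
    obtain c1 a1 where q1: "q = (c1, a1)" by (cases q)
    have "open (V \<inter> O0)" "q \<in> V \<inter> O0" using V(1) O0(1) q by auto
    from open_prod_elim[OF this]
    obtain C' A' where "open C'" "open A'" "q \<in> C' \<times> A'" "C' \<times> A' \<subseteq> V \<inter> O0" .
    then have box: "open C'" "open A'" "c1 \<in> C'" "a1 \<in> A'" "C' \<times> A' \<subseteq> V \<inter> O0"
      using q1 by auto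
    have CC: "C' \<subseteq> C"
    proof
      fix x assume "x \<in> C'"
      then have "(x, a1) \<in> C' \<times> A'" using box(4) by simp
      then show "x \<in> C" using box(5) by (auto simp: O0_def)
    qed
    have AA: "A' \<subseteq> A"
    proof
      fix y assume "y \<in> A'"
      then have "(c1, y) \<in> C' \<times> A'" using box(3) by simp
      then show "y \<in> A" using box(5) by (auto simp: O0_def)
    qed
    have "(c1, a1) \<in> open_pairs" using q(3) q1 by simp
    then have ne: "\<exists>c'\<in>C'. \<exists>a'\<in>A'. (c', a') \<in> open_pairs" using box(3,4) by (intro bexI)
    have "\<not> (\<forall>x\<in>C'. \<forall>y\<in>A'. (x, y) \<in> open_pairs \<longrightarrow> syndetically_close T d m x y)"
    proof
      assume all: "\<forall>x\<in>C'. \<forall>y\<in>A'. (x, y) \<in> open_pairs \<longrightarrow> syndetically_close T d m x y"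
      have "\<exists>C' A' m. open C' \<and> open A' \<and> C' \<subseteq> C \<and> A' \<subseteq> A \<and>
    (\<exists>c'\<in>C'. \<exists>a'\<in>A'. (c', a') \<in> open_pairs) \<and>
    (\<forall>x\<in>C'. \<forall>y\<in>A'. (x, y) \<in> open_pairs \<longrightarrow> syndetically_close T d m x y)"
        by (intro exI[of _ C'] exI[of _ A'] exI[of _ m] conjI box(1,2) CC AA ne all)
      with no show False by (rule notE)
    qed
    then obtain x y where xy: "(x, y) \<in> open_pairs" "x \<in> C'" "y \<in> A'" "\<not> syndetically_close T d m x y"
      by auto
    have VO: "(x, y) \<in> V \<inter> O0" using xy(2,3) by (intro subsetD[OF box(5)]) simp
    have "(x, y) \<in> O0 \<inter> pairs" using VO subsetD[OF closure_subset xy(1)] by simp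
    then have "(x, y) \<in> Q" unfolding Q_def by (rule subsetD[OF closure_subset])
    moreover have "(x, y) \<in> - K m" using xy(4) by (simp add: K_def)
    ultimately have "(x, y) \<in> V \<inter> Q \<inter> - K m" using VO by simp
    then show "V \<inter> Q \<inter> - K m \<noteq> {}" by (metis empty_iff)
  qed
  then have "comeager_in Q (\<Inter>m. - K m)" by (rule comeager_in_INT)
  moreover have "O0 \<inter> Q \<noteq> {}"
  proof -
    have "(c0, a0) \<in> pairs" using 0(3) by (intro subsetD[OF closure_subset]) simp
    then have "(c0, a0) \<in> O0 \<inter> pairs" using O0(2) by simp
    then have "(c0, a0) \<in> Q" unfolding Q_def by (rule subsetD[OF closure_subset])
    then show ?thesis using O0(2) by (metis IntI empty_iff)
  qed
  ultimately obtain q where q: "q \<in> O0" "q \<in> Q" "q \<in> (\<Inter>m. - K m)"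
    using comeager_in_dense[OF \<open>compact Q\<close> _ O0(1)] by metis
  obtain x y where xy: "q = (x, y)" by (cases q)
  have X': "x \<in> X" "y \<in> X" using q(2) QN pXX xy by auto
  then have "(x, y) \<in> close_pairs e" using q(1) 1(5) by (auto simp: O0_def xy)
  then obtain m where "syndetically_close T d m x y" using e by (auto simp: modulus_def)
  then have "q \<in> K m" using X' by (simp add: K_def xy)
  then show False using q(3) by blast
qed

text \<open>A box near (c, a) has a uniform gap m and contains an open pair (c2, a2). Lower
  semicontinuity at a provides b2 near b with (a2, b2) regionally proximal, hence open pairs (a',
  b') near it that are close at a scale chosen after m. Openness over a2 lets c2 follow to c' in the
  fibre of a', still inside the box, so the gap m applies to (c', a') and the triangle inequality to
  (c', b').\<close>

lemma near_trans:
  assumes d: "d > 0" and e: "modulus d e" and a: "lsc_at X (closure ap_pairs) a"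
    and ca: "(c, a) \<in> near e" and ab: "(a, b) \<in> closure ap_pairs"
  shows "(c, b) \<in> near (2 * d)"
  unfolding near_def
proof (rule closure_boxI)
  fix C B assume CB: "open C" "open B" "c \<in> C" "b \<in> B"
  obtain A where A: "open A" "a \<in> A" "\<And>a'. a' \<in> A \<inter> X \<Longrightarrow> \<exists>b'\<in>B. (a', b') \<in> closure ap_pairs"
    using a ab CB(2,4) unfolding lsc_at_def by meson
  obtain C' A' m c2 a2 where box: "open C'" "open A'" "C' \<subseteq> C" "A' \<subseteq> A"
    "(c2, a2) \<in> open_pairs" "c2 \<in> C'" "a2 \<in> A'"
    "\<And>x y. (x, y) \<in> open_pairs \<Longrightarrow> x \<in> C' \<Longrightarrow> y \<in> A' \<Longrightarrow> syndetically_close T d m x y"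
    using uniform_gap_box[OF e ca CB(1,3) A(1,2)] by metis
  have c2: "c2 \<in> X" "a2 \<in> X" "p c2 = p a2" using box(5) open_pairs_subset by (auto simp: fibre_pairs_def)
  then obtain b2 where b2: "b2 \<in> B" "(a2, b2) \<in> rprox"
    using A(3)[of a2] box(4,7) closure_ap_pairs by blast
  obtain e' where e': "e' > 0" "\<forall>x\<in>X. \<forall>y z. syndetically_close T d m x y \<longrightarrow>
        (y, z) \<in> close_pairs e' \<longrightarrow> (x, z) \<in> close_pairs (2 * d)"
    using close_pairs_triangle[OF d] by blast
  have "a2 \<in> open_points" using box(5) open_pairs_sym by (auto simp: open_pairs_def)
  from open_points_nbhd[OF this c2(1,3) box(1,6)]
  obtain W where W: "open W" "a2 \<in> W" "\<forall>a'\<in>W \<inter> X. \<exists>c'\<in>C'. c' \<in> X \<and> p c' = p a'" by auto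
  have "open (A' \<inter> W)" "a2 \<in> A' \<inter> W" using box W by auto
  then obtain a' b' where ab': "a' \<in> A' \<inter> W" "b' \<in> B" "(a', b') \<in> close_pairs e' \<inter> open_pairs"
    using closure_boxE[OF rprox_near[OF b2(2) e'(1), unfolded near_def] _ CB(2) _ b2(1)] by metis
  then have a'X: "a' \<in> X" "a' \<in> open_points" "b' \<in> X" "p a' = p b'" by (auto simp: open_pairs_def open_points_def)
  then obtain c' where c': "c' \<in> C'" "c' \<in> X" "p c' = p a'" using W(3) ab'(1) by blast
  then have "(a', c') \<in> open_pairs" using a'X by (simp add: open_pairs_def)
  then have ca': "(c', a') \<in> open_pairs" using open_pairs_sym by blast
  then have "syndetically_close T d m c' a'" using box(8) c' ab' by blast
  then have "(c', b') \<in> close_pairs (2 * d)" using e'(2) c'(2) ab'(3) by blast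
  moreover have "(c', b') \<in> open_pairs"
    using ca' a'X c' by (simp add: open_pairs_def)
  ultimately show "\<exists>x'\<in>C. \<exists>y'\<in>B. (x', y') \<in> close_pairs (2 * d) \<inter> open_pairs"
    using c'(1) box(3) ab'(2) by blast
qed

text \<open>Forward invariance of far pairs is the complement of \<open>near_pull_back\<close>;
  closing up then allows passage to orbit closures and shadows.\<close>

lemma far_invariant: "TT ` closure (pairs - near d) \<subseteq> closure (pairs - near d)"
proof (rule closure_invariant)
  have sub: "pairs \<subseteq> X \<times> X" using closure_open_pairs_subset open_pairs_subset by blast
  then show "pairs - near d \<subseteq> X \<times> X" by blast
  show "TT ` (pairs - near d) \<subseteq> closure (pairs - near d)"
  proof (rule image_subsetI)
    fix q assume q: "q \<in> pairs - near d"
    obtain x y where xy: "q = (x, y)" by (cases q)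
    have "x \<in> X" "y \<in> X" using q sub xy by auto
    then have "TT q \<notin> near d" using near_pull_back q xy by auto
    moreover have "TT q \<in> pairs" using pairs_invariant q by (meson DiffD1 image_subset_iff)
    ultimately show "TT q \<in> closure (pairs - near d)"
      using subsetD[OF closure_subset[of "pairs - near d"]] by simp
  qed
qed

lemma triple_orbit:
  assumes "c \<in> X" "a \<in> X" "b \<in> X" "(c1, a1, b1) \<in> closure (orbit (map_triple T) (c, a, b))"
  shows "(c1, a1) \<in> closure (orbit TT (c, a))" "(a1, b1) \<in> closure (orbit TT (a, b))"
    "(c1, b1) \<in> closure (orbit TT (c, b))"
proof -
  have *: "\<phi> (c1, a1, b1) \<in> closure (orbit TT (\<phi> (c, a, b)))"
    if "continuous_on (X \<times> X \<times> X) \<phi>" "\<And>v. \<phi> (map_triple T v) = TT (\<phi> v)" for \<phi>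
    using image_closure_orbit_subset[where W = "X \<times> X \<times> X" and F = "map_triple T" and S = TT
        and w = "(c, a, b)" and \<phi> = \<phi>, OF XXX(2,3)] that assms
      imageI[OF assms(4), of \<phi>] by (meson SigmaI subsetD)
  show "(c1, a1) \<in> closure (orbit TT (c, a))"
    using *[of "\<lambda>q. (fst q, fst (snd q))"] by (simp add: continuous_on_Pair continuous_on_fst continuous_on_snd continuous_on_id)
  show "(a1, b1) \<in> closure (orbit TT (a, b))"
    using *[of "\<lambda>q. snd q"] by (simp add: continuous_on_snd continuous_on_id)
  show "(c1, b1) \<in> closure (orbit TT (c, b))"
    using *[of "\<lambda>q. (fst q, snd (snd q))"] by (simp add: continuous_on_Pair continuous_on_fst continuous_on_snd continuous_on_id)
qed

text \<open>If \<open>(c, b)\<close> were a limit of far pairs, one could move the triple \<open>(c, a, b)\<close> to a nearby one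
  with generic \<open>a\<close> and \<open>b\<close> for which \<open>(c, b)\<close> itself is far, since the far pairs form an open
  set that is invariant because \<open>T\<close> is a homeomorphism; this contradicts \<open>near_trans\<close>.\<close>

lemma not_far:
  assumes d: "d > 0" and e: "modulus d e"
    and X': "c \<in> X" "a \<in> X" "b \<in> X" and ap: "almost_periodic (map_triple T) (c, a, b)"
    and ca: "(c, a) \<in> close_pairs e" and ab: "(a, b) \<in> ap_pairs"
  shows "(c, b) \<notin> closure (pairs - near (2 * d))"
proof
  let ?far = "pairs - near (2 * d)" and ?\<Omega> = "closure (orbit (map_triple T) (c, a, b))"
  assume cb: "(c, b) \<in> closure ?far"
  have w: "(c, a, b) \<in> X \<times> X \<times> X" using X' by simp
  have "compact ?\<Omega>"
    using compact_Int_closed[OF XXX(1), of ?\<Omega>] closure_orbit_subset[OF XXX(2,3) w]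
    by (simp add: inf.absorb2)
  moreover have "UNIV \<inter> ?\<Omega> \<noteq> {}"
    using self_in_closure_orbit[of "(c, a, b)" "map_triple T"] by (metis Int_UNIV_left empty_iff)
  ultimately obtain t where "t \<in> ?\<Omega>" "t \<in> {q. snd (snd q) \<in> generic_points}"
    using comeager_in_dense[OF _ comeager_orbit_triple(2)[OF X' ap comeager_generic] open_UNIV] by metis
  then obtain c1 a1 b1 where t: "(c1, a1, b1) \<in> ?\<Omega>" and b1: "b1 \<in> generic_points"
    by (cases t) auto
  have returns: "(c, a, b) \<in> closure (orbit (map_triple T) (c1, a1, b1))"
    using ap t by (simp add: almost_periodic_def)
  have X1: "c1 \<in> X" "a1 \<in> X" "b1 \<in> X"
    using closure_orbit_subset[OF XXX(2,3) w] t by auto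
  have cb1: "(c1, b1) \<in> closure ?far"
    using closure_orbit_pair_subset[OF closed_closure far_invariant cb] triple_orbit(3)[OF X' t] by blast
  have "(a1, b1) \<in> ap_pairs" using ap_pairs_orbit[OF ab triple_orbit(2)[OF X' t]] .
  then have ba1: "(b1, a1) \<in> closure ap_pairs"
    by (rule subsetD[OF closure_subset ap_pairs_sym])
  \<comment> \<open>The orbit of (c1, a1) returns to a box of e-close pairs around (c, a), and
    closeness at a later time is closeness of the pair itself.\<close>
  have ca1: "(c1, a1) \<in> close_pairs e"
  proof -
    obtain C A where CA: "open C" "open A" "c \<in> C" "a \<in> A"
      "\<And>x' y'. x' \<in> C \<Longrightarrow> y' \<in> A \<Longrightarrow> x' \<in> X \<Longrightarrow> y' \<in> X \<Longrightarrow> (x', y') \<in> close_pairs e"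
      using close_pairs_nbhd[OF ca] by metis
    have "(c, a) \<in> closure (orbit TT (c1, a1))" using triple_orbit(1)[OF X1 returns] .
    moreover have "open (C \<times> A)" "(c, a) \<in> C \<times> A" using CA by (auto intro: open_Times)
    ultimately obtain n where "(TT ^^ n) (c1, a1) \<in> C \<times> A" unfolding in_closure_orbit_iff by meson
    then have "((T ^^ n) c1, (T ^^ n) a1) \<in> close_pairs e"
      using CA(5) X1 funpow_T_in by simp
    then show ?thesis using close_pairs_funpow X1 by blast
  qed
  obtain C1 A1 where CA: "open C1" "open A1" "c1 \<in> C1" "a1 \<in> A1"
      "\<And>x' y'. x' \<in> C1 \<Longrightarrow> y' \<in> A1 \<Longrightarrow> x' \<in> X \<Longrightarrow> y' \<in> X \<Longrightarrow> (x', y') \<in> close_pairs e"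
    using close_pairs_nbhd[OF ca1] by metis
  have "lsc_at X (closure ap_pairs) b1" using b1 by (simp add: generic_points_def)
  then obtain W where W: "open W" "b1 \<in> W" "\<And>b'. b' \<in> W \<inter> X \<Longrightarrow> \<exists>a'\<in>A1. (b', a') \<in> closure ap_pairs"
    using ba1 CA(2,4) unfolding lsc_at_def by meson
  \<comment> \<open>Limits are replaced by actual pairs: first a far pair near (c1, b1), then a box
    around it missing \<open>near (2 * d)\<close>, and in that box an open pair (c3, b3).\<close>
  obtain c2 b2 where 2: "c2 \<in> C1" "b2 \<in> W" "(c2, b2) \<in> ?far"
    using closure_boxE[OF cb1 CA(1) W(1) CA(3) W(2)] by metis
  have "open (- near (2 * d))" "(c2, b2) \<in> - near (2 * d)" using closed_near 2 by auto
  from open_prod_elim[OF this]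
  obtain C2 B2 where "open C2" "open B2" "(c2, b2) \<in> C2 \<times> B2" "C2 \<times> B2 \<subseteq> - near (2 * d)" .
  then have box2: "open C2" "open B2" "c2 \<in> C2" "b2 \<in> B2" "C2 \<times> B2 \<subseteq> - near (2 * d)" by auto
  have "open (C1 \<inter> C2)" "open (W \<inter> B2)" "c2 \<in> C1 \<inter> C2" "b2 \<in> W \<inter> B2"
    using CA(1) W(1) box2 2 by auto
  moreover have "(c2, b2) \<in> pairs" using 2 by blast
  ultimately obtain c3 b3 where 3: "c3 \<in> C1 \<inter> C2" "b3 \<in> W \<inter> B2" "(c3, b3) \<in> open_pairs"
    using closure_boxE[of c2 b2 open_pairs "C1 \<inter> C2" "W \<inter> B2"] by metis
  have X3: "c3 \<in> X" "b3 \<in> X" "p c3 = p b3" "b3 \<in> open_points"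
    using 3(3) open_points_fibre by (auto simp: open_pairs_def open_points_def)
  obtain a3 where a3: "a3 \<in> A1" "(b3, a3) \<in> closure ap_pairs" using W(3) 3(2) X3(2) by blast
  \<comment> \<open>Passing to an actual almost periodic pair (b4, a4) moves b once more; openness
    over b3 guarantees that c can follow without leaving the box.\<close>
  have "open (C1 \<inter> C2)" using CA(1) box2(1) by blast
  from open_points_nbhd[OF X3(4,1,3) this 3(1)]
  obtain W2 where W2: "open W2" "b3 \<in> W2"
    "\<forall>b'\<in>W2 \<inter> X. \<exists>c'\<in>C1 \<inter> C2. c' \<in> X \<and> p c' = p b'" by auto
  have op2: "open (B2 \<inter> W2)" "b3 \<in> B2 \<inter> W2" using box2 W2 3 by auto
  then obtain b4 a4 where 4: "b4 \<in> B2 \<inter> W2" "a4 \<in> A1" "(b4, a4) \<in> ap_pairs"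
    using closure_boxE[OF a3(2) _ CA(2) _ a3(1)] by metis
  have X4: "b4 \<in> X" "a4 \<in> X" "almost_periodic TT (b4, a4)"
    using 4(3) rprox_subset(3) by (auto simp: ap_pairs_def)
  \<comment> \<open>In this minimal orbit closure the second coordinate can be made generic while
    the pair stays in the open box \<open>(B2 \<inter> W2) \<times> A1\<close>.\<close>
  let ?\<Omega>4 = "closure (orbit TT (b4, a4))"
  have "compact ?\<Omega>4"
    using compact_Int_closed[OF XX(1), of ?\<Omega>4] closure_orbit_subset[OF XX(2,3), of "(b4, a4)"] X4
    by (simp add: inf.absorb2)
  moreover have "open ((B2 \<inter> W2) \<times> A1)" using op2 CA by (auto intro: open_Times)
  moreover have "(b4, a4) \<in> ((B2 \<inter> W2) \<times> A1) \<inter> ?\<Omega>4"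
    using 4 self_in_closure_orbit[of "(b4, a4)" TT] by auto
  then have "((B2 \<inter> W2) \<times> A1) \<inter> ?\<Omega>4 \<noteq> {}" by (metis empty_iff)
  ultimately obtain t5 where t5: "t5 \<in> (B2 \<inter> W2) \<times> A1" "t5 \<in> ?\<Omega>4" "t5 \<in> {q. snd q \<in> generic_points}"
    using comeager_in_dense[OF _ comeager_orbit_pair(2)[OF X4 comeager_generic]] by metis
  obtain b5 a5 where ba5: "t5 = (b5, a5)" by (cases t5)
  have 5: "b5 \<in> B2" "b5 \<in> W2" "a5 \<in> A1" "(b5, a5) \<in> ap_pairs" "a5 \<in> generic_points"
    using t5 ap_pairs_orbit[OF 4(3)] by (auto simp: ba5)
  have X5: "b5 \<in> X" "a5 \<in> X" "p b5 = p a5"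
    using 5(4) rprox_subset(2) by (auto simp: ap_pairs_def fibre_pairs_def)
  obtain c5 where c5: "c5 \<in> C1" "c5 \<in> C2" "c5 \<in> X" "p c5 = p b5" using W2(3) 5(2) X5(1) by blast
  have "a5 \<in> open_points" "lsc_at X (closure ap_pairs) a5" using 5(5) by (auto simp: generic_points_def)
  \<comment> \<open>Being over a point of openness and in the e-close box
    \<open>C1 \<times> A1\<close>, the pair (c5, a5) is in \<open>near e\<close>. With the generic
    middle point a5, \<open>near_trans\<close> puts (c5, b5) into \<open>near (2 * d)\<close>,
    although it lies in the far box.\<close>
  then have "(a5, c5) \<in> open_pairs" using c5 X5 by (simp add: open_pairs_def)
  then have "(c5, a5) \<in> open_pairs" using open_pairs_sym by blast
  moreover have "(c5, a5) \<in> close_pairs e" using CA(5) c5 5(3) X5(2) by blast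
  ultimately have "(c5, a5) \<in> near e" unfolding near_def by (intro subsetD[OF closure_subset]) blast
  moreover have "(a5, b5) \<in> closure ap_pairs"
    by (rule subsetD[OF closure_subset ap_pairs_sym[OF 5(4)]])
  ultimately have "(c5, b5) \<in> near (2 * d)"
    using near_trans[OF d e \<open>lsc_at X (closure ap_pairs) a5\<close>] by blast
  then show False using box2(5) c5(2) 5(1) by blast
qed

section \<open>The shadow relation is a closed invariant equivalence relation\<close>

lemma u_fibre: "x \<in> X \<Longrightarrow> y \<in> X \<Longrightarrow> p x = p y \<Longrightarrow> p (u x) = p (u y)"
  using closure_orbit_pair_subset[OF closed_fibre_pairs, of x y] u_orbit[of x y]
  by (auto simp: fibre_pairs_def)

lemma far_shadow:
  assumes "x \<in> X" "y \<in> X" "(x, y) \<in> pairs - near d"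
  shows "(u x, u y) \<in> closure (pairs - near d)"
  using closure_orbit_pair_subset[OF closed_closure far_invariant subsetD[OF closure_subset assms(3)]]
    u_orbit[OF assms(1,2)] by blast

definition shadow_rprox :: "('a \<times> 'a) set" where
  "shadow_rprox = {(x, y) \<in> fibre_pairs. (u x, u y) \<in> rprox}"

lemma shadow_ap:
  assumes "x \<in> X" "y \<in> X" "(u x, u y) \<in> rprox"
  shows "(u x, u y) \<in> ap_pairs"
  using u_pair[OF assms(1,2)] assms(3) by (simp add: ap_pairs_def)

lemma shadow_rprox_invariant: "TT ` shadow_rprox \<subseteq> shadow_rprox"
proof (rule image_subsetI)
  fix q assume q: "q \<in> shadow_rprox"
  obtain x y where xy: "q = (x, y)" by (cases q)
  have 1: "(x, y) \<in> fibre_pairs" "(u x, u y) \<in> rprox" using q by (auto simp: shadow_rprox_def xy)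
  then have X': "x \<in> X" "y \<in> X" by (auto simp: fibre_pairs_def)
  have "TT (x, y) \<in> fibre_pairs" using closed_fibre_pairs(2) 1(1) by (meson image_subset_iff)
  moreover have "TT (u x, u y) \<in> rprox" using rprox_invariant 1(2) by (meson image_subset_iff)
  ultimately show "TT q \<in> shadow_rprox" using u(2) X' by (simp add: shadow_rprox_def xy)
qed

lemma compact_orbit_pair:
  assumes "x \<in> X" "y \<in> X"
  shows "compact (closure (orbit TT (x, y)))" "closure (orbit TT (x, y)) \<subseteq> X \<times> X"
proof -
  show sub: "closure (orbit TT (x, y)) \<subseteq> X \<times> X"
    using closure_orbit_subset[OF XX(2,3), of "(x, y)"] assms by simp
  show "compact (closure (orbit TT (x, y)))"
    using compact_Int_closed[OF XX(1) closed_closure[of "orbit TT (x, y)"]] sub by (simp add: inf.absorb2)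
qed

text \<open>The almost periodic triple is moved within its orbit closure until the middle coordinate
  is generic, where \<open>near_trans\<close> holds at every scale. Almost periodicity brings the
  conclusion back to the original triple.\<close>

lemma rprox_trans_u:
  assumes X': "x \<in> X" "y \<in> X" "z \<in> X" and "(u x, u y) \<in> rprox" "(u y, u z) \<in> rprox"
  shows "(u x, u z) \<in> rprox"
proof -
  let ?w = "(u x, u y, u z)"
  let ?\<Omega> = "closure (orbit (map_triple T) ?w)"
  have uX: "u x \<in> X" "u y \<in> X" "u z \<in> X" using X' u by auto
  have w: "?w \<in> X \<times> X \<times> X" using uX by simp
  have ap: "almost_periodic (map_triple T) ?w" by (rule u_triple[OF X'])
  have "compact ?\<Omega>"
    using compact_Int_closed[OF XXX(1), of ?\<Omega>] closure_orbit_subset[OF XXX(2,3) w]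
    by (simp add: inf.absorb2)
  moreover have "UNIV \<inter> ?\<Omega> \<noteq> {}"
    using self_in_closure_orbit[of ?w "map_triple T"] by (metis Int_UNIV_left empty_iff)
  ultimately obtain t where "t \<in> ?\<Omega>" "t \<in> {q. fst (snd q) \<in> generic_points}"
    using comeager_in_dense[OF _ comeager_orbit_triple(1)[OF uX ap comeager_generic] open_UNIV] by metis
  then obtain c a b where t: "(c, a, b) \<in> ?\<Omega>" and a: "a \<in> generic_points" by (cases t) auto
  note orb = triple_orbit[OF uX t]
  have cX: "c \<in> X" "a \<in> X" "b \<in> X" using closure_orbit_subset[OF XXX(2,3) w] t by auto
  have "(u x, u y) \<in> ap_pairs" "(u y, u z) \<in> ap_pairs" using shadow_ap assms by auto
  then have ca: "(c, a) \<in> ap_pairs" and ab: "(a, b) \<in> ap_pairs" using ap_pairs_orbit orb by auto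
  have "(c, b) \<in> rprox"
  proof (rule rproxI)
    fix d :: real assume "d > 0"
    then have d: "d / 2 > 0" by simp
    obtain e where e: "modulus (d / 2) e" using modulus_exists[OF d] .
    have "(c, a) \<in> rprox" using ca by (simp add: ap_pairs_def)
    then have "(c, a) \<in> near e" using rprox_near e by (auto simp: modulus_def)
    moreover have "lsc_at X (closure ap_pairs) a" using a by (simp add: generic_points_def)
    ultimately have "(c, b) \<in> near (2 * (d / 2))"
      using near_trans[OF d e] subsetD[OF closure_subset ab] by blast
    then show "(c, b) \<in> near d" by simp
  qed
  then have "closure (orbit TT (c, b)) \<subseteq> rprox"
    by (rule closure_orbit_pair_subset[OF closed_rprox rprox_invariant])
  moreover have "?w \<in> closure (orbit (map_triple T) (c, a, b))"
    using ap t by (simp add: almost_periodic_def)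
  then have "(u x, u z) \<in> closure (orbit TT (c, b))" using triple_orbit(3)[OF cX] by blast
  ultimately show ?thesis by blast
qed

lemma equiv_shadow_rprox: "equiv X shadow_rprox"
proof (rule equivI)
  show "shadow_rprox \<subseteq> X \<times> X" by (auto simp: shadow_rprox_def fibre_pairs_def)
  show "refl_on X shadow_rprox"
    using diagonal_rprox u by (auto simp: refl_on_def shadow_rprox_def fibre_pairs_def)
  show "sym shadow_rprox"
    using rprox_sym by (auto simp: sym_def shadow_rprox_def fibre_pairs_def)
  show "trans shadow_rprox"
    using rprox_trans_u by (auto simp: trans_def shadow_rprox_def fibre_pairs_def)
qed

text \<open>Closedness: if a limit \<open>(s, s')\<close> of shadow pairs \<open>(y, y')\<close> were not regionally proximal,
  replace \<open>y\<close> by a third point \<open>y''\<close> near \<open>y\<close> for which \<open>(y'', y')\<close> is far from regional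
  proximality; then \<open>u y''\<close> and \<open>u y\<close> are close by insensitivity, which contradicts \<open>not_far\<close>.\<close>

lemma closed_shadow_rprox: "closed shadow_rprox"
proof -
  have "closure shadow_rprox \<subseteq> shadow_rprox"
  proof
    fix q assume q: "q \<in> closure shadow_rprox"
    obtain x x' where xx: "q = (x, x')" by (cases q)
    have "closure shadow_rprox \<subseteq> fibre_pairs"
      by (rule closure_minimal[OF _ closed_fibre_pairs(1)]) (auto simp: shadow_rprox_def)
    then have fib: "(x, x') \<in> fibre_pairs" using q xx by blast
    then have X': "x \<in> X" "x' \<in> X" "p x = p x'" by (auto simp: fibre_pairs_def)
    have "(u x, u x') \<in> rprox"
    proof (rule ccontr)
      assume no: "(u x, u x') \<notin> rprox"
      have uX: "u x \<in> X" "u x' \<in> X" using u X' by auto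
      have ap: "almost_periodic TT (u x, u x')" by (rule u_pair[OF X'(1,2)])
      let ?\<Omega> = "closure (orbit TT (u x, u x'))"
      have inv: "TT ` closure shadow_rprox \<subseteq> closure shadow_rprox"
        by (rule closure_invariant[OF _ subset_trans[OF shadow_rprox_invariant closure_subset]])
          (auto simp: shadow_rprox_def fibre_pairs_def)
      \<comment> \<open>All of the orbit closure of the shadow consists of limits of
        \<open>shadow_rprox\<close>, so the shadow may be replaced by a pair (s, s') with both
        coordinates generic.\<close>
      have "(u x, u x') \<in> closure shadow_rprox"
        using closure_orbit_pair_subset[OF closed_closure inv] q u_orbit[OF X'(1,2)] xx by blast
      then have sub: "?\<Omega> \<subseteq> closure shadow_rprox" by (rule closure_orbit_pair_subset[OF closed_closure inv])
      have "UNIV \<inter> ?\<Omega> \<noteq> {}"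
        using self_in_closure_orbit[of "(u x, u x')" TT] by (metis Int_UNIV_left empty_iff)
      then obtain t where t: "t \<in> ?\<Omega>" "t \<in> {q. fst q \<in> generic_points} \<inter> {q. snd q \<in> generic_points}"
        using comeager_in_dense[OF compact_orbit_pair(1)[OF uX] comeager_in_Int[OF
            comeager_orbit_pair[OF uX ap comeager_generic]] open_UNIV] by metis
      obtain s s' where ss: "t = (s, s')" by (cases t)
      have s: "(s, s') \<in> ?\<Omega>" "s \<in> generic_points" "s' \<in> generic_points" using t ss by auto
      have "(u x, u x') \<in> fibre_pairs" using u_fibre[OF X'] uX by (simp add: fibre_pairs_def)
      from closure_orbit_pair_subset[OF closed_fibre_pairs this]
      have "(s, s') \<in> fibre_pairs" using s(1) by blast
      then have "(s, s') \<in> open_pairs"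
        using s(2) by (auto simp: fibre_pairs_def open_pairs_def generic_points_def)
      then have "(s', s) \<in> open_pairs" using open_pairs_sym by blast
      then have "(s', s) \<in> pairs" by (rule subsetD[OF closure_subset])
      \<comment> \<open>Otherwise the return from (s, s') to (u x, u x') would make the latter
        regionally proximal too.\<close>
      have "(s, s') \<notin> rprox"
      proof
        assume "(s, s') \<in> rprox"
        then have "closure (orbit TT (s, s')) \<subseteq> rprox"
          by (rule closure_orbit_pair_subset[OF closed_rprox rprox_invariant])
        moreover have "(u x, u x') \<in> closure (orbit TT (s, s'))"
          using ap s(1) by (simp add: almost_periodic_def)
        ultimately show False using no by blast
      qed
      then obtain d' where d': "d' > 0" "(s, s') \<notin> near d'" using rproxI by blast
      define d where "d = d' / 2"
      have d: "d > 0" "(s, s') \<in> - near (2 * d)" using d' by (auto simp: d_def)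
      have "open (- near (2 * d))" using closed_near by blast
      from open_prod_elim[OF this d(2)]
      obtain V V' where "open V" "open V'" "(s, s') \<in> V \<times> V'" "V \<times> V' \<subseteq> - near (2 * d)" .
      then have V: "open V" "open V'" "s \<in> V" "s' \<in> V'" "V \<times> V' \<subseteq> - near (2 * d)" by auto
      obtain e where e: "modulus d e" using modulus_exists[OF d(1)] .
      then have "e / 2 > 0" by (simp add: modulus_def)
      from nonsensitive[OF this] obtain e' where e': "e' > 0"
        "\<forall>x\<in>X. \<forall>y\<in>X. dist x y < e' \<longrightarrow> (\<exists>m. syndetically_close T (e / 2) m x y)" by blast
      \<comment> \<open>Radius e'/2 puts any two points of V1 at distance less than e'.\<close>
      define V1 where "V1 = V \<inter> ball s (e' / 2)"
      have V1: "open V1" "s \<in> V1" using V e' by (auto simp: V1_def)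
      have "lsc_at X pairs s'" using s(3) by (simp add: generic_points_def)
      \<comment> \<open>The pair (y, y') found below is only known to be a fibre pair, whereas being
        far refers to \<open>pairs\<close>. Lower semicontinuity at s' supplies a second partner y''
        in V1 that is paired with y' inside \<open>pairs\<close>.\<close>
      then obtain W where W: "open W" "s' \<in> W" "\<forall>y'\<in>W \<inter> X. \<exists>y''\<in>V1. (y', y'') \<in> pairs"
        using V1 \<open>(s', s) \<in> pairs\<close> unfolding lsc_at_def by meson
      have "open (V' \<inter> W)" "s' \<in> V' \<inter> W" using V W by auto
      moreover have "(s, s') \<in> closure shadow_rprox" using sub s(1) by blast
      ultimately obtain y y' where y: "y \<in> V1" "y' \<in> V' \<inter> W" "(y, y') \<in> shadow_rprox"
        using closure_boxE[of s s' shadow_rprox V1 "V' \<inter> W"] V1 by metis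
      have yX: "y \<in> X" "y' \<in> X" "p y = p y'" "(u y, u y') \<in> rprox"
        using y(3) by (auto simp: shadow_rprox_def fibre_pairs_def)
      obtain y'' where y'': "y'' \<in> V1" "(y', y'') \<in> pairs" using W(3) y(2) yX(2) by blast
      have "(y', y'') \<in> fibre_pairs" using y''(2) closure_open_pairs_subset by blast
      then have y''X: "y'' \<in> X" "p y'' = p y'" by (auto simp: fibre_pairs_def)
      have "dist y'' y < e'"
        using y(1) y''(1) dist_triangle_half_r[of s y'' e' y] by (simp add: V1_def dist_commute)
      then obtain m where m: "syndetically_close T (e / 2) m y'' y" using e'(2) y''X(1) yX(1) by blast
      let ?K = "{q \<in> X \<times> X. syndetically_close T (e / 2) m (fst q) (snd q)}"
      \<comment> \<open>With m fixed, closeness passes to the shadows; the bound e/2 leaves room for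
        the strict inequality with e.\<close>
      have "closure (orbit TT (y'', y)) \<subseteq> ?K"
        by (rule closure_orbit_subset[OF closed_syndetically_close])
          (use m yX y''X syndetically_close_step T_in in auto)
      then have "syndetically_close T (e / 2) m (u y'') (u y)" using u_orbit[OF y''X(1) yX(1)] by auto
      then have close: "(u y'', u y) \<in> close_pairs e"
        by (rule syndetically_close_imp_close) (use \<open>e / 2 > 0\<close> yX y''X u in auto)
      have "(y'', y') \<in> V \<times> V'" using y(2) y''(1) by (simp add: V1_def)
      then have "(y'', y') \<notin> near (2 * d)" using V(5) by blast
      then have "(y'', y') \<in> pairs - near (2 * d)" using pairs_sym[OF y''(2)] by simp
      then have "(u y'', u y') \<in> closure (pairs - near (2 * d))" by (rule far_shadow[OF y''X(1) yX(2)])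
      \<comment> \<open>\<open>not_far\<close> is used with c = u y'', a = u y and b = u y'.\<close>
      moreover have "(u y'', u y') \<notin> closure (pairs - near (2 * d))"
        by (rule not_far[OF d(1) e _ _ _ u_triple close shadow_ap]) (use yX y''X u in auto)
      ultimately show False by simp
    qed
    then show "q \<in> shadow_rprox" using fib xx by (simp add: shadow_rprox_def)
  qed
  then show ?thesis by (metis closure_closed closure_subset closed_closure subset_antisym)
qed

section \<open>From regional proximality of fibres to proximality\<close>

lemma fibre_rprox:
  assumes "x \<in> X" "y \<in> X" "p x = p y"
  shows "(u x, u y) \<in> rprox"
proof -
  have "(x, y) \<in> shadow_rprox"
  proof (rule fibre_minimal[OF closed_shadow_rprox equiv_shadow_rprox _ _ assms])
    show "(T x, T y) \<in> shadow_rprox" if "(x, y) \<in> shadow_rprox" for x y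
      using shadow_rprox_invariant that by (metis image_subset_iff map_prod_simp)
    show "(x, y) \<in> shadow_rprox" if "x \<in> X" "y \<in> X" "proximal_pair T x y" for x y
      using that u_proximal[OF that] proximal_fibre[OF that] diagonal_rprox[OF u(1)]
      by (simp add: shadow_rprox_def fibre_pairs_def)
  qed
  then show ?thesis by (simp add: shadow_rprox_def)
qed

text \<open>Shadows of far pairs are limits of far pairs. For (x, z) in \<open>pairs\<close>,
  applying \<open>not_far\<close> to the degenerate triple (u x, u x, u z) excludes this, because (u
  x, u z) is regionally proximal.\<close>

lemma pairs_rprox: "pairs \<subseteq> rprox"
proof
  fix q assume q: "q \<in> pairs"
  obtain x z where xz: "q = (x, z)" by (cases q)
  have "(x, z) \<in> fibre_pairs" using q xz closure_open_pairs_subset by blast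
  then have X': "x \<in> X" "z \<in> X" "p x = p z" by (auto simp: fibre_pairs_def)
  show "q \<in> rprox"
  proof (rule rproxI, rule ccontr)
    fix d' :: real assume d': "d' > 0" "q \<notin> near d'"
    define d where "d = d' / 2"
    have d: "d > 0" "(x, z) \<notin> near (2 * d)" using d' xz by (auto simp: d_def)
    obtain e where e: "modulus d e" using modulus_exists[OF d(1)] .
    then have "(u x, u x) \<in> close_pairs e" using u X' by (auto simp: close_pairs_def modulus_def)
    moreover have "(u x, u z) \<in> ap_pairs" using shadow_ap fibre_rprox X' by blast
    ultimately have "(u x, u z) \<notin> closure (pairs - near (2 * d))"
      using not_far[OF d(1) e u(1)[OF X'(1)] u(1)[OF X'(1)] u(1)[OF X'(2)] u_triple] X' by blast
    then show False using far_shadow[OF X'(1,2), of "2 * d"] q xz d(2) by simp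
  qed
qed

definition proximal_dense_points :: "'a set" where
  "proximal_dense_points = {x. \<forall>z\<in>X. \<forall>V d. p z = p x \<longrightarrow> open V \<longrightarrow> z \<in> V \<longrightarrow> d > 0 \<longrightarrow>
     (\<exists>z'\<in>V \<inter> X. p z' = p x \<and> (x, z') \<in> close_pairs d)}"

text \<open>Regional proximality of (x, z) moves both points; here x has to stay fixed. Openness
  turns each approximating close pair (x1, z1) into a whole neighbourhood of x1 of points with a
  close partner near z. So x lies in the closure of the open set \<open>U i j\<close>, and a generic
  x, avoiding its boundary, lies in the set itself.\<close>

lemma comeager_proximal_dense_points: "comeager_in X proximal_dense_points"
proof -
  obtain B where B: "\<And>i::nat. open (B i)"
    "\<And>x V. x \<in> X \<Longrightarrow> open V \<Longrightarrow> x \<in> V \<Longrightarrow> \<exists>i. x \<in> B i \<and> closure (B i) \<subseteq> V"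
    using compact_countable_basis[OF X(1)] by metis
  define A where "A i j = {x \<in> X. \<exists>z\<in>B i \<inter> X. p z = p x \<and> (x, z) \<in> close_pairs (1 / Suc j)}" for i j
  define U where "U i j = \<Union>{W. open W \<and> W \<inter> X \<subseteq> A i j}" for i j
  have U: "open (U i j)" "U i j \<inter> X \<subseteq> A i j" for i j unfolding U_def by blast+
  have "comeager_in X (U i j \<union> - closure (U i j \<inter> X))" for i j
  proof (rule comeager_in_open)
    show "open (U i j \<union> - closure (U i j \<inter> X))" using U by blast
    fix V assume V: "open V" "V \<inter> X \<noteq> {}"
    show "V \<inter> X \<inter> (U i j \<union> - closure (U i j \<inter> X)) \<noteq> {}"
    proof (cases "V \<inter> (U i j \<inter> X) = {}")
      case True
      then have "V \<inter> closure (U i j \<inter> X) = {}" using V(1) open_Int_closure_eq_empty by metis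
      then show ?thesis using V(2) by blast
    qed blast
  qed
  then have "comeager_in X ((\<Inter>i. \<Inter>j. U i j \<union> - closure (U i j \<inter> X)) \<inter> open_points)"
    by (intro comeager_in_Int comeager_in_INT comeager_open_points)
  then show ?thesis unfolding proximal_dense_points_def
  proof (rule comeager_in_mono, intro subsetI CollectI ballI allI impI)
    fix x z V and d :: real
    assume x: "x \<in> X \<inter> ((\<Inter>i. \<Inter>j. U i j \<union> - closure (U i j \<inter> X)) \<inter> open_points)"
      and z: "z \<in> X" "p z = p x" "open V" "z \<in> V" and d: "d > 0"
    obtain i where i: "z \<in> B i" "closure (B i) \<subseteq> V" using B(2) z by blast
    obtain j where j: "1 / Suc j < d" using nat_approx_posE[OF d] by auto
    have "x \<in> closure (U i j \<inter> X)"
      unfolding closure_iff_nhds_not_empty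
    proof (intro allI impI)
      fix V0 V1 assume V1: "V1 \<subseteq> V0" "open V1" "x \<in> V1"
      have "(x, z) \<in> open_pairs" using x z by (simp add: open_pairs_def)
      then have "(x, z) \<in> rprox" using pairs_rprox closure_subset by blast
      then have "(x, z) \<in> closure (close_pairs (1 / Suc j) \<inter> open_pairs)"
        using rprox_near[of _ "1 / Suc j"] by (simp add: near_def)
      then obtain x1 z1 where 1: "x1 \<in> V1" "z1 \<in> B i" "(x1, z1) \<in> close_pairs (1 / Suc j) \<inter> open_pairs"
        using closure_boxE[OF _ V1(2) B(1) V1(3) i(1)] by metis
      then obtain C D where CD: "open C" "open D" "x1 \<in> C" "z1 \<in> D"
        "\<And>x' y'. x' \<in> C \<Longrightarrow> y' \<in> D \<Longrightarrow> x' \<in> X \<Longrightarrow> y' \<in> X \<Longrightarrow> (x', y') \<in> close_pairs (1 / Suc j)"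
        using close_pairs_nbhd[of x1 z1 "1 / Suc j"] by (metis IntD1)
      have x1: "x1 \<in> open_points" "x1 \<in> X" "z1 \<in> X" "p z1 = p x1"
        using 1(3) by (auto simp: open_pairs_def open_points_def)
      have "open (B i \<inter> D)" "z1 \<in> B i \<inter> D" using B(1) CD 1(2) by auto
      from open_points_nbhd[OF x1(1,3,4) this]
      obtain W where W: "open W" "x1 \<in> W" "\<forall>a'\<in>W \<inter> X. \<exists>c'\<in>B i \<inter> D. c' \<in> X \<and> p c' = p a'" by auto
      have "(W \<inter> C) \<inter> X \<subseteq> A i j"
      proof
        fix a assume a: "a \<in> (W \<inter> C) \<inter> X"
        then obtain c where c: "c \<in> B i \<inter> D" "c \<in> X" "p c = p a" using W(3) by blast
        then have "(a, c) \<in> close_pairs (1 / Suc j)" using CD(5) a by blast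
        then show "a \<in> A i j" using a c by (auto simp: A_def)
      qed
      then have "x1 \<in> U i j" unfolding U_def using W CD(1,3) by (intro UnionI[of "W \<inter> C"]) auto
      then show "U i j \<inter> X \<inter> V0 \<noteq> {}" using 1(1) x1(2) V1(1) by blast
    qed
    then have "x \<in> A i j" using x U(2) by blast
    then obtain z' where z': "z' \<in> B i" "z' \<in> X" "p z' = p x" "(x, z') \<in> close_pairs (1 / Suc j)"
      by (auto simp: A_def)
    have "(x, z') \<in> close_pairs d" using z'(4) close_pairs_mono[of "1 / Suc j" d] j by auto
    moreover have "z' \<in> V" using z'(1) i(2) closure_subset by blast
    ultimately show "\<exists>z'\<in>V \<inter> X. p z' = p x \<and> (x, z') \<in> close_pairs d" using z' by blast
  qed
qed

text \<open>By the Kuratowski-Ulam argument a generic pair \<open>(s, s')\<close> in the orbit closure of a pair of a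
  common fibre has a common proximal partner.\<close>

lemma fibre_proximal:
  assumes xy: "x \<in> X" "y \<in> X" "p x = p y"
  shows "proximal_pair T x y"
proof -
  let ?\<Omega> = "closure (orbit TT (u x, u y))"
  have uX: "u x \<in> X" "u y \<in> X" using u xy by auto
  have ap: "almost_periodic TT (u x, u y)" by (rule u_pair[OF xy(1,2)])
  have "UNIV \<inter> ?\<Omega> \<noteq> {}"
    using self_in_closure_orbit[of "(u x, u y)" TT] by (metis Int_UNIV_left empty_iff)
  then obtain t where t: "t \<in> ?\<Omega>" "t \<in> {q. fst q \<in> proximal_dense_points} \<inter> {q. snd q \<in> proximal_dense_points}"
    using comeager_in_dense[OF compact_orbit_pair(1)[OF uX] comeager_in_Int[OF
        comeager_orbit_pair[OF uX ap comeager_proximal_dense_points]] open_UNIV] by metis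
  obtain s s' where ss: "t = (s, s')" by (cases t)
  have "(u x, u y) \<in> fibre_pairs" using u_fibre[OF xy] uX by (simp add: fibre_pairs_def)
  from closure_orbit_pair_subset[OF closed_fibre_pairs this]
  have "(s, s') \<in> fibre_pairs" using t(1) ss by blast
  then have s: "s \<in> X" "s' \<in> X" "p s = p s'" by (auto simp: fibre_pairs_def)
  have dense_close: "\<exists>z'\<in>V \<inter> X. p z' = p s \<and> (r, z') \<in> close_pairs d"
    if "r \<in> {s, s'}" "z \<in> X" "p z = p s" "open V" "z \<in> V" "d > 0" for r z V d
    using t(2) that s(3) by (auto simp: ss proximal_dense_points_def)
  define K where "K = {z \<in> X. p z = p s}"
  have "closed {z \<in> X. p z \<in> {p s}}"
    using continuous_closed_preimage[OF p(1) compact_imp_closed[OF X(1)] closed_singleton[of "p s"]]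
    by (simp add: vimage_def Collect_conj_eq Int_commute)
  then have "closed K" by (simp add: K_def)
  then have "compact K" using compact_Int_closed[OF X(1), of K] by (simp add: K_def Int_absorb1 subset_eq inf.absorb2)
  \<comment> \<open>For r one of s and s', the set \<open>U r j\<close> is open and dense in the
    fibre K by the choice of s and s'. Baire in K then gives one point z proximal to both.\<close>
  define U where "U r j = \<Union>{B. open B \<and> (\<forall>z\<in>B \<inter> X. (r, z) \<in> close_pairs (1 / Suc j))}" for r j
  have "comeager_in K (U r j)" if r: "r \<in> {s, s'}" for r j
  proof (rule comeager_in_open)
    show "open (U r j)" unfolding U_def by blast
    fix V assume V: "open V" "V \<inter> K \<noteq> {}"
    then obtain z where z: "z \<in> V" "z \<in> X" "p z = p s" by (auto simp: K_def)
    obtain z' where z': "z' \<in> V" "z' \<in> X" "p z' = p s" "(r, z') \<in> close_pairs (1 / Suc j)"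
      using dense_close[OF r z(2,3) V(1) z(1), of "1 / Suc j"] by auto
    obtain A B where AB: "open A" "open B" "r \<in> A" "z' \<in> B"
      "\<And>x' y'. x' \<in> A \<Longrightarrow> y' \<in> B \<Longrightarrow> x' \<in> X \<Longrightarrow> y' \<in> X \<Longrightarrow> (x', y') \<in> close_pairs (1 / Suc j)"
      using close_pairs_nbhd[OF z'(4)] by metis
    have "r \<in> X" using r s by auto
    then have "z' \<in> U r j" unfolding U_def using AB by (intro UnionI[of B]) auto
    then show "V \<inter> K \<inter> U r j \<noteq> {}" using z' by (auto simp: K_def)
  qed
  then have "comeager_in K ((\<Inter>j. U s j) \<inter> (\<Inter>j. U s' j))"
    by (intro comeager_in_Int comeager_in_INT) auto
  moreover have "UNIV \<inter> K \<noteq> {}" using s by (auto simp: K_def)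
  ultimately obtain z where z: "z \<in> K" "z \<in> (\<Inter>j. U s j) \<inter> (\<Inter>j. U s' j)"
    using comeager_in_dense[OF \<open>compact K\<close> _ open_UNIV] by metis
  have zX: "z \<in> X" using z by (simp add: K_def)
  have "proximal_pair T r z" if r: "r \<in> {s, s'}" for r
  proof -
    have "(r, z) \<in> close_pairs d" if d: "d > 0" for d
    proof -
      obtain j where j: "1 / Suc j < d" using nat_approx_posE[OF d] by auto
      have "z \<in> U r j" using z(2) r by auto
      then have "(r, z) \<in> close_pairs (1 / Suc j)" using zX unfolding U_def by blast
      then show ?thesis using close_pairs_mono[of "1 / Suc j" d] j by auto
    qed
    then show ?thesis using proximal_iff_close r s zX by blast
  qed
  then have "proximal_pair T s z" "proximal_pair T z s'"
    by (auto simp: proximal_pair_iff dist_commute)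
  then have "proximal_pair T s s'" using proximal_trans s zX by blast
  from diagonal_if_proximal[OF X(1) T(1) TX s(1,2) this]
  obtain a where a: "(a, a) \<in> closure (orbit TT (s, s'))" .
  \<comment> \<open>Since (s, s') is in the orbit closure of (x, y) via the shadow, a diagonal point
    in its orbit closure also serves (x, y).\<close>
  have "(s, s') \<in> closure (orbit TT (x, y))"
    using closure_orbit_trans[OF XX(2,4,3) _ u_orbit[OF xy(1,2)]] t(1) ss xy by auto
  then have "(a, a) \<in> closure (orbit TT (x, y))"
    using closure_orbit_trans[OF XX(2,4,3), of "(x, y)" "(s, s')"] a xy by auto
  then show ?thesis by (rule proximal_pair_if_diagonal)
qed

end

subsection \<open>The natural extension\<close>

definition natural_extension :: "'a set \<Rightarrow> ('a \<Rightarrow> 'a) \<Rightarrow> (nat \<Rightarrow> 'a) set" where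
  "natural_extension X T = {\<xi>. \<forall>i. \<xi> i \<in> X \<and> T (\<xi> (Suc i)) = \<xi> i}"

definition natural_lift :: "('a \<Rightarrow> 'a) \<Rightarrow> (nat \<Rightarrow> 'a) \<Rightarrow> nat \<Rightarrow> 'a" where
  "natural_lift T \<xi> i = (case i of 0 \<Rightarrow> T (\<xi> 0) | Suc j \<Rightarrow> \<xi> j)"

lemma natural_lift_simps [simp]:
  "natural_lift T \<xi> 0 = T (\<xi> 0)" "natural_lift T \<xi> (Suc j) = \<xi> j"
  by (simp_all add: natural_lift_def)

lemma natural_lift_funpow: "(natural_lift T ^^ (n + i)) \<xi> i = (T ^^ n) (\<xi> 0)"
proof (induction i)
  case 0
  show ?case by (induction n) auto
qed simp

text \<open>After n + L steps the coordinates up to L depend on \<xi> only through the n-th iterate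
  of its zeroth coordinate. Closeness in X at time n thus gives closeness upstairs at time n +
  L.\<close>

lemma natural_lift_funpow_le:
  assumes "i \<le> L"
  shows "(natural_lift T ^^ (n + L)) \<xi> i = (T ^^ (L - i)) ((T ^^ n) (\<xi> 0))"
proof -
  have eq: "(L - i + n) + i = n + L" using assms by simp
  have "(natural_lift T ^^ ((L - i + n) + i)) \<xi> i = (T ^^ (L - i + n)) (\<xi> 0)"
    by (rule natural_lift_funpow)
  also have "\<dots> = (T ^^ (L - i)) ((T ^^ n) (\<xi> 0))" by (simp add: funpow_add)
  finally show ?thesis by (simp only: eq)
qed

lemma natural_extension_funpow:
  assumes "\<xi> \<in> natural_extension X T"
  shows "(T ^^ k) (\<xi> (i + k)) = \<xi> i"
proof (induction k)
  case (Suc k)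
  have "(T ^^ Suc k) (\<xi> (i + Suc k)) = (T ^^ k) (T (\<xi> (Suc (i + k))))" by (simp add: funpow_swap1)
  also have "\<dots> = (T ^^ k) (\<xi> (i + k))" using assms by (simp add: natural_extension_def)
  finally show ?case using Suc by simp
qed simp

lemma compact_natural_extension:
  fixes X :: "'a::metric_space set"
  assumes "compact X" "continuous_on X T"
  shows "compact (natural_extension X T)"
proof -
  let ?K = "Pi\<^sub>E UNIV (\<lambda>_::nat. X)"
  have "compactin (product_topology (\<lambda>_::nat. euclidean) UNIV) ?K"
    by (subst compactin_PiE) (use assms in auto)
  then have K: "compact ?K" by (simp add: euclidean_product_topology)
  have "closed {\<xi> \<in> ?K. dist (T (\<xi> (Suc i))) (\<xi> i) = 0}" for i
    by (intro continuous_closed_preimage_constant continuous_on_dist compact_imp_closed[OF K]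
        continuous_on_compose2[OF assms(2)] continuous_on_eval) auto
  then have "closed (\<Inter>i. {\<xi> \<in> ?K. dist (T (\<xi> (Suc i))) (\<xi> i) = 0})" by blast
  from compact_Int_closed[OF K this] show ?thesis
    by (rule back_subst[of compact]) (auto simp: natural_extension_def PiE_iff)
qed

lemma natural_lift_homeo:
  fixes X :: "'a::metric_space set"
  assumes "continuous_on X T" "T ` X \<subseteq> X"
  shows "continuous_on (natural_extension X T) (natural_lift T)"
    "natural_lift T ` natural_extension X T = natural_extension X T"
    "inj_on (natural_lift T) (natural_extension X T)"
proof -
  show "continuous_on (natural_extension X T) (natural_lift T)"
  proof (rule continuous_on_coordinatewise_then_product)
    fix i show "continuous_on (natural_extension X T) (\<lambda>\<xi>. natural_lift T \<xi> i)"
    proof (cases i)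
      case 0
      have "continuous_on (natural_extension X T) (\<lambda>\<xi>. T (\<xi> 0))"
        by (rule continuous_on_compose2[OF assms(1) continuous_on_eval]) (auto simp: natural_extension_def)
      then show ?thesis by (simp add: 0)
    qed (simp add: continuous_on_eval)
  qed
  have "natural_lift T \<xi> \<in> natural_extension X T" if "\<xi> \<in> natural_extension X T" for \<xi>
  proof -
    have "natural_lift T \<xi> i \<in> X \<and> T (natural_lift T \<xi> (Suc i)) = natural_lift T \<xi> i" for i
      using that assms(2) by (cases i) (auto simp: natural_extension_def)
    then show ?thesis by (simp add: natural_extension_def)
  qed
  moreover have "\<xi> \<in> natural_lift T ` natural_extension X T" if "\<xi> \<in> natural_extension X T" for \<xi>
  proof (rule image_eqI)
    show "\<xi> = natural_lift T (\<lambda>i. \<xi> (Suc i))"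
    proof
      fix i show "\<xi> i = natural_lift T (\<lambda>i. \<xi> (Suc i)) i"
        using that by (cases i) (auto simp: natural_extension_def)
    qed
    show "(\<lambda>i. \<xi> (Suc i)) \<in> natural_extension X T" using that by (simp add: natural_extension_def)
  qed
  ultimately show "natural_lift T ` natural_extension X T = natural_extension X T" by blast
  show "inj_on (natural_lift T) (natural_extension X T)"
  proof (rule inj_onI)
    fix \<xi> \<zeta> assume "natural_lift T \<xi> = natural_lift T \<zeta>"
    then have "natural_lift T \<xi> (Suc i) = natural_lift T \<zeta> (Suc i)" for i by simp
    then show "\<xi> = \<zeta>" by (simp add: fun_eq_iff)
  qed
qed

lemma natural_extension_over:
  assumes "T ` X = X" "x \<in> X"
  obtains \<xi> where "\<xi> \<in> natural_extension X T" "\<xi> 0 = x"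
proof -
  define \<xi> where "\<xi> = rec_nat x (\<lambda>_ y. inv_into X T y)"
  have 0: "\<xi> 0 = x" "\<And>i. \<xi> (Suc i) = inv_into X T (\<xi> i)" by (simp_all add: \<xi>_def)
  have X: "\<xi> i \<in> X" for i
    by (induction i) (use assms 0 in \<open>auto simp: inv_into_into\<close>)
  have "T (\<xi> (Suc i)) = \<xi> i" for i
    unfolding 0(2) by (rule f_inv_into_f) (use X assms in auto)
  then show thesis using that[of \<xi>] X 0(1) by (simp add: natural_extension_def)
qed

lemma dist_fun_le:
  fixes d :: real
  assumes "d > 0"
  obtains L e where "e > 0" "\<And>\<xi> \<zeta> :: nat \<Rightarrow> 'a::metric_space.
    (\<And>i. i \<le> L \<Longrightarrow> dist (\<xi> i) (\<zeta> i) \<le> e) \<Longrightarrow> dist \<xi> \<zeta> \<le> d"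
proof -
  \<comment> \<open>The distance is at most twice the largest of the first N + 1 coordinate
    distances, in the order of \<open>from_nat\<close>, plus the tail bound (1/2)^N. Coordinates
    within d/4 and a tail below d/2 add up to at most d.\<close>
  obtain N where N: "(1/2::real) ^ N < d / 2" using real_arch_pow_inv[of "d/2" "1/2"] assms by auto
  define L where "L = Max ((from_nat :: nat \<Rightarrow> nat) ` {..N})"
  show thesis
  proof (rule that[of "d / 4" L])
    fix \<xi> \<zeta> :: "nat \<Rightarrow> 'a" assume *: "\<And>i. i \<le> L \<Longrightarrow> dist (\<xi> i) (\<zeta> i) \<le> d / 4"
    have "dist (\<xi> (from_nat n)) (\<zeta> (from_nat n)) \<le> d / 4" if "n \<le> N" for n
      by (rule *) (use that in \<open>auto simp: L_def\<close>)
    then have "Max {dist (\<xi> (from_nat n)) (\<zeta> (from_nat n)) |n. n \<le> N} \<le> d / 4"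
      by (subst Max_le_iff) auto
    then show "dist \<xi> \<zeta> \<le> d"
      using dist_fun_le_dist_first_terms[of \<xi> \<zeta> N] N by linarith
  qed (use assms in simp)
qed

lemma natural_extension_close:
  fixes X :: "'a::metric_space set"
  assumes X: "compact X" "continuous_on X T" "T ` X \<subseteq> X" and d: "d > 0"
  shows "\<exists>L. \<exists>e>0. \<forall>\<xi>\<in>natural_extension X T. \<forall>\<zeta>\<in>natural_extension X T. \<forall>n.
    dist ((T ^^ n) (\<xi> 0)) ((T ^^ n) (\<zeta> 0)) < e \<longrightarrow>
    dist ((natural_lift T ^^ (n + L)) \<xi>) ((natural_lift T ^^ (n + L)) \<zeta>) \<le> d"
proof -
  obtain L e' where e': "e' > 0" "\<And>\<xi> \<zeta> :: nat \<Rightarrow> 'a.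
    (\<And>i. i \<le> L \<Longrightarrow> dist (\<xi> i) (\<zeta> i) \<le> e') \<Longrightarrow> dist \<xi> \<zeta> \<le> d"
    using dist_fun_le[OF d, where 'a = 'a] by metis
  obtain e where e: "e > 0" "\<forall>x\<in>X. \<forall>y\<in>X. dist x y < e \<longrightarrow> (\<forall>i\<le>L. dist ((T ^^ i) x) ((T ^^ i) y) < e')"
    using equicontinuous_upto[OF X e'(1), of L] by metis
  show ?thesis
  proof (intro exI[of _ L] exI[of _ e] conjI e(1) ballI allI impI)
    fix \<xi> \<zeta> n assume \<xi>: "\<xi> \<in> natural_extension X T" "\<zeta> \<in> natural_extension X T"
      and n: "dist ((T ^^ n) (\<xi> 0)) ((T ^^ n) (\<zeta> 0)) < e"
    have X0: "(T ^^ n) (\<xi> 0) \<in> X" "(T ^^ n) (\<zeta> 0) \<in> X"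
      using \<xi> by (auto intro!: funpow_in[OF X(3)] simp: natural_extension_def)
    show "dist ((natural_lift T ^^ (n + L)) \<xi>) ((natural_lift T ^^ (n + L)) \<zeta>) \<le> d"
    proof (rule e'(2))
      fix i assume i: "i \<le> L"
      have "dist ((T ^^ (L - i)) ((T ^^ n) (\<xi> 0))) ((T ^^ (L - i)) ((T ^^ n) (\<zeta> 0))) < e'"
        using e(2) X0 n by auto
      then show "dist ((natural_lift T ^^ (n + L)) \<xi> i) ((natural_lift T ^^ (n + L)) \<zeta> i) \<le> e'"
        by (simp add: natural_lift_funpow_le[OF i])
    qed
  qed
qed

text \<open>Proximality ignores the past: going up costs a delay of L steps, and going down is
  uniform continuity of the zeroth coordinate.\<close>

lemma natural_extension_proximal:
  fixes X :: "'a::metric_space set"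
  assumes X: "compact X" "continuous_on X T" "T ` X \<subseteq> X"
    and \<xi>: "\<xi> \<in> natural_extension X T" "\<zeta> \<in> natural_extension X T"
  shows "proximal_pair (natural_lift T) \<xi> \<zeta> \<longleftrightarrow> proximal_pair T (\<xi> 0) (\<zeta> 0)"
proof
  assume prox: "proximal_pair T (\<xi> 0) (\<zeta> 0)"
  show "proximal_pair (natural_lift T) \<xi> \<zeta>"
    unfolding proximal_pair_iff
  proof (intro allI impI)
    fix d :: real assume "d > 0"
    then have d: "d / 2 > 0" by simp
    from natural_extension_close[OF X d] obtain L e where e: "e > 0" "\<And>n.
      dist ((T ^^ n) (\<xi> 0)) ((T ^^ n) (\<zeta> 0)) < e \<Longrightarrow>
      dist ((natural_lift T ^^ (n + L)) \<xi>) ((natural_lift T ^^ (n + L)) \<zeta>) \<le> d / 2"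
      using \<xi> by metis
    obtain n where "dist ((T ^^ n) (\<xi> 0)) ((T ^^ n) (\<zeta> 0)) < e"
      using prox e(1) unfolding proximal_pair_iff by blast
    then have "dist ((natural_lift T ^^ (n + L)) \<xi>) ((natural_lift T ^^ (n + L)) \<zeta>) < d"
      using e(2)[of n] d by linarith
    then show "\<exists>n. dist ((natural_lift T ^^ n) \<xi>) ((natural_lift T ^^ n) \<zeta>) < d" by (rule exI)
  qed
next
  assume prox: "proximal_pair (natural_lift T) \<xi> \<zeta>"
  have "uniformly_continuous_on (natural_extension X T) (\<lambda>\<xi>. \<xi> 0)"
    by (rule compact_uniformly_continuous[OF continuous_on_eval compact_natural_extension[OF X(1,2)]])
  show "proximal_pair T (\<xi> 0) (\<zeta> 0)"
    unfolding proximal_pair_iff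
  proof (intro allI impI)
    fix d :: real assume "d > 0"
    then obtain e where e: "e > 0" "\<And>\<alpha> \<beta>. \<alpha> \<in> natural_extension X T \<Longrightarrow> \<beta> \<in> natural_extension X T \<Longrightarrow>
        dist \<beta> \<alpha> < e \<Longrightarrow> dist (\<beta> 0) (\<alpha> 0) < d"
      using \<open>uniformly_continuous_on _ _\<close> unfolding uniformly_continuous_on_def by metis
    obtain n where "dist ((natural_lift T ^^ n) \<xi>) ((natural_lift T ^^ n) \<zeta>) < e"
      using prox e(1) unfolding proximal_pair_iff by blast
    moreover have "(natural_lift T ^^ n) \<theta> \<in> natural_extension X T" if "\<theta> \<in> natural_extension X T" for \<theta>
      by (rule funpow_in[OF _ that]) (use natural_lift_homeo(2)[OF X(2,3)] in simp)
    ultimately have "dist ((natural_lift T ^^ n) \<xi> 0) ((natural_lift T ^^ n) \<zeta> 0) < d"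
      using e(2) \<xi> by blast
    then have "dist ((T ^^ n) (\<xi> 0)) ((T ^^ n) (\<zeta> 0)) < d"
      using natural_lift_funpow[where i = 0 and n = n and T = T] by simp
    then show "\<exists>n. dist ((T ^^ n) (\<xi> 0)) ((T ^^ n) (\<zeta> 0)) < d" by (rule exI)
  qed
qed

text \<open>The target is the L-th coordinate of \<zeta>, its past, rather than \<zeta> 0: once the
  orbit in X is close to \<zeta> L, the next L steps reproduce all coordinates of \<zeta> up to
  L.\<close>

lemma natural_extension_dense:
  fixes X :: "'a::metric_space set"
  assumes X: "compact X" "continuous_on X T" "T ` X \<subseteq> X"
    and dense: "\<And>x V. x \<in> X \<Longrightarrow> open V \<Longrightarrow> V \<inter> X \<noteq> {} \<Longrightarrow> \<exists>n. (T ^^ n) x \<in> V"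
    and \<xi>: "\<xi> \<in> natural_extension X T" and V: "open V" "V \<inter> natural_extension X T \<noteq> {}"
  shows "\<exists>n. (natural_lift T ^^ n) \<xi> \<in> V"
proof -
  obtain \<zeta> where \<zeta>: "\<zeta> \<in> V" "\<zeta> \<in> natural_extension X T" using V(2) by blast
  obtain d where d: "d > 0" "ball \<zeta> d \<subseteq> V" using V(1) \<zeta>(1) by (meson open_contains_ball)
  have d2: "d / 2 > 0" using d by simp
  obtain L e' where e': "e' > 0" "\<And>\<xi> \<zeta> :: nat \<Rightarrow> 'a.
    (\<And>i. i \<le> L \<Longrightarrow> dist (\<xi> i) (\<zeta> i) \<le> e') \<Longrightarrow> dist \<xi> \<zeta> \<le> d / 2"
    using dist_fun_le[OF d2, where 'a = 'a] by metis
  obtain e where e: "e > 0" "\<forall>x\<in>X. \<forall>y\<in>X. dist x y < e \<longrightarrow> (\<forall>i\<le>L. dist ((T ^^ i) x) ((T ^^ i) y) < e')"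
    using equicontinuous_upto[OF X e'(1), of L] by metis
  have \<xi>X: "\<xi> 0 \<in> X" "\<zeta> L \<in> X" using \<xi> \<zeta> by (auto simp: natural_extension_def)
  have "\<zeta> L \<in> ball (\<zeta> L) e \<inter> X" using e(1) \<xi>X by simp
  then obtain n where n: "(T ^^ n) (\<xi> 0) \<in> ball (\<zeta> L) e" using dense[OF \<xi>X(1) open_ball] by blast
  have "dist \<zeta> ((natural_lift T ^^ (n + L)) \<xi>) \<le> d / 2"
  proof (rule e'(2))
    fix i assume i: "i \<le> L"
    note natural_lift_funpow_le[OF i, of n T \<xi>]
    moreover have "\<zeta> i = (T ^^ (L - i)) (\<zeta> L)"
      using natural_extension_funpow[OF \<zeta>(2), of "L - i" i] i by simp
    moreover have "dist ((T ^^ (L - i)) (\<zeta> L)) ((T ^^ (L - i)) ((T ^^ n) (\<xi> 0))) < e'"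
      using e(2) \<xi>X(2) funpow_in[OF X(3) \<xi>X(1), of n] n by auto
    ultimately show "dist (\<zeta> i) ((natural_lift T ^^ (n + L)) \<xi> i) \<le> e'" by simp
  qed
  then have "(natural_lift T ^^ (n + L)) \<xi> \<in> ball \<zeta> d" using d2 by simp
  then show ?thesis using d(2) by blast
qed

text \<open>The delay L is added to the window, and e/2 is used downstairs because
  \<open>natural_extension_close\<close> asks for a strict bound.\<close>

lemma natural_extension_syndetically_close:
  fixes X :: "'a::metric_space set"
  assumes X: "compact X" "continuous_on X T" "T ` X \<subseteq> X" and d: "d > 0"
    and nonsensitive: "\<And>d. d > 0 \<Longrightarrow>
      \<exists>e>0. \<forall>x\<in>X. \<forall>y\<in>X. dist x y < e \<longrightarrow> (\<exists>m. syndetically_close T d m x y)"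
  shows "\<exists>e>0. \<forall>\<xi>\<in>natural_extension X T. \<forall>\<zeta>\<in>natural_extension X T. dist \<xi> \<zeta> < e \<longrightarrow>
    (\<exists>m. syndetically_close (natural_lift T) d m \<xi> \<zeta>)"
proof -
  from natural_extension_close[OF X d] obtain L e where e: "e > 0"
    "\<forall>\<xi>\<in>natural_extension X T. \<forall>\<zeta>\<in>natural_extension X T. \<forall>n.
      dist ((T ^^ n) (\<xi> 0)) ((T ^^ n) (\<zeta> 0)) < e \<longrightarrow>
      dist ((natural_lift T ^^ (n + L)) \<xi>) ((natural_lift T ^^ (n + L)) \<zeta>) \<le> d" by metis
  then have "e / 2 > 0" by simp
  from nonsensitive[OF this] obtain e1 where e1: "e1 > 0"
    "\<forall>x\<in>X. \<forall>y\<in>X. dist x y < e1 \<longrightarrow> (\<exists>m. syndetically_close T (e / 2) m x y)" by metis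
  have "uniformly_continuous_on (natural_extension X T) (\<lambda>\<xi>. \<xi> 0)"
    by (rule compact_uniformly_continuous[OF continuous_on_eval compact_natural_extension[OF X(1,2)]])
  then obtain e2 where e2: "e2 > 0" "\<And>\<alpha> \<beta>. \<alpha> \<in> natural_extension X T \<Longrightarrow> \<beta> \<in> natural_extension X T \<Longrightarrow>
        dist \<beta> \<alpha> < e2 \<Longrightarrow> dist (\<beta> 0) (\<alpha> 0) < e1"
    using e1(1) unfolding uniformly_continuous_on_def by metis
  show ?thesis
  proof (intro exI[of _ e2] conjI e2(1) ballI impI)
    fix \<xi> \<zeta> assume \<xi>: "\<xi> \<in> natural_extension X T" "\<zeta> \<in> natural_extension X T" "dist \<xi> \<zeta> < e2"
    then have "dist (\<xi> 0) (\<zeta> 0) < e1" using e2(2) by blast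
    moreover have "\<xi> 0 \<in> X" "\<zeta> 0 \<in> X" using \<xi> by (auto simp: natural_extension_def)
    ultimately obtain m where m: "syndetically_close T (e / 2) m (\<xi> 0) (\<zeta> 0)" using e1(2) by blast
    have "syndetically_close (natural_lift T) d (m + L) \<xi> \<zeta>"
      unfolding syndetically_close_def
    proof
      fix k
      obtain i where i: "i \<le> m" "dist ((T ^^ (k + i)) (\<xi> 0)) ((T ^^ (k + i)) (\<zeta> 0)) \<le> e / 2"
        using m unfolding syndetically_close_def by blast
      then have "dist ((T ^^ (k + i)) (\<xi> 0)) ((T ^^ (k + i)) (\<zeta> 0)) < e" using e(1) by linarith
      then have "dist ((natural_lift T ^^ (k + i + L)) \<xi>) ((natural_lift T ^^ (k + i + L)) \<zeta>) \<le> d"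
        using e(2) \<xi>(1,2) by blast
      then show "\<exists>i\<le>m + L. dist ((natural_lift T ^^ (k + i)) \<xi>) ((natural_lift T ^^ (k + i)) \<zeta>) \<le> d"
        using i(1) by (intro exI[of _ "i + L"]) (simp add: add.assoc)
    qed
    then show "\<exists>m. syndetically_close (natural_lift T) d m \<xi> \<zeta>" by (rule exI)
  qed
qed

subsection \<open>The dichotomy\<close>

lemma minimal_dense:
  assumes "minimal X T" "x \<in> X" "open V" "V \<inter> X \<noteq> {}"
  shows "\<exists>n. (T ^^ n) x \<in> V"
proof -
  obtain y where y: "y \<in> V" "y \<in> X" using assms(4) by blast
  then have "y \<in> closure (orbit T x)" using assms(1,2) by (simp add: minimal_def)
  then show ?thesis using y(1) assms(3) unfolding in_closure_orbit_iff by blast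
qed

text \<open>Insensitivity at scale d concerns one open set U. By minimality its preimages under the
  iterates cover X, and a Lebesgue number e of this cover sends any two e-close points into U at a
  common time.\<close>

lemma not_sensitive_syndetically_close:
  fixes X :: "'a::metric_space set"
  assumes X: "compact X" "continuous_on X T" "T ` X \<subseteq> X" "minimal X T"
    and "\<not> strongly_Ft_sensitive X T" "d > 0"
  shows "\<exists>e>0. \<forall>x\<in>X. \<forall>y\<in>X. dist x y < e \<longrightarrow> (\<exists>m. syndetically_close T d m x y)"
proof -
  obtain U where U: "open U" "U \<inter> X \<noteq> {}"
    "\<And>x y. x \<in> U \<inter> X \<Longrightarrow> y \<in> U \<inter> X \<Longrightarrow> \<not> thick {n. dist ((T ^^ n) x) ((T ^^ n) y) > d}"
    using assms(5,6) unfolding strongly_Ft_sensitive_def by metis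
  have synd: "\<exists>m. syndetically_close T d m x y" if xy: "x \<in> U \<inter> X" "y \<in> U \<inter> X" for x y
  proof -
    obtain L where L: "\<And>k. \<not> {k..<k + L} \<subseteq> {n. dist ((T ^^ n) x) ((T ^^ n) y) > d}"
      using U(3)[OF xy] unfolding thick_def by blast
    have "syndetically_close T d L x y"
      unfolding syndetically_close_def
    proof
      fix k
      obtain n where n: "n \<in> {k..<k + L}" "\<not> dist ((T ^^ n) x) ((T ^^ n) y) > d"
        using L[of k] by blast
      then have "n - k \<le> L" "k + (n - k) = n" by auto
      then show "\<exists>i\<le>L. dist ((T ^^ (k + i)) x) ((T ^^ (k + i)) y) \<le> d"
        using n(2) by (intro exI[of _ "n - k"]) simp
    qed
    then show ?thesis by (rule exI)
  qed
  have "\<exists>W. open W \<and> W \<inter> X = {x \<in> X. (T ^^ n) x \<in> U}" for n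
    using openin_preimage_open[OF continuous_on_funpow[OF X(2,3)] U(1)] by metis
  then obtain W where W: "\<And>n. open (W n)" "\<And>n. W n \<inter> X = {x \<in> X. (T ^^ n) x \<in> U}" by metis
  have "X \<subseteq> \<Union>(range W)"
  proof
    fix x assume x: "x \<in> X"
    then obtain n where "(T ^^ n) x \<in> U" using minimal_dense[OF X(4) x U(1,2)] by blast
    then have "x \<in> W n \<inter> X" using W(2) x by simp
    then show "x \<in> \<Union>(range W)" by blast
  qed
  then obtain e where e: "e > 0" "\<forall>x\<in>X. \<exists>G\<in>range W. ball x e \<subseteq> G"
    using Heine_Borel_lemma[OF X(1), of "range W"] W(1) by (metis imageE)
  show ?thesis
  proof (intro exI[of _ e] conjI e(1) ballI impI)
    fix x y assume xy: "x \<in> X" "y \<in> X" "dist x y < e"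
    then obtain n where n: "ball x e \<subseteq> W n" using e(2) by blast
    then have "x \<in> W n \<inter> X" "y \<in> W n \<inter> X" using xy e(1) by auto
    then have "(T ^^ n) x \<in> U \<inter> X" "(T ^^ n) y \<in> U \<inter> X" using W(2) funpow_in[OF X(3)] xy by auto
    then obtain m where "syndetically_close T d m ((T ^^ n) x) ((T ^^ n) y)" using synd by blast
    then show "\<exists>m. syndetically_close T d m x y" using syndetically_close_funpow by blast
  qed
qed

text \<open>The factor map is pulled back along the zeroth coordinate. The point that needs an
  argument is that its fibres still form the smallest relation of the required kind: a relation on
  the natural extension is projected to X, compared there, and then recovered.\<close>

lemma not_sensitive_imp_proximal:
  fixes X :: "'a::metric_space set" and Y :: "'b::metric_space set"
  assumes "minimal X T" and max: "maximal_distal_factor X T Y S p"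
    and "\<not> strongly_Ft_sensitive X T"
  shows "proximal_factor_map X T p"
proof -
  have X: "compact X" "continuous_on X T" "T ` X = X" "X \<noteq> {}"
    and Y: "compact Y" "continuous_on Y S" "S ` Y = Y" "distal Y S"
    and p: "continuous_on X p" "p ` X = Y" "\<And>x. x \<in> X \<Longrightarrow> p (T x) = S (p x)"
    using assms(1,2) by (auto simp: maximal_distal_factor_def factor_map_def TDS_def minimal_def)
  have TX: "T ` X \<subseteq> X" and SY: "S ` Y \<subseteq> Y" using X(3) Y(3) by auto
  note close = not_sensitive_syndetically_close[OF X(1,2) TX assms(1,3)]
  let ?N = "natural_extension X T" and ?F = "natural_lift T"
  note N = compact_natural_extension[OF X(1,2)] and F = natural_lift_homeo[OF X(2) TX]
  have FN: "?F ` ?N \<subseteq> ?N" using F(2) by simp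
  have N0: "\<And>\<xi>. \<xi> \<in> ?N \<Longrightarrow> \<xi> 0 \<in> X" by (simp add: natural_extension_def)
  have N0X: "(\<lambda>\<xi>. \<xi> 0) ` ?N = X"
    using N0 natural_extension_over[OF X(3)] by (metis (no_types, lifting) image_eqI image_subsetI subsetI subset_antisym)
  \<comment> \<open>Two points with equal images are at distance 0 at time 1, hence proximal, which
    distality forbids for distinct points.\<close>
  have injS: "inj_on S Y"
  proof (rule inj_onI, rule ccontr)
    fix y y' assume y: "y \<in> Y" "y' \<in> Y" "S y = S y'" "y \<noteq> y'"
    then have "proximal_pair S y y'" unfolding proximal_pair_iff by (intro allI impI exI[of _ 1]) simp
    then show False using Y(4) y by (auto simp: distal_def)
  qed
  have p0: "continuous_on ?N (\<lambda>\<xi>. p (\<xi> 0))"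
    by (rule continuous_on_compose2[OF p(1) continuous_on_eval]) (use N0 in auto)
  have pF: "p (?F \<xi> 0) = S (p (\<xi> 0))" if "\<xi> \<in> ?N" for \<xi> using p(3) N0[OF that] by simp
  have prox_fibre: "p (\<xi> 0) = p (\<zeta> 0)" if "\<xi> \<in> ?N" "\<zeta> \<in> ?N" "proximal_pair ?F \<xi> \<zeta>" for \<xi> \<zeta>
  proof -
    have "proximal_pair T (\<xi> 0) (\<zeta> 0)" using natural_extension_proximal[OF X(1,2) TX that(1,2)] that(3) by simp
    from diagonal_if_proximal[OF X(1,2) TX N0[OF that(1)] N0[OF that(2)] this]
    obtain a where a: "(a, a) \<in> closure (orbit (map_prod T T) (\<xi> 0, \<zeta> 0))" .
    have W: "closed (X \<times> X)" "map_prod T T ` (X \<times> X) \<subseteq> X \<times> X"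
      using compact_imp_closed[OF compact_Times[OF X(1,1)]] map_prod_invariant[OF TX TX] by auto
    have eq: "map_prod p p (map_prod T T w) = map_prod S S (map_prod p p w)" if "w \<in> X \<times> X" for w
      using that p(3) by auto
    have "map_prod p p ` closure (orbit (map_prod T T) (\<xi> 0, \<zeta> 0))
        \<subseteq> closure (orbit (map_prod S S) (map_prod p p (\<xi> 0, \<zeta> 0)))"
      using image_closure_orbit_subset[where W = "X \<times> X" and F = "map_prod T T" and S = "map_prod S S"
          and \<phi> = "map_prod p p" and w = "(\<xi> 0, \<zeta> 0)", OF W _ continuous_on_map_prod[OF p(1,1)] eq]
        N0 that by simp
    then have "(p a, p a) \<in> closure (orbit (map_prod S S) (p (\<xi> 0), p (\<zeta> 0)))"
      using imageI[OF a, of "map_prod p p"] by auto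
    then have "proximal_pair S (p (\<xi> 0)) (p (\<zeta> 0))" by (rule proximal_pair_if_diagonal)
    moreover have "p (\<xi> 0) \<in> Y" "p (\<zeta> 0) \<in> Y" using N0 that p(2) by auto
    ultimately show ?thesis using Y(4) unfolding distal_def by metis
  qed
  have fibre: "(\<xi>, \<zeta>) \<in> R"
    if R: "closed R" "equiv ?N R" "\<And>x y. (x, y) \<in> R \<Longrightarrow> (?F x, ?F y) \<in> R"
      "\<And>x y. x \<in> ?N \<Longrightarrow> y \<in> ?N \<Longrightarrow> proximal_pair ?F x y \<Longrightarrow> (x, y) \<in> R"
      and \<xi>: "\<xi> \<in> ?N" "\<zeta> \<in> ?N" "p (\<xi> 0) = p (\<zeta> 0)" for R \<xi> \<zeta>
  proof -
    have RN: "R \<subseteq> ?N \<times> ?N" using R(2) by (simp add: equiv_def)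
    have sym: "(y, x) \<in> R" if "(x, y) \<in> R" for x y using R(2) that by (meson equivE symD)
    have trans: "(x, z) \<in> R" if "(x, y) \<in> R" "(y, z) \<in> R" for x y z
      using R(2) that by (meson equivE transD)
    \<comment> \<open>Sequences with the same zeroth coordinate are proximal, so R is determined by
      its projection to that coordinate.\<close>
    have same: "(x, y) \<in> R" if "x \<in> ?N" "y \<in> ?N" "x 0 = y 0" for x y
    proof (rule R(4)[OF that(1,2)])
      have "proximal_pair T (x 0) (y 0)" unfolding proximal_pair_iff using that(3) by simp
      then show "proximal_pair ?F x y" using natural_extension_proximal[OF X(1,2) TX that(1,2)] by simp
    qed
    define R0 where "R0 = (\<lambda>q. (fst q 0, snd q 0)) ` R"
    have R0: "(x, y) \<in> R0 \<longleftrightarrow> (\<exists>\<xi> \<zeta>. (\<xi>, \<zeta>) \<in> R \<and> x = \<xi> 0 \<and> y = \<zeta> 0)" for x y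
      unfolding R0_def by force
    have "compact R"
      using compact_Int_closed[OF compact_Times[OF N N] R(1)] RN by (simp add: inf.absorb2)
    moreover have "continuous_on R (\<lambda>q. fst q 0)" "continuous_on R (\<lambda>q. snd q 0)"
      by (rule continuous_on_compose2[OF continuous_on_eval[of UNIV 0]];
          simp add: continuous_on_fst continuous_on_snd continuous_on_id)+
    ultimately have "compact R0" unfolding R0_def
      by (intro compact_continuous_image continuous_on_Pair)
    then have "closed R0" by (rule compact_imp_closed)
    moreover have "equiv X R0"
    proof (rule equivI)
      show "R0 \<subseteq> X \<times> X"
      proof
        fix q assume "q \<in> R0"
        then obtain r where "r \<in> R" "q = (fst r 0, snd r 0)" unfolding R0_def by blast
        moreover have "fst r \<in> ?N" "snd r \<in> ?N" if "r \<in> R" for r using that RN by auto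
        ultimately show "q \<in> X \<times> X" using N0 by simp
      qed
      show "refl_on X R0"
      proof (rule refl_onI)
        fix x assume "x \<in> X"
        then obtain \<theta> where "\<theta> \<in> ?N" "\<theta> 0 = x" using natural_extension_over[OF X(3)] by metis
        then show "(x, x) \<in> R0" unfolding R0 using same by blast
      qed
      show "sym R0" using sym unfolding sym_def R0 by blast
      show "trans R0"
      proof (rule transI)
        fix x y z assume "(x, y) \<in> R0" "(y, z) \<in> R0"
        then obtain \<alpha> \<beta> \<beta>' \<gamma> where *: "(\<alpha>, \<beta>) \<in> R" "(\<beta>', \<gamma>) \<in> R" "x = \<alpha> 0" "y = \<beta> 0" "y = \<beta>' 0" "z = \<gamma> 0"
          unfolding R0 by metis
        \<comment> \<open>The two lifted pairs share only the zeroth coordinate of their middle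
          terms; \<open>same\<close> joins \<beta> to \<beta>'.\<close>
        have "\<beta> \<in> ?N" "\<beta>' \<in> ?N" using *(1,2) RN by auto
        then have "(\<beta>, \<beta>') \<in> R" using same *(4,5) by simp
        then have "(\<alpha>, \<gamma>) \<in> R" using trans[OF trans[OF *(1)] *(2)] by simp
        then show "(x, z) \<in> R0" unfolding R0 using * by metis
      qed
    qed
    moreover have "(T x, T y) \<in> R0" if xy: "(x, y) \<in> R0" for x y
    proof -
      obtain \<alpha> \<beta> where "(\<alpha>, \<beta>) \<in> R" "x = \<alpha> 0" "y = \<beta> 0" using xy unfolding R0 by metis
      then show ?thesis unfolding R0 using R(3) by (metis natural_lift_simps(1))
    qed
    moreover have "(x, y) \<in> R0" if xy: "x \<in> X" "y \<in> X" "proximal_pair T x y" for x y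
    proof -
      obtain \<alpha> where a: "\<alpha> \<in> ?N" "\<alpha> 0 = x" using natural_extension_over[OF X(3) xy(1)] .
      obtain \<beta> where b: "\<beta> \<in> ?N" "\<beta> 0 = y" using natural_extension_over[OF X(3) xy(2)] .
      have "proximal_pair ?F \<alpha> \<beta>" using natural_extension_proximal[OF X(1,2) TX a(1) b(1)] xy(3) a b by simp
      then show ?thesis unfolding R0 using R(4) a b by metis
    qed
    ultimately have "(\<xi> 0, \<zeta> 0) \<in> R0"
      by (rule maximal_distal_factor_fibre[OF max]) (use \<xi> N0 in auto)
    then obtain \<alpha> \<beta> where ab: "(\<alpha>, \<beta>) \<in> R" "\<xi> 0 = \<alpha> 0" "\<zeta> 0 = \<beta> 0" unfolding R0 by metis
    have "\<alpha> \<in> ?N" "\<beta> \<in> ?N" using ab(1) RN by auto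
    then have "(\<xi>, \<alpha>) \<in> R" "(\<beta>, \<zeta>) \<in> R" using same \<xi> ab by simp_all
    then show ?thesis using trans[OF trans[OF _ ab(1)]] by simp
  qed
  obtain u where u: "\<And>x. x \<in> ?N \<Longrightarrow> u x \<in> ?N" "\<And>x. u (u x) = u x"
    "\<And>x. x \<in> ?N \<Longrightarrow> u (?F x) = ?F (u x)"
    "\<And>x y. x \<in> ?N \<Longrightarrow> y \<in> ?N \<Longrightarrow> (u x, u y) \<in> closure (orbit (map_prod ?F ?F) (x, y))"
    "\<And>x y. x \<in> ?N \<Longrightarrow> y \<in> ?N \<Longrightarrow> almost_periodic (map_prod ?F ?F) (u x, u y)"
    "\<And>x y z. x \<in> ?N \<Longrightarrow> y \<in> ?N \<Longrightarrow> z \<in> ?N \<Longrightarrow>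
       (u x, u y, u z) \<in> closure (orbit (map_triple ?F) (x, y, z))"
    "\<And>x y z. x \<in> ?N \<Longrightarrow> y \<in> ?N \<Longrightarrow> z \<in> ?N \<Longrightarrow> almost_periodic (map_triple ?F) (u x, u y, u z)"
    using ellis_retraction[OF N F(1) FN] by blast
  have Nne: "?N \<noteq> {}" using X(4) N0X by auto
  have p0N: "(\<lambda>\<xi>. p (\<xi> 0)) ` ?N = Y" using N0X p(2) by (metis image_image)
  have dense: "\<exists>n. (?F ^^ n) \<xi> \<in> V" if "\<xi> \<in> ?N" "open V" "V \<inter> ?N \<noteq> {}" for \<xi> V
    by (rule natural_extension_dense[OF X(1,2) TX minimal_dense[OF assms(1)] that])
  have close': "\<exists>e>0. \<forall>\<xi>\<in>?N. \<forall>\<zeta>\<in>?N. dist \<xi> \<zeta> < e \<longrightarrow> (\<exists>m. syndetically_close ?F d m \<xi> \<zeta>)"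
    if "d > 0" for d
    by (rule natural_extension_syndetically_close[OF X(1,2) TX that close])
  have N_proximal: "proximal_pair ?F \<alpha> \<beta>" if "\<alpha> \<in> ?N" "\<beta> \<in> ?N" "p (\<alpha> 0) = p (\<beta> 0)" for \<alpha> \<beta>
  proof -
    interpret nonsensitive_factor ?N ?F Y S "\<lambda>\<xi>. p (\<xi> 0)" u
      by (unfold_locales; fact N Nne F dense Y(1,2,3) injS p0 p0N pF close' prox_fibre fibre u)
    show ?thesis by (rule fibre_proximal[OF that])
  qed
  show ?thesis
    unfolding proximal_factor_map_def
  proof (intro ballI impI)
    fix x y assume xy: "x \<in> X" "y \<in> X" "p x = p y"
    obtain \<alpha> where a: "\<alpha> \<in> ?N" "\<alpha> 0 = x" using natural_extension_over[OF X(3) xy(1)] .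
    obtain \<beta> where b: "\<beta> \<in> ?N" "\<beta> 0 = y" using natural_extension_over[OF X(3) xy(2)] .
    have "proximal_pair ?F \<alpha> \<beta>" using N_proximal[OF a(1) b(1)] a b xy(3) by simp
    then show "proximal_pair T x y"
      using natural_extension_proximal[OF X(1,2) TX a(1) b(1)] a b by simp
  qed
qed

theorem theoremD:
  fixes X :: "'a::metric_space set" and T :: "'a \<Rightarrow> 'a"
    and XD :: "'b::metric_space set" and S :: "'b \<Rightarrow> 'b" and \<pi> :: "'a \<Rightarrow> 'b"
  assumes "TDS X T" and "minimal X T" and "maximal_distal_factor X T XD S \<pi>"
  shows "strongly_Ft_sensitive X T \<longleftrightarrow> \<not> proximal_factor_map X T \<pi>"
proof
  assume "strongly_Ft_sensitive X T"
  then show "\<not> proximal_factor_map X T \<pi>"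
    using assms(2,3) strongly_sensitive_imp_not_proximal[of X T XD S \<pi>]
    by (simp add: minimal_def maximal_distal_factor_def)
next
  assume "\<not> proximal_factor_map X T \<pi>"
  then show "strongly_Ft_sensitive X T"
    using not_sensitive_imp_proximal[OF assms(2,3)] by blast
qed

end
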